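(* Let $n\ge3$ and consider the net $\mathcal{L}=\{xX+yY+zZ\}$ spanned by linearly independent $X,Y,Z\in\mathbb{S}^n$. The Chow matrix of $(X,Y,Z)$ is singular if and only if $\mathcal{L}\setminus\{{\bf 0}_n\}$ contains a matrix of rank $\le n-2$. So the determinant of the Chow matrix is (up to a nonzero constant) the Chow form, written in dual Stiefel coordinates, of the subvariety of $\mathbb{P}(\mathbb{S}^n)$ defined by the $(n-1)\times(n-1)$-minors.
   Context: $\mathbb{S}^n$ is the space of symmetric $n\times n$ matrices over $\mathbb{C}$. Chow matrix: let $x,y,z$ be unknowns. The Chow matrix is the square matrix of size $\binom{n+1}{2}$ whose columns are labeled by the monomials of degree $n-1$ in $x,y,z$ and whose rows are labeled by pairs $(i,j)$ with $1\le i\le j\le n$; the row indexed by $(i,j)$ consists of the coefficients of the $(i,j)$ entry of the adjoint (adjugate) matrix of $xX+yY+zZ$, a homogeneous polynomial of degree $n-1$ in $x,y,z$. So the entries of the Chow matrix are homogeneous polynomials of degree $n-1$ in the entries of $X,Y,Z$. Chow form: for an irreducible projective variety $V\subset\mathbb{P}^N$ of codimension $c$, the linear subspaces of projective dimension $c-1$ that meet $V$ form an irreducible hypersurface in the Grassmannian, and the Chow form is its (irreducible) defining polynomial, unique up to a nonzero scalar. When the linear space is expressed as the row space of a matrix, the entries of that matrix are its dual Stiefel coordinates. Here $V$ is the variety of symmetric matrices of rank $\le n-2$ (codimension $3$), and the linear spaces are the projective planes $\mathbb{P}(\mathcal{L})$, with dual Stiefel coordinates the entries of $X,Y,Z$.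 *)

theory Defs
  imports
    "Jordan_Normal_Form.Determinant"
    "Jordan_Normal_Form.DL_Rank"
    "Jordan_Normal_Form.DL_Submatrix"
    "HOL-Library.Poly_Mapping"
    "HOL-Computational_Algebra.Factorial_Ring"
begin

subsection \<open>Polynomials in several unknowns\<close>

text \<open>A polynomial with unknowns in \<open>'v\<close> maps each exponent vector to its coefficient; the
  commutative ring structure is that of the finitely supported functions.\<close>

type_synonym ('v, 'a) polys = "('v \<Rightarrow>\<^sub>0 nat) \<Rightarrow>\<^sub>0 'a"

definition Const :: "'a::zero \<Rightarrow> ('v, 'a) polys" where
  "Const c = Poly_Mapping.single 0 c"

definition Var :: "'v \<Rightarrow> ('v, 'a::zero_neq_one) polys" where
  "Var v = Poly_Mapping.single (Poly_Mapping.single v 1) 1"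

definition poly_vars :: "('v, 'a::zero) polys \<Rightarrow> 'v set" where
  "poly_vars F = (\<Union>m \<in> Poly_Mapping.keys F. Poly_Mapping.keys m)"

definition poly_value :: "('v \<Rightarrow> 'a) \<Rightarrow> ('v, 'a::comm_semiring_1) polys \<Rightarrow> 'a" where
  "poly_value \<alpha> F = (\<Sum>m \<in> Poly_Mapping.keys F.
     Poly_Mapping.lookup F m * (\<Prod>v \<in> Poly_Mapping.keys m. \<alpha> v ^ Poly_Mapping.lookup m v))"


subsection \<open>The Chow matrix\<close>

text \<open>The unknowns \<open>x\<close>, \<open>y\<close>, \<open>z\<close> are \<open>Var 0\<close>, \<open>Var 1\<close>, \<open>Var 2\<close>. The coefficient ring is
  arbitrary, so that \<open>X\<close>, \<open>Y\<close>, \<open>Z\<close> may be complex matrices as well as matrices of unknowns.\<close>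

definition net_mat :: "'a::comm_ring_1 mat \<Rightarrow> 'a mat \<Rightarrow> 'a mat \<Rightarrow> (nat, 'a) polys mat" where
  "net_mat X Y Z =
     Var 0 \<cdot>\<^sub>m map_mat Const X + Var 1 \<cdot>\<^sub>m map_mat Const Y + Var 2 \<cdot>\<^sub>m map_mat Const Z"

text \<open>The pairs \<open>(i,j)\<close> with \<open>i \<le> j < n\<close> (indices start at 0), and the exponent vectors of the
  monomials of degree \<open>d\<close> in \<open>x\<close>, \<open>y\<close>, \<open>z\<close>, each listed once. The orders chosen affect the
  determinant of the Chow matrix only by a sign.\<close>

definition upper_pairs :: "nat \<Rightarrow> (nat \<times> nat) list" where
  "upper_pairs n = concat (map (\<lambda>j. map (\<lambda>i. (i, j)) [0..<Suc j]) [0..<n])"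

definition ternary_monoms :: "nat \<Rightarrow> (nat \<Rightarrow>\<^sub>0 nat) list" where
  "ternary_monoms d = concat (map (\<lambda>a. map (\<lambda>b.
      Poly_Mapping.single 0 a + Poly_Mapping.single 1 b + Poly_Mapping.single 2 (d - a - b))
      [0..<Suc (d - a)]) [0..<Suc d])"

definition chow_mat :: "nat \<Rightarrow> 'a::comm_ring_1 mat \<Rightarrow> 'a mat \<Rightarrow> 'a mat \<Rightarrow> 'a mat" where
  "chow_mat n X Y Z = mat ((n + 1) choose 2) ((n + 1) choose 2)
     (\<lambda>(r, s). Poly_Mapping.lookup
        (adj_mat (net_mat X Y Z) $$ (upper_pairs n ! r)) (ternary_monoms (n - 1) ! s))"


subsection \<open>Symmetric matrices as vectors of their upper triangular entries\<close>

definition sym_mats :: "nat \<Rightarrow> 'a mat set" where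
  "sym_mats n = {A \<in> carrier_mat n n. transpose_mat A = A}"

definition sym_coords :: "nat \<Rightarrow> 'a mat \<Rightarrow> 'a vec" where
  "sym_coords n A = vec ((n + 1) choose 2) (\<lambda>r. A $$ (upper_pairs n ! r))"

text \<open>The position in \<^term>\<open>upper_pairs n\<close> of the pair with entries \<open>i\<close> and \<open>j\<close>.\<close>

definition pair_index :: "nat \<Rightarrow> nat \<Rightarrow> nat" where
  "pair_index i j = (Suc (max i j) choose 2) + min i j"

text \<open>The symmetric matrix whose upper triangular entries are the unknowns in row \<open>k\<close> of a
  generic matrix with \<open>(n + 1) choose 2\<close> columns.\<close>

definition generic_sym_mat :: "nat \<Rightarrow> nat \<Rightarrow> (nat \<times> nat, 'a::comm_ring_1) polys mat" where
  "generic_sym_mat n k = mat n n (\<lambda>(i, j). Var (k, pair_index i j))"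

lemma length_upper_pairs: "length (upper_pairs n) = (n + 1) choose 2"
proof (induction n)
  case (Suc n)
  have "length (upper_pairs (Suc n)) = length (upper_pairs n) + Suc n"
    by (simp add: upper_pairs_def)
  then show ?case
    using Suc by (simp add: numeral_2_eq_2)
qed (simp add: upper_pairs_def)

lemma upper_pairs_nth_pair_index:
  assumes "i \<le> j" "j < n"
  shows "upper_pairs n ! pair_index i j = (i, j)"
  using assms
proof (induction n)
  case (Suc n)
  have app: "upper_pairs (Suc n) = upper_pairs n @ map (\<lambda>i. (i, n)) [0..<Suc n]"
    by (simp add: upper_pairs_def)
  have pidx: "pair_index i j = (Suc j choose 2) + i"
    using Suc.prems by (simp add: pair_index_def)
  show ?case
  proof (cases "j = n")
    case True
    then show ?thesis
      using Suc.prems length_upper_pairs[of n] unfolding app pidx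
      by (simp add: nth_append del: upt_Suc)
  next
    case False
    then have "j < n" using Suc.prems by simp
    have "pair_index i j < (Suc j choose 2) + Suc j"
      using pidx Suc.prems by simp
    also have "\<dots> = (Suc (Suc j) choose 2)" by (simp add: numeral_2_eq_2)
    also have "\<dots> \<le> (Suc n choose 2)"
      using \<open>j < n\<close> by (intro binomial_right_mono) simp
    finally have "pair_index i j < length (upper_pairs n)"
      by (simp add: length_upper_pairs)
    then show ?thesis
      using Suc.IH \<open>j < n\<close> Suc.prems by (simp add: app nth_append)
  qed
qed simp

lemma length_ternary_monoms: "length (ternary_monoms d) = (d + 2) choose 2"
proof -
  have "length (ternary_monoms d) = (\<Sum>a<Suc d. Suc (d - a))"
    by (simp add: ternary_monoms_def length_concat comp_def sum_list_sum_nth atLeast0LessThan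
        del: upt_Suc sum.lessThan_Suc)
  also have "\<dots> = (\<Sum>a<Suc d. Suc a)"
    using sum.nat_diff_reindex[of "\<lambda>a. Suc a" "Suc d"] by simp
  also have "\<dots> = (d + 2) choose 2"
    by (induction d) (simp_all add: numeral_2_eq_2)
  finally show ?thesis .
qed


subsection \<open>Chow forms in dual Stiefel coordinates\<close>

text \<open>Let \<open>V\<close> be (the affine cone over) an irreducible variety of codimension \<open>c\<close> in the projective
  space of the vectors with \<open>m\<close> entries. A linear subspace of projective dimension \<open>c - 1\<close> is the
  row space of a \<open>c \<times> m\<close> matrix \<open>M\<close> of rank \<open>c\<close>, which is unique up to multiplication
  from the left by an invertible matrix; the dual Stiefel coordinates are the entries of \<open>M\<close>, the
  entry at \<open>(k, r)\<close> being the unknown \<open>Var (k, r)\<close>. A form of degree \<open>d\<close> on the Grassmannian is a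
  polynomial in these unknowns that is multiplied by \<open>det g ^ d\<close> when \<open>M\<close> is replaced by \<open>g * M\<close>
  (equivalently, a form of degree \<open>d\<close> in the Pluecker coordinates). Over the complex numbers an
  irreducible polynomial is determined by its zeros up to a nonzero scalar.\<close>

definition stiefel_value :: "(nat \<times> nat, complex) polys \<Rightarrow> complex mat \<Rightarrow> complex" where
  "stiefel_value F M = poly_value (\<lambda>v. M $$ v) F"

definition grassmannian_form :: "nat \<Rightarrow> nat \<Rightarrow> nat \<Rightarrow> (nat \<times> nat, complex) polys \<Rightarrow> bool" where
  "grassmannian_form c m d F \<longleftrightarrow>
     poly_vars F \<subseteq> {..<c} \<times> {..<m} \<and>
     (\<forall>g \<in> carrier_mat c c. \<forall>M \<in> carrier_mat c m. det g \<noteq> 0 \<longrightarrow>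
        stiefel_value F (g * M) = det g ^ d * stiefel_value F M)"

definition chow_form :: "nat \<Rightarrow> nat \<Rightarrow> complex vec set \<Rightarrow> (nat \<times> nat, complex) polys \<Rightarrow> bool" where
  "chow_form c m V F \<longleftrightarrow>
     (\<exists>d. grassmannian_form c m d F) \<and>
     Factorial_Ring.irreducible F \<and>
     (\<forall>M \<in> carrier_mat c m. vec_space.rank c M = c \<longrightarrow>
        (stiefel_value F M = 0 \<longleftrightarrow> (\<exists>v \<in> vec_space.row_space m M. v \<noteq> 0\<^sub>v m \<and> v \<in> V)))"

text \<open>The cone over the subvariety of the projective space of symmetric matrices that is defined
  by the \<open>(n - 1) \<times> (n - 1)\<close> minors; its codimension is 3.\<close>

definition corank2_variety :: "nat \<Rightarrow> complex vec set" where
  "corank2_variety n = sym_coords n ` {A \<in> sym_mats n.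
     \<forall>I J. I \<subseteq> {..<n} \<and> J \<subseteq> {..<n} \<and> card I = n - 1 \<and> card J = n - 1 \<longrightarrow>
       det (submatrix A I J) = 0}"

end

theory Submission
  imports Defs "Jordan_Normal_Form.DL_Rank_Submatrix" "Jordan_Normal_Form.Schur_Decomposition"
    "HOL-Complex_Analysis.Conformal_Mappings" "HOL-Library.Nat_Bijection"
begin

text \<open>The determinant \<open>F\<close> of the Chow matrix vanishes at \<open>(X, Y, Z)\<close> exactly when some nonzero
  point of the net has corank at least 2, that is, when its adjugate is zero
  (\<open>rank_le_iff_adj_mat_eq_0\<close>, \<open>minors_eq_0_iff_adj_mat_eq_0\<close>). One direction is immediate: the
  Chow matrix maps the vector of the monomials at \<open>(a, b, c)\<close> to the adjugate of \<open>aX + bY + cZ\<close>,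
  so a point where the adjugate vanishes gives a kernel vector.

  For the converse, a vector in the left kernel of a singular Chow matrix is a nonzero symmetric
  matrix \<open>W\<close> that is apolar to the net: it pairs to zero with every \<open>adj (aX + bY + cZ)\<close>. Suppose
  that \<open>X\<close> is invertible with inverse \<open>J\<close> and that no nonzero point has corank 2. Then every
  \<open>M = J(aY + bZ)\<close> with \<open>(a, b) \<noteq> 0\<close> has one-dimensional eigenspaces. Hence \<open>B \<mapsto> B M - M\<^sup>T B\<close> is
  injective on skew-symmetric \<open>B\<close> (\<open>skew_intertwiner_eq_0\<close>), its image consists of the symmetric
  matrices that pair to zero with the \<open>n\<close> independent matrices \<open>M\<^sup>k J\<close>, and \<open>W\<close> is one of them. So
  \<open>W = B M - M\<^sup>T B\<close> for a unique skew \<open>B = B(a, b)\<close>. By Cramer's rule \<open>B\<close> is holomorphic away from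
  the origin, and it is homogeneous of degree -1, so it vanishes by Liouville's theorem, and
  \<open>W = 0\<close> (\<open>apolar_matrix_eq_0\<close>). If \<open>X\<close> is singular, then \<open>F(X + s, Y + t, Z)\<close> is nonzero at
  every small \<open>(s, t) \<noteq> 0\<close>, and a holomorphic function of two variables has no isolated zero.

  It remains to see that \<open>F\<close> is irreducible and a form on the Grassmannian. Replacing \<open>(X, Y, Z)\<close>
  by linear combinations with coefficient matrix \<open>g\<close> multiplies \<open>F\<close> by a character of \<open>g\<close>. It is
  computed for diagonal \<open>g\<close>, then for triangular \<open>g\<close> by a limit of conjugates, and then for all
  \<open>g\<close> by Schur's triangularization: it is \<open>det g ^ N\<close> with \<open>N = (n + 1) choose 3\<close>. For
  irreducibility, the nets with a corank 2 point have a rational parametrization, so in every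
  factorization \<open>F = G H\<close> one factor, say \<open>G\<close>, vanishes at all of them. On suitable lines of nets
  \<open>\<Sum>\<^sub>i l\<^sub>i v\<^sub>i v\<^sub>i\<^sup>T\<close>, where \<open>v\<^sub>0, \<dots>, v\<^sub>n\<close> are \<open>n + 1\<close> vectors in general position and the \<open>l\<^sub>i\<close>
  are linear forms, a corank 2 point appears when three \<open>l\<^sub>i\<close> have a common zero, which happens
  for \<open>N\<close> distinct nets on the line. Since \<open>F\<close> has degree \<open>N\<close> in each of \<open>X\<close>, \<open>Y\<close>, \<open>Z\<close>, the factor
  \<open>G\<close> already has the full degree, and \<open>H\<close> is constant.\<close>

(* The matrices below have a variable dimension; the homonymous notions for matrices that are
   indexed by finite types are hidden. *)
unbundle no vec_syntax
unbundle no inner_syntax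
hide_const (open) Finite_Cartesian_Product.mat Finite_Cartesian_Product.vec Finite_Cartesian_Product.row
  Determinants.det Finite_Cartesian_Product.transpose
hide_type (open) Finite_Cartesian_Product.vec
hide_fact (open) Finite_Cartesian_Product.mat_def Finite_Cartesian_Product.vec_def
  Finite_Cartesian_Product.vec_eq_iff Determinants.det_def Determinants.det_transpose

section \<open>Corank, the adjugate and the maximal minors\<close>

lemma index_mult_mat_vec_sum:
  assumes "A \<in> carrier_mat nr nc" "x \<in> carrier_vec nc" "r < nr"
  shows "(A *\<^sub>v x) $ r = (\<Sum>l<nc. A $$ (r, l) * x $ l)"
  using assms by (simp add: index_mult_mat_vec index_mult_mat scalar_prod_def lessThan_atLeast0)

lemma index_mult_mat_sum:
  assumes "A \<in> carrier_mat nr k" "B \<in> carrier_mat k nc" "i < nr" "j < nc"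
  shows "(A * B) $$ (i, j) = (\<Sum>l<k. A $$ (i, l) * B $$ (l, j))"
  using assms by (simp add: index_mult_mat_vec index_mult_mat scalar_prod_def lessThan_atLeast0)

(* By default an entry of a product becomes a scalar product of a row and a column. Below, such
   entries are expanded with the two sums above, at chosen places only. *)
declare index_mult_mat_vec [simp del] and index_mult_mat(1) [simp del]

text \<open>Fewer equations than unknowns: pad the system with zero rows to a square matrix; its
  determinant vanishes by expansion along a zero row.\<close>

lemma homogeneous_system_solvable:
  fixes f :: "nat \<Rightarrow> nat \<Rightarrow> 'a::field"
  assumes "p < q"
  shows "\<exists>c. (\<exists>k<q. c k \<noteq> 0) \<and> (\<forall>i<p. (\<Sum>k<q. f i k * c k) = 0)"
proof -
  define A where "A = mat q q (\<lambda>(i, k). if i < p then f i k else 0)"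
  have A: "A \<in> carrier_mat q q" by (simp add: A_def)
  have "det A = (\<Sum>j<q. A $$ (p, j) * cofactor A p j)"
    using laplace_expansion_row[OF A assms] .
  also have "\<dots> = 0" using assms by (intro sum.neutral) (simp add: A_def)
  finally obtain v where v: "v \<in> carrier_vec q" "v \<noteq> 0\<^sub>v q" "A *\<^sub>v v = 0\<^sub>v q"
    using det_0_iff_vec_prod_zero_field[OF A] by auto
  have "(\<Sum>k<q. f i k * v $ k) = 0" if "i < p" for i
  proof -
    have "(A *\<^sub>v v) $ i = (\<Sum>k<q. f i k * v $ k)"
      using that assms by (subst index_mult_mat_vec_sum[OF A v(1)]) (auto simp: A_def)
    then show ?thesis using v(3) that assms by simp
  qed
  moreover have "\<exists>k<q. v $ k \<noteq> 0" using v(1,2) by (auto simp: Matrix.vec_eq_iff)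
  ultimately show ?thesis by blast
qed

lemma cofactor_cong_row:
  assumes "A \<in> carrier_mat n n" "B \<in> carrier_mat n n" "j < n" "i < n"
    "\<And>r c. r < n \<Longrightarrow> c < n \<Longrightarrow> r \<noteq> j \<Longrightarrow> A $$ (r, c) = B $$ (r, c)"
  shows "cofactor A j i = cofactor B j i"
proof -
  have "mat_delete A j i = mat_delete B j i"
    using assms unfolding mat_delete_def by (intro eq_matI) auto
  then show ?thesis by (simp add: cofactor_def)
qed

lemma nontrivial_relationE:
  fixes x y :: "'a::field"
  obtains a b where "a \<noteq> 0 \<or> b \<noteq> 0" "a * x + b * y = 0"
proof (cases "x = 0")
  case True
  then show ?thesis using that[of 1 0] by simp
next
  case False
  then show ?thesis using that[of y "- x"] by simp
qed

text \<open>A two-dimensional kernel contains a nonzero vector whose \<open>i\<close>-th entry is 0. It is also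
  killed by the matrix \<open>A\<close> with row \<open>j\<close> replaced by the \<open>i\<close>-th unit vector, whose determinant is
  the cofactor at \<open>(j, i)\<close>.\<close>

lemma adj_mat_eq_0_if_kernel:
  fixes A :: "'a::field mat"
  assumes A: "A \<in> carrier_mat n n"
    and u: "u \<in> carrier_vec n" "A *\<^sub>v u = 0\<^sub>v n"
    and w: "w \<in> carrier_vec n" "A *\<^sub>v w = 0\<^sub>v n"
    and indep: "\<And>a b. (\<forall>i<n. a * u $ i + b * w $ i = 0) \<Longrightarrow> a = 0 \<and> b = 0"
  shows "adj_mat A = 0\<^sub>m n n"
proof -
  have "cofactor A j i = 0" if i: "i < n" and j: "j < n" for i j
  proof -
    \<comment> \<open>the matrix whose determinant is the cofactor at \<open>(j, i)\<close>\<close>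
    define B where "B = mat n n (\<lambda>(r, c). if r = j then (if c = i then 1 else 0) else A $$ (r, c))"
    have B: "B \<in> carrier_mat n n" by (simp add: B_def)
    have "det B = (\<Sum>l<n. B $$ (j, l) * cofactor B j l)"
      using laplace_expansion_row[OF B j] .
    also have "\<dots> = (\<Sum>l<n. if l = i then cofactor B j l else 0)"
    proof (intro sum.cong refl)
      fix l assume "l \<in> {..<n}"
      then have "B $$ (j, l) = (if l = i then 1 else 0)" using j unfolding B_def by simp
      then show "B $$ (j, l) * cofactor B j l = (if l = i then cofactor B j l else 0)" by simp
    qed
    also have "\<dots> = cofactor B j i" using i by simp
    also have "\<dots> = cofactor A j i" using A B i j by (intro cofactor_cong_row) (auto simp: B_def)
    finally have det: "det B = cofactor A j i" .
    obtain a b where ab: "a \<noteq> 0 \<or> b \<noteq> 0" "a * u $ i + b * w $ i = 0"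
      by (rule nontrivial_relationE)
    define x where "x = vec n (\<lambda>k. a * u $ k + b * w $ k)"
    have x: "x \<in> carrier_vec n" by (simp add: x_def)
    have "x \<noteq> 0\<^sub>v n"
    proof
      assume "x = 0\<^sub>v n"
      then have "x $ k = 0" if "k < n" for k using that by simp
      then have "\<forall>k<n. a * u $ k + b * w $ k = 0" by (simp add: x_def)
      then show False using indep ab(1) by blast
    qed
    moreover have "B *\<^sub>v x = 0\<^sub>v n"
    proof (rule eq_vecI)
      fix r assume "r < dim_vec (0\<^sub>v n :: 'a vec)"
      then have r: "r < n" by simp
      show "(B *\<^sub>v x) $ r = 0\<^sub>v n $ r"
      proof (cases "r = j")
        case True
        have "(B *\<^sub>v x) $ r = (\<Sum>l<n. if l = i then x $ l else 0)"
          unfolding index_mult_mat_vec_sum[OF B x r]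
          using True r by (intro sum.cong refl) (simp add: B_def)
        also have "\<dots> = 0" using i ab(2) by (simp add: x_def)
        finally show ?thesis using r by simp
      next
        case False
        have "(B *\<^sub>v x) $ r = (\<Sum>l<n. a * (A $$ (r, l) * u $ l) + b * (A $$ (r, l) * w $ l))"
          unfolding index_mult_mat_vec_sum[OF B x r]
          using False r by (intro sum.cong refl) (simp add: B_def x_def algebra_simps)
        also have "\<dots> = a * (A *\<^sub>v u) $ r + b * (A *\<^sub>v w) $ r"
          by (simp add: index_mult_mat_vec_sum[OF A _ r] u(1) w(1) sum.distrib sum_distrib_left)
        also have "\<dots> = 0" using u(2) w(2) r by simp
        finally show ?thesis using r by simp
      qed
    qed (simp add: B_def)
    ultimately have "det B = 0" using det_0_iff_vec_prod_zero_field[OF B] x by blast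
    then show ?thesis using det by simp
  qed
  then show ?thesis using A unfolding adj_mat_def by (intro eq_matI) auto
qed

text \<open>Besides a kernel vector \<open>u\<close> with \<open>u\<^sub>i \<noteq> 0\<close>, take a vector \<open>y \<noteq> 0\<close> in the left kernel with
  \<open>y\<^sub>j \<noteq> 0\<close>. Adding 1 to the entry at \<open>(j, i)\<close> keeps the determinant 0, because it changes the
  determinant by a cofactor; pairing the resulting kernel vector \<open>x\<close> with \<open>y\<close> shows \<open>x\<^sub>i = 0\<close> and
  \<open>A x = 0\<close>, so \<open>x\<close> is independent of \<open>u\<close>.\<close>

lemma two_kernel_vectors_if_adj_mat_eq_0:
  fixes A :: "'a::field mat"
  assumes A: "A \<in> carrier_mat n n" and n: "0 < n" and adj: "adj_mat A = 0\<^sub>m n n"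
  shows "\<exists>u w. u \<in> carrier_vec n \<and> A *\<^sub>v u = 0\<^sub>v n \<and> w \<in> carrier_vec n \<and> A *\<^sub>v w = 0\<^sub>v n \<and>
    (\<forall>a b. (\<forall>i<n. a * u $ i + b * w $ i = 0) \<longrightarrow> a = 0 \<and> b = 0)"
proof -
  have cof: "cofactor A j i = 0" if "i < n" "j < n" for i j
  proof -
    have "adj_mat A $$ (i, j) = 0" using adj that by simp
    then show ?thesis using that A by (simp add: adj_mat_def)
  qed
  have "det A = (\<Sum>j<n. A $$ (0, j) * cofactor A 0 j)" using laplace_expansion_row[OF A n] .
  then have detA: "det A = 0" using cof n by simp
  obtain u where u: "u \<in> carrier_vec n" "u \<noteq> 0\<^sub>v n" "A *\<^sub>v u = 0\<^sub>v n"
    using det_0_iff_vec_prod_zero_field[OF A] detA by auto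
  have At: "transpose_mat A \<in> carrier_mat n n" using A by simp
  have "det (transpose_mat A) = 0" using detA det_transpose[OF A] by simp
  then obtain y where y: "y \<in> carrier_vec n" "y \<noteq> 0\<^sub>v n" "transpose_mat A *\<^sub>v y = 0\<^sub>v n"
    using det_0_iff_vec_prod_zero_field[OF At] by auto
  obtain i where i: "i < n" "u $ i \<noteq> 0" using u(1,2) by (auto simp: Matrix.vec_eq_iff)
  obtain j where j: "j < n" "y $ j \<noteq> 0" using y(1,2) by (auto simp: Matrix.vec_eq_iff)
  \<comment> \<open>the perturbation of the entry at \<open>(j, i)\<close> by 1\<close>
  define B where "B = mat n n (\<lambda>(r, c). A $$ (r, c) + (if r = j \<and> c = i then 1 else 0))"
  have B: "B \<in> carrier_mat n n" by (simp add: B_def)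
  have "det B = (\<Sum>l<n. B $$ (j, l) * cofactor B j l)"
    using laplace_expansion_row[OF B j(1)] .
  also have "\<dots> = (\<Sum>l<n. B $$ (j, l) * cofactor A j l)"
  proof (intro sum.cong refl)
    fix l assume "l \<in> {..<n}"
    then have "cofactor B j l = cofactor A j l"
      using A B j by (intro cofactor_cong_row) (auto simp: B_def)
    then show "B $$ (j, l) * cofactor B j l = B $$ (j, l) * cofactor A j l" by simp
  qed
  also have "\<dots> = 0" using cof j by simp
  finally obtain x where x: "x \<in> carrier_vec n" "x \<noteq> 0\<^sub>v n" "B *\<^sub>v x = 0\<^sub>v n"
    using det_0_iff_vec_prod_zero_field[OF B] by auto
  have Bx: "(A *\<^sub>v x) $ r + (if r = j then x $ i else 0) = 0" if r: "r < n" for r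
  proof -
    have "(B *\<^sub>v x) $ r = (\<Sum>l<n. A $$ (r, l) * x $ l + (if l = i then if r = j then x $ l else 0 else 0))"
      unfolding index_mult_mat_vec_sum[OF B x(1) r]
      using r by (intro sum.cong) (auto simp: B_def algebra_simps)
    also have "\<dots> = (A *\<^sub>v x) $ r + (if r = j then x $ i else 0)"
      using i by (simp add: sum.distrib index_mult_mat_vec_sum[OF A x(1) r])
    finally show ?thesis using x(3) r by simp
  qed
  have "(\<Sum>r<n. y $ r * (A *\<^sub>v x) $ r) = (\<Sum>l<n. (transpose_mat A *\<^sub>v y) $ l * x $ l)"
  proof -
    have "(\<Sum>r<n. y $ r * (A *\<^sub>v x) $ r) = (\<Sum>r<n. \<Sum>l<n. y $ r * (A $$ (r, l) * x $ l))"
      by (simp add: index_mult_mat_vec_sum[OF A x(1)] sum_distrib_left)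
    also have "\<dots> = (\<Sum>l<n. \<Sum>r<n. y $ r * (A $$ (r, l) * x $ l))" by (rule sum.swap)
    also have "\<dots> = (\<Sum>l<n. (transpose_mat A *\<^sub>v y) $ l * x $ l)"
      using A by (simp add: index_mult_mat_vec_sum[OF At y(1)] sum_distrib_left mult_ac)
    finally show ?thesis .
  qed
  also have "\<dots> = 0" using y(3) by simp
  also have "(\<Sum>r<n. y $ r * (A *\<^sub>v x) $ r) = (\<Sum>r<n. if r = j then y $ j * (A *\<^sub>v x) $ j else 0)"
    using Bx by (intro sum.cong refl) (metis add.right_neutral lessThan_iff mult_zero_right)
  also have "\<dots> = y $ j * (A *\<^sub>v x) $ j" using j by simp
  finally have Axj: "(A *\<^sub>v x) $ j = 0" using j by simp
  then have xi: "x $ i = 0" using Bx[OF j(1)] by simp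
  have Ax: "A *\<^sub>v x = 0\<^sub>v n"
  proof (rule eq_vecI)
    fix r assume "r < dim_vec (0\<^sub>v n :: 'a vec)"
    then show "(A *\<^sub>v x) $ r = 0\<^sub>v n $ r" using Bx[of r] Axj by (cases "r = j") auto
  qed (use A in simp)
  have "a = 0 \<and> b = 0" if "\<forall>k<n. a * u $ k + b * x $ k = 0" for a b
  proof -
    have "a = 0" using that i xi by auto
    moreover obtain k where "k < n" "x $ k \<noteq> 0" using x(1,2) by (auto simp: Matrix.vec_eq_iff)
    ultimately show ?thesis using that by auto
  qed
  then show ?thesis using u x(1) Ax by blast
qed

text \<open>If \<open>n - 1\<close> columns were independent, a kernel vector that vanishes at the position of the
  remaining column would be a relation between them.\<close>

lemma rank_le_if_adj_mat_eq_0: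
  fixes A :: "'a::field mat"
  assumes A: "A \<in> carrier_mat n n" and n: "0 < n" and adj: "adj_mat A = 0\<^sub>m n n"
  shows "vec_space.rank n A \<le> n - 2"
proof (rule ccontr)
  interpret vec_space "TYPE('a)" n .
  assume *: "\<not> vec_space.rank n A \<le> n - 2"
  obtain S where S: "maximal S (\<lambda>T. T \<subseteq> set (cols A) \<and> lin_indpt T)"
    using maximal_exists[of "(\<lambda>T. T \<subseteq> set (cols A) \<and> lin_indpt T)" "card (set (cols A))" "{}"]
    by (meson List.finite_set card_mono empty_iff empty_subsetI finite_lin_indpt2 rev_finite_subset)
  have card: "card S \<ge> n - 1" using rank_card_indpt[OF A S] * by simp
  have SA: "S \<subseteq> set (cols A)" and Sind: "lin_indpt S" using S by (auto simp: maximal_def)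
  have "set (cols A) = col A ` {..<n}" using A by (auto simp: cols_def)
  then obtain J where J: "J \<subseteq> {..<n}" "inj_on (col A) J" "S = col A ` J"
    using SA subset_image_inj[of S "col A" "{..<n}"] by auto
  have finJ: "finite J" using J finite_subset by blast
  have cardJ: "card J \<ge> n - 1" using card card_image[OF J(2)] J(3) by simp
  obtain i where i: "i < n" "J \<union> {i} = {..<n}"
  proof (cases "J = {..<n}")
    case True then show ?thesis using that[of 0] n by auto
  next
    case False
    then obtain i where i: "i < n" "i \<notin> J" using J(1) by blast
    have "card (insert i J) \<ge> n" using cardJ finJ i n by simp
    then have "insert i J = {..<n}" using i J(1) by (intro card_subset_eq) (auto intro!: antisym card_mono[of "{..<n}", simplified])
    then show ?thesis using that i by auto
  qed
  obtain u w where u: "u \<in> carrier_vec n" "A *\<^sub>v u = 0\<^sub>v n"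
    and w: "w \<in> carrier_vec n" "A *\<^sub>v w = 0\<^sub>v n"
    and ind: "\<And>a b. (\<forall>i<n. a * u $ i + b * w $ i = 0) \<Longrightarrow> a = 0 \<and> b = 0"
    using two_kernel_vectors_if_adj_mat_eq_0[OF A n adj] by blast
  obtain a b where ab: "a \<noteq> 0 \<or> b \<noteq> 0" "a * u $ i + b * w $ i = 0"
    by (rule nontrivial_relationE)
  define x where "x k = a * u $ k + b * w $ k" for k
  have xi: "x i = 0" using ab by (simp add: x_def)
  obtain k where k: "k < n" "x k \<noteq> 0" using ind[of a b] ab(1) unfolding x_def by blast
  then have "k \<noteq> i" using xi by metis
  then have kJ: "k \<in> J" using i(2) k(1) by blast
  define c where "c v = x (the_inv_into J (col A) v)" for v
  have cj: "c (col A j) = x j" if "j \<in> J" for j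
    using that J(2) by (simp add: c_def the_inv_into_f_f)
  have Scar: "S \<subseteq> carrier_vec n" using SA A cols_dim by blast
  have "lincomb c S = 0\<^sub>v n"
  proof (rule eq_vecI)
    show "dim_vec (lincomb c S) = dim_vec (0\<^sub>v n)" using Scar lincomb_dim finJ J(3) by simp
    fix r assume "r < dim_vec (0\<^sub>v n :: 'a vec)"
    then have r: "r < n" by simp
    have "lincomb c S $ r = (\<Sum>v\<in>S. c v * v $ r)" using lincomb_index[OF r Scar] .
    also have "\<dots> = (\<Sum>j\<in>J. c (col A j) * col A j $ r)"
      unfolding J(3) by (rule sum.reindex_cong[OF J(2)]) auto
    also have "\<dots> = (\<Sum>j\<in>J. x j * A $$ (r, j))"
      using J(1) A r by (intro sum.cong) (auto simp: cj)
    also have "\<dots> = (\<Sum>j<n. x j * A $$ (r, j))"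
    proof (rule sum.mono_neutral_left)
      have "j = i" if "j \<in> {..<n} - J" for j using that i(2) by blast
      then show "\<forall>j\<in>{..<n} - J. x j * A $$ (r, j) = 0" using xi by auto
    qed (use J(1) in auto)
    also have "\<dots> = (\<Sum>j<n. a * (A $$ (r, j) * u $ j) + b * (A $$ (r, j) * w $ j))"
      by (intro sum.cong refl) (simp add: x_def algebra_simps)
    also have "\<dots> = a * (A *\<^sub>v u) $ r + b * (A *\<^sub>v w) $ r"
      by (simp add: index_mult_mat_vec_sum[OF A _ r] u(1) w(1) sum.distrib sum_distrib_left)
    also have "\<dots> = 0" using u w r by simp
    finally show "lincomb c S $ r = 0\<^sub>v n $ r" using r by simp
  qed
  moreover have "c (col A k) \<noteq> 0" "col A k \<in> S" using cj kJ k J(3) by auto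
  moreover have "finite S" using finJ J(3) by simp
  ultimately have "lin_dep S" unfolding lin_dep_def
    by (intro exI[of _ S] exI[of _ c] exI[of _ "col A k"]) (auto simp: class_ring_simps module_vec_simps)
  then show False using Sind by simp
qed

lemma submatrix_eq_mat_delete:
  assumes A: "A \<in> carrier_mat n n" and i: "i < n" and j: "j < n"
  shows "submatrix A ({..<n} - {i}) ({..<n} - {j}) = mat_delete A i j"
proof -
  have pick: "pick ({..<n} - {k}) r = insert_index k r" if k: "k < n" and r: "r < n - 1" for k r
  proof -
    have "insert_index k r \<in> {..<n} - {k}" using k r by (auto simp: insert_index_def)
    moreover have "card {a \<in> {..<n} - {k}. a < insert_index k r} = r"
    proof (cases "r < k")
      case True
      then have "{a \<in> {..<n} - {k}. a < insert_index k r} = {..<r}"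
        using k by (auto simp: insert_index_def)
      then show ?thesis by simp
    next
      case False
      then have "{a \<in> {..<n} - {k}. a < insert_index k r} = {..<Suc r} - {k}"
        using r by (auto simp: insert_index_def)
      then show ?thesis using False by simp
    qed
    ultimately show ?thesis using pick_card_in_set by metis
  qed
  have card: "card {a. a < n \<and> a \<in> {..<n} - {k}} = n - 1" if "k < n" for k
  proof -
    have "{a. a < n \<and> a \<in> {..<n} - {k}} = {..<n} - {k}" by auto
    then show ?thesis using that by simp
  qed
  show ?thesis
  proof (rule eq_matI)
    fix r c assume "r < dim_row (mat_delete A i j)" "c < dim_col (mat_delete A i j)"
    then have r: "r < n - 1" and c: "c < n - 1" using A by (auto simp: mat_delete_def)
    have "submatrix A ({..<n} - {i}) ({..<n} - {j}) $$ (r, c)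
        = A $$ (pick ({..<n} - {i}) r, pick ({..<n} - {j}) c)"
      using A card[OF i] card[OF j] r c by (intro submatrix_index) auto
    also have "\<dots> = mat_delete A i j $$ (r, c)"
      using pick[OF i r] pick[OF j c] mat_delete_index[of A n i j r c] A i j r c
      by (cases n) (auto simp: mat_delete_def insert_index_def)
    finally show "submatrix A ({..<n} - {i}) ({..<n} - {j}) $$ (r, c) = mat_delete A i j $$ (r, c)" .
  qed (use A card[OF i] card[OF j] in \<open>auto simp: dim_submatrix mat_delete_def\<close>)
qed

lemma minors_eq_0_iff_adj_mat_eq_0:
  fixes A :: "'a::field mat"
  assumes A: "A \<in> carrier_mat n n" and n: "0 < n"
  shows "(\<forall>I J. I \<subseteq> {..<n} \<and> J \<subseteq> {..<n} \<and> card I = n - 1 \<and> card J = n - 1 \<longrightarrow>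
       det (submatrix A I J) = 0) \<longleftrightarrow> adj_mat A = 0\<^sub>m n n"
proof -
  have co: "\<exists>i<n. I = {..<n} - {i}" if "I \<subseteq> {..<n}" "card I = n - 1" for I :: "nat set"
  proof -
    have "card ({..<n} - I) = 1" using that n by (simp add: card_Diff_subset finite_subset)
    then obtain i where "{..<n} - I = {i}" using card_1_singletonE by metis
    then have "i < n" "I = {..<n} - {i}" using that by auto
    then show ?thesis by blast
  qed
  have "adj_mat A = 0\<^sub>m n n \<longleftrightarrow> (\<forall>i<n. \<forall>j<n. det (mat_delete A i j) = 0)"
  proof -
    have "adj_mat A = 0\<^sub>m n n \<longleftrightarrow> (\<forall>i<n. \<forall>j<n. adj_mat A $$ (i, j) = 0)"
      using adj_mat(1)[OF A] by (auto simp: Matrix.mat_eq_iff)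
    also have "\<dots> \<longleftrightarrow> (\<forall>i<n. \<forall>j<n. det (mat_delete A j i) = 0)"
    proof -
      have "adj_mat A $$ (i, j) = 0 \<longleftrightarrow> det (mat_delete A j i) = 0" if "i < n" "j < n" for i j
        using A that by (simp add: adj_mat_def cofactor_def)
      then show ?thesis by blast
    qed
    finally show ?thesis by blast
  qed
  also have "\<dots> \<longleftrightarrow> (\<forall>I J. I \<subseteq> {..<n} \<and> J \<subseteq> {..<n} \<and> card I = n - 1 \<and> card J = n - 1 \<longrightarrow>
       det (submatrix A I J) = 0)" (is "?L \<longleftrightarrow> ?R")
  proof
    assume ?L
    then show ?R using co submatrix_eq_mat_delete[OF A] by metis
  next
    assume R: ?R
    show ?L
    proof (intro allI impI)
      fix i j assume ij: "i < n" "j < n"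
      have "det (submatrix A ({..<n} - {i}) ({..<n} - {j})) = 0"
        using ij by (intro R[rule_format]) auto
      then show "det (mat_delete A i j) = 0" using submatrix_eq_mat_delete[OF A ij] by simp
    qed
  qed
  finally show ?thesis by blast
qed

text \<open>This is the form in which rank at most \<open>n - 2\<close> is used everywhere below: the vanishing of
  the adjugate is polynomial in the matrix and is equivalent to a kernel of dimension at least 2.\<close>

lemma rank_le_iff_adj_mat_eq_0:
  fixes A :: "'a::field mat"
  assumes A: "A \<in> carrier_mat n n" and n: "2 \<le> n"
  shows "vec_space.rank n A \<le> n - 2 \<longleftrightarrow> adj_mat A = 0\<^sub>m n n"
proof
  assume r: "vec_space.rank n A \<le> n - 2"
  have "det (submatrix A I J) = 0" if "I \<subseteq> {..<n}" "J \<subseteq> {..<n}" "card I = n - 1" "card J = n - 1" for I J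
  proof (rule ccontr)
    assume "det (submatrix A I J) \<noteq> 0"
    then have "card {j. j < n \<and> j \<in> J} \<le> vec_space.rank n A"
      using vec_space.rank_gt_minor[OF A] by blast
    moreover have "{j. j < n \<and> j \<in> J} = J" using that by auto
    ultimately show False using r that n by simp
  qed
  then show "adj_mat A = 0\<^sub>m n n" using minors_eq_0_iff_adj_mat_eq_0[OF A] n by auto
qed (use rank_le_if_adj_mat_eq_0[OF A] n in auto)

section \<open>Evaluation and leading terms of polynomials\<close>

definition monom_value :: "('v \<Rightarrow> 'a::comm_semiring_1) \<Rightarrow> ('v \<Rightarrow>\<^sub>0 nat) \<Rightarrow> 'a" where
  "monom_value \<alpha> m = (\<Prod>v \<in> Poly_Mapping.keys m. \<alpha> v ^ Poly_Mapping.lookup m v)"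

lemma monom_value_superset:
  assumes "finite S" "Poly_Mapping.keys m \<subseteq> S"
  shows "monom_value \<alpha> m = (\<Prod>v \<in> S. \<alpha> v ^ Poly_Mapping.lookup m v)"
  unfolding monom_value_def using assms
  by (intro prod.mono_neutral_left) (auto simp: in_keys_iff)

lemma monom_value_add: "monom_value \<alpha> (m + m') = monom_value \<alpha> m * monom_value \<alpha> m'"
proof -
  let ?S = "Poly_Mapping.keys m \<union> Poly_Mapping.keys m'"
  have "monom_value \<alpha> (m + m') = (\<Prod>v \<in> ?S. \<alpha> v ^ Poly_Mapping.lookup (m + m') v)"
    by (intro monom_value_superset) (auto dest: subsetD[OF Poly_Mapping.keys_add])
  also have "\<dots> = (\<Prod>v \<in> ?S. \<alpha> v ^ Poly_Mapping.lookup m v) * (\<Prod>v \<in> ?S. \<alpha> v ^ Poly_Mapping.lookup m' v)"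
    by (simp add: lookup_add power_add prod.distrib)
  also have "\<dots> = monom_value \<alpha> m * monom_value \<alpha> m'"
    by (subst (1 2) monom_value_superset[of ?S]) auto
  finally show ?thesis .
qed

lemma poly_value_superset:
  assumes "finite S" "Poly_Mapping.keys F \<subseteq> S"
  shows "poly_value \<alpha> F = (\<Sum>m \<in> S. Poly_Mapping.lookup F m * monom_value \<alpha> m)"
  unfolding poly_value_def monom_value_def[symmetric] using assms
  by (intro sum.mono_neutral_left) (auto simp: in_keys_iff)

lemma poly_value_add: "poly_value \<alpha> (F + G) = poly_value \<alpha> F + poly_value \<alpha> G"
proof -
  let ?S = "Poly_Mapping.keys F \<union> Poly_Mapping.keys G"
  have "poly_value \<alpha> (F + G) = (\<Sum>m \<in> ?S. Poly_Mapping.lookup (F + G) m * monom_value \<alpha> m)"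
    by (intro poly_value_superset) (auto dest: subsetD[OF Poly_Mapping.keys_add])
  also have "\<dots> = (\<Sum>m \<in> ?S. Poly_Mapping.lookup F m * monom_value \<alpha> m) + (\<Sum>m \<in> ?S. Poly_Mapping.lookup G m * monom_value \<alpha> m)"
    by (simp add: lookup_add distrib_right sum.distrib)
  also have "\<dots> = poly_value \<alpha> F + poly_value \<alpha> G"
    by (subst (1 2) poly_value_superset[of ?S]) auto
  finally show ?thesis .
qed

lemma poly_value_0 [simp]: "poly_value \<alpha> 0 = 0"
  by (simp add: poly_value_def)

lemma poly_value_sum: "poly_value \<alpha> (sum f S) = (\<Sum>x\<in>S. poly_value \<alpha> (f x))"
  by (induction S rule: infinite_finite_induct) (auto simp: poly_value_add)

lemma poly_value_single: "poly_value \<alpha> (Poly_Mapping.single m c) = c * monom_value \<alpha> m"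
  by (subst poly_value_superset[of "{m}"]) auto

text \<open>Allowing a superset \<open>S\<close> of the support turns inclusions of supports into explicit normal
  forms; with \<open>S = {0}\<close> it says that the polynomial is constant.\<close>

lemma sum_single_lookup:
  assumes "finite S" "Poly_Mapping.keys F \<subseteq> S"
  shows "F = (\<Sum>m\<in>S. Poly_Mapping.single m (Poly_Mapping.lookup F m))"
proof (rule poly_mapping_eqI)
  fix k
  have "Poly_Mapping.lookup (\<Sum>m\<in>S. Poly_Mapping.single m (Poly_Mapping.lookup F m)) k
    = (\<Sum>m\<in>S. if m = k then Poly_Mapping.lookup F m else 0)"
    by (simp add: lookup_sum lookup_single when_def)
  also have "\<dots> = Poly_Mapping.lookup F k"
    using assms by (auto simp: in_keys_iff)
  finally show "Poly_Mapping.lookup F k = Poly_Mapping.lookup (\<Sum>m\<in>S. Poly_Mapping.single m (Poly_Mapping.lookup F m)) k" ..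
qed

lemma mult_eq_sum_single:
  fixes F G :: "('v, 'a::comm_semiring_1) polys"
  shows "F * G = (\<Sum>m\<in>Poly_Mapping.keys F. \<Sum>m'\<in>Poly_Mapping.keys G.
    Poly_Mapping.single (m + m') (Poly_Mapping.lookup F m * Poly_Mapping.lookup G m'))"
proof -
  have "F * G = (\<Sum>m\<in>Poly_Mapping.keys F. Poly_Mapping.single m (Poly_Mapping.lookup F m)) *
      (\<Sum>m\<in>Poly_Mapping.keys G. Poly_Mapping.single m (Poly_Mapping.lookup G m))"
    using sum_single_lookup[of "Poly_Mapping.keys F" F] sum_single_lookup[of "Poly_Mapping.keys G" G] by simp
  then show ?thesis by (simp add: sum_product mult_single)
qed

lemma lookup_mult_eq_sum:
  fixes F G :: "('v, 'a::comm_semiring_1) polys"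
  shows "Poly_Mapping.lookup (F * G) k = (\<Sum>m\<in>Poly_Mapping.keys F. \<Sum>m'\<in>Poly_Mapping.keys G.
    if m + m' = k then Poly_Mapping.lookup F m * Poly_Mapping.lookup G m' else 0)"
  unfolding mult_eq_sum_single by (simp add: lookup_sum lookup_single when_def)

lemma poly_value_mult: "poly_value \<alpha> (F * G) = poly_value \<alpha> F * poly_value \<alpha> G"
proof -
  have "poly_value \<alpha> (F * G) = (\<Sum>m\<in>Poly_Mapping.keys F. \<Sum>m'\<in>Poly_Mapping.keys G.
      (Poly_Mapping.lookup F m * monom_value \<alpha> m) * (Poly_Mapping.lookup G m' * monom_value \<alpha> m'))"
    unfolding mult_eq_sum_single
    by (simp add: poly_value_sum poly_value_single monom_value_add mult_ac)
  also have "\<dots> = poly_value \<alpha> F * poly_value \<alpha> G"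
    by (simp add: sum_product[symmetric] poly_value_superset[OF finite_keys order_refl])
  finally show ?thesis .
qed

lemma monom_value_0 [simp]: "monom_value \<alpha> 0 = 1"
  by (simp add: monom_value_def)

lemma monom_value_single: "monom_value \<alpha> (Poly_Mapping.single v k) = \<alpha> v ^ k"
  by (subst monom_value_superset[of "{v}"]) auto

lemma poly_value_Var [simp]: "poly_value \<alpha> (Var v) = \<alpha> v"
  by (simp add: Var_def poly_value_single monom_value_single)

lemma poly_value_1 [simp]: "poly_value \<alpha> 1 = 1"
  using poly_value_single[of \<alpha> 0 1] by simp

lemma comm_ring_hom_poly_value:
  "comm_ring_hom (poly_value \<alpha> :: ('v, 'a::comm_ring_1) polys \<Rightarrow> 'a)"
proof
  show "poly_value \<alpha> (F + G) = poly_value \<alpha> F + poly_value \<alpha> G" for F G by (rule poly_value_add)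
  show "poly_value \<alpha> (F * G) = poly_value \<alpha> F * poly_value \<alpha> G" for F G by (rule poly_value_mult)
qed auto

lemma comm_ring_hom_adj_mat:
  assumes "comm_ring_hom h" and A: "A \<in> carrier_mat n n" and ij: "i < n" "j < n"
  shows "h (adj_mat A $$ (i, j)) = adj_mat (map_mat h A) $$ (i, j)"
proof -
  interpret comm_ring_hom h by fact
  have "map_mat h (mat_delete A j i) = mat_delete (map_mat h A) j i"
    using A ij by (intro eq_matI) (auto simp: mat_delete_def)
  then show ?thesis using A ij
    by (simp add: adj_mat_def cofactor_def hom_distribs flip: hom_det)
qed

text \<open>\<open>C\<close> plays the role of a grading by an arbitrary commutative monoid: column \<open>j\<close> is
  homogeneous of degree \<open>d j\<close>, so each term of the Leibniz formula has degree \<open>\<Sum>d\<close>. It serves for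
  total degrees and for multidegrees in the three blocks of unknowns.\<close>

lemma det_mem_graded:
  fixes A :: "'r::comm_ring_1 mat" and C :: "'g::comm_monoid_add \<Rightarrow> 'r set"
  assumes zero: "\<And>i. 0 \<in> C i" and one: "1 \<in> C 0"
    and add: "\<And>i x y. x \<in> C i \<Longrightarrow> y \<in> C i \<Longrightarrow> x + y \<in> C i"
    and neg: "\<And>i x. x \<in> C i \<Longrightarrow> - x \<in> C i"
    and mult: "\<And>i j x y. x \<in> C i \<Longrightarrow> y \<in> C j \<Longrightarrow> x * y \<in> C (i + j)"
    and A: "A \<in> carrier_mat n n" and ent: "\<And>i j. i < n \<Longrightarrow> j < n \<Longrightarrow> A $$ (i, j) \<in> C (d j)"
  shows "det A \<in> C (\<Sum>j<n. d j)"
proof -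
  have sum: "(\<Sum>x\<in>S. f x) \<in> C i" if "\<And>x. x \<in> S \<Longrightarrow> f x \<in> C i" for S :: "(nat \<Rightarrow> nat) set" and f i
    using that by (induction S rule: infinite_finite_induct) (auto simp: zero add)
  have prod: "(\<Prod>x\<in>S. f x) \<in> C (\<Sum>x\<in>S. e x)" if "finite S" "\<And>x. x \<in> S \<Longrightarrow> f x \<in> C (e x)" for S :: "nat set" and f e
    using that by (induction S rule: finite_induct) (auto simp: one mult)
  have "signof p * (\<Prod>i = 0..<n. A $$ (i, p i)) \<in> C (\<Sum>j<n. d j)" if p: "p permutes {0..<n}" for p
  proof -
    have "(\<Prod>i = 0..<n. A $$ (i, p i)) \<in> C (\<Sum>i = 0..<n. d (p i))"
      using permutes_in_image[OF p] by (intro prod) (auto intro!: ent)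
    also have "(\<Sum>i = 0..<n. d (p i)) = (\<Sum>j<n. d j)"
      using sum.permute[OF p, of d] by (simp add: comp_def lessThan_atLeast0)
    finally show ?thesis by (cases "evenperm p") (auto simp: sign_def neg)
  qed
  then show ?thesis unfolding det_def'[OF A] by (intro sum) auto
qed

lemma adj_mat_mem_graded:
  fixes A :: "'r::comm_ring_1 mat" and C :: "nat \<Rightarrow> 'r set"
  assumes zero: "\<And>i. 0 \<in> C i" and one: "1 \<in> C 0"
    and add: "\<And>i x y. x \<in> C i \<Longrightarrow> y \<in> C i \<Longrightarrow> x + y \<in> C i"
    and neg: "\<And>i x. x \<in> C i \<Longrightarrow> - x \<in> C i"
    and mult: "\<And>i j x y. x \<in> C i \<Longrightarrow> y \<in> C j \<Longrightarrow> x * y \<in> C (i + j)"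
    and A: "A \<in> carrier_mat n n" and ent: "\<And>i j. i < n \<Longrightarrow> j < n \<Longrightarrow> A $$ (i, j) \<in> C 1"
    and ij: "i < n" "j < n"
  shows "adj_mat A $$ (i, j) \<in> C (n - 1)"
proof -
  have "det (mat_delete A j i) \<in> C (\<Sum>j<n - 1. 1)"
  proof (rule det_mem_graded[of C, OF zero one add neg mult])
    show "mat_delete A j i \<in> carrier_mat (n - 1) (n - 1)" using mat_delete_carrier[OF A] .
    show "mat_delete A j i $$ (r, c) \<in> C 1" if "r < n - 1" "c < n - 1" for r c
      using that A ij by (auto simp: mat_delete_def simp del: One_nat_def intro!: ent)
  qed auto
  then have "det (mat_delete A j i) \<in> C (n - 1)" by simp
  moreover have "(-1) ^ (j + i) * x \<in> C (n - 1)" if "x \<in> C (n - 1)" for x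
    using that neg by (cases "even (j + i)") auto
  ultimately show ?thesis using A ij by (simp add: adj_mat_def cofactor_def)
qed

lemma mem_keys_multE:
  assumes "\<mu> \<in> Poly_Mapping.keys (F * G)"
  obtains a b where "\<mu> = a + b" "a \<in> Poly_Mapping.keys F" "b \<in> Poly_Mapping.keys G"
  using assms keys_mult[of F G] by blast

text \<open>Among the monomials of maximal weight, take the largest one in a monomial order, for both
  factors. Their product arises in only one way, so it does not cancel. The monomial order is the
  lexicographic order on exponent vectors indexed by natural numbers, transported along an
  encoding of pairs.\<close>

lemma ex_keys_mult_weight_ge:
  fixes G H :: "(nat \<times> nat, 'a::idom) polys" and w :: "((nat \<times> nat) \<Rightarrow>\<^sub>0 nat) \<Rightarrow> nat"
  assumes w: "\<And>m m'. w (m + m') = w m + w m'"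
    and a: "a \<in> Poly_Mapping.keys G" and b: "b \<in> Poly_Mapping.keys H"
  shows "\<exists>\<mu> \<in> Poly_Mapping.keys (G * H). w a + w b \<le> w \<mu>"
proof -
  \<comment> \<open>linearly ordered exponent vectors, indexed by the encodings of pairs\<close>
  define \<tau> where "\<tau> = (Poly_Mapping.map_key prod_decode :: ((nat \<times> nat) \<Rightarrow>\<^sub>0 nat) \<Rightarrow> (nat \<Rightarrow>\<^sub>0 nat))"
  have inj: "inj prod_decode" by (rule inj_prod_decode)
  have \<tau>_add: "\<tau> (m + m') = \<tau> m + \<tau> m'" for m m' by (simp add: \<tau>_def map_key_plus[OF inj])
  have \<tau>_inj: "m = m'" if "\<tau> m = \<tau> m'" for m m'
  proof (rule poly_mapping_eqI)
    fix k
    have "Poly_Mapping.lookup (\<tau> m) (prod_encode k) = Poly_Mapping.lookup (\<tau> m') (prod_encode k)" using that by simp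
    then show "Poly_Mapping.lookup m k = Poly_Mapping.lookup m' k"
      by (simp add: \<tau>_def map_key.rep_eq[OF inj])
  qed
  \<comment> \<open>the largest monomial of maximal weight\<close>
  have top: "\<exists>t \<in> S. w x \<le> w t \<and> (\<forall>s \<in> S. w s \<le> w t) \<and> (\<forall>s \<in> S. w s = w t \<longrightarrow> \<tau> s \<le> \<tau> t)"
    if S: "finite S" "x \<in> S" for S :: "((nat \<times> nat) \<Rightarrow>\<^sub>0 nat) set" and x
  proof -
    define S' where "S' = {s \<in> S. w s = Max (w ` S)}"
    have "Max (w ` S) \<in> w ` S" using S by (intro Max_in) auto
    then have ne: "S' \<noteq> {}" "finite S'" using S by (auto simp: S'_def)
    then have "Max (\<tau> ` S') \<in> \<tau> ` S'" by (intro Max_in) auto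
    then obtain t where t: "t \<in> S'" "\<tau> t = Max (\<tau> ` S')" by auto
    have "w s \<le> w t" if "s \<in> S" for s using t(1) that S by (auto simp: S'_def)
    moreover have "\<tau> s \<le> \<tau> t" if "s \<in> S" "w s = w t" for s
    proof -
      have "s \<in> S'" using that t(1) by (auto simp: S'_def)
      then show ?thesis unfolding t(2) using ne(2) by (intro Max_ge) auto
    qed
    moreover have "t \<in> S" using t(1) by (simp add: S'_def)
    ultimately show ?thesis using S(2) by blast
  qed
  obtain p where p: "p \<in> Poly_Mapping.keys G" "w a \<le> w p" "\<And>s. s \<in> Poly_Mapping.keys G \<Longrightarrow> w s \<le> w p"
    "\<And>s. s \<in> Poly_Mapping.keys G \<Longrightarrow> w s = w p \<Longrightarrow> \<tau> s \<le> \<tau> p"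
    using top[OF finite_keys a] by blast
  obtain q where q: "q \<in> Poly_Mapping.keys H" "w b \<le> w q" "\<And>s. s \<in> Poly_Mapping.keys H \<Longrightarrow> w s \<le> w q"
    "\<And>s. s \<in> Poly_Mapping.keys H \<Longrightarrow> w s = w q \<Longrightarrow> \<tau> s \<le> \<tau> q"
    using top[OF finite_keys b] by blast
  have unique: "m = p \<and> m' = q" if m: "m \<in> Poly_Mapping.keys G" "m' \<in> Poly_Mapping.keys H" "m + m' = p + q" for m m'
  proof -
    have "w m + w m' = w p + w q" using m(3) w by metis
    then have wm: "w m = w p" "w m' = w q" using p(3)[OF m(1)] q(3)[OF m(2)] by auto
    have "\<tau> m + \<tau> m' = \<tau> p + \<tau> q" using m(3) \<tau>_add by metis
    moreover have "\<tau> m \<le> \<tau> p" "\<tau> m' \<le> \<tau> q" using p(4)[OF m(1) wm(1)] q(4)[OF m(2) wm(2)] by auto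
    ultimately have "\<tau> m = \<tau> p"
      by (metis add_le_cancel_left add_le_cancel_right order_antisym add_mono order_refl)
    then have "m = p" by (rule \<tau>_inj)
    then show ?thesis using m(3) by simp
  qed
  let ?c = "Poly_Mapping.lookup G p * Poly_Mapping.lookup H q"
  have "Poly_Mapping.lookup (G * H) (p + q) = (\<Sum>m\<in>Poly_Mapping.keys G. if m = p then
      (\<Sum>m'\<in>Poly_Mapping.keys H. if m' = q then ?c else 0) else 0)"
    unfolding lookup_mult_eq_sum
  proof (intro sum.cong refl)
    fix m assume m: "m \<in> Poly_Mapping.keys G"
    show "(\<Sum>m'\<in>Poly_Mapping.keys H. if m + m' = p + q then Poly_Mapping.lookup G m * Poly_Mapping.lookup H m' else 0)
      = (if m = p then (\<Sum>m'\<in>Poly_Mapping.keys H. if m' = q then ?c else 0) else 0)"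
    proof (cases "m = p")
      case True
      show ?thesis unfolding True using m by (auto intro!: sum.cong)
    next
      case False
      then have "m + m' \<noteq> p + q" if "m' \<in> Poly_Mapping.keys H" for m' using unique[OF m that] by blast
      then show ?thesis using False by simp
    qed
  qed
  also have "\<dots> = ?c" using p(1) q(1) by simp
  finally have "p + q \<in> Poly_Mapping.keys (G * H)" using p(1) q(1) by (simp add: in_keys_iff)
  then show ?thesis using w p(2) q(2) by (metis add_mono)
qed

text \<open>The unknown \<open>(k, p)\<close> is the coordinate \<open>p\<close> of the \<open>k\<close>-th spanning matrix of the net; this
  is the degree of a monomial in the coordinates of one of the three matrices.\<close>

definition block_degree :: "nat \<Rightarrow> ((nat \<times> nat) \<Rightarrow>\<^sub>0 nat) \<Rightarrow> nat" where
  "block_degree k m = (\<Sum>v \<in> Poly_Mapping.keys m. if fst v = k then Poly_Mapping.lookup m v else 0)"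

lemma block_degree_superset:
  assumes "finite S" "Poly_Mapping.keys m \<subseteq> S"
  shows "block_degree k m = (\<Sum>v \<in> S. if fst v = k then Poly_Mapping.lookup m v else 0)"
  unfolding block_degree_def using assms
  by (intro sum.mono_neutral_left) (auto simp: in_keys_iff)

lemma block_degree_add: "block_degree k (m + m') = block_degree k m + block_degree k m'"
proof -
  let ?S = "Poly_Mapping.keys m \<union> Poly_Mapping.keys m'"
  have "block_degree k (m + m') = (\<Sum>v \<in> ?S. if fst v = k then Poly_Mapping.lookup (m + m') v else 0)"
    by (intro block_degree_superset) (auto dest: subsetD[OF Poly_Mapping.keys_add])
  also have "\<dots> = (\<Sum>v \<in> ?S. if fst v = k then Poly_Mapping.lookup m v else 0)
      + (\<Sum>v \<in> ?S. if fst v = k then Poly_Mapping.lookup m' v else 0)"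
    unfolding sum.distrib[symmetric] by (intro sum.cong refl) (simp add: lookup_add)
  also have "\<dots> = block_degree k m + block_degree k m'"
    by (subst (1 2) block_degree_superset[of ?S]) auto
  finally show ?thesis .
qed

text \<open>The pullback of \<open>F\<close> to a polynomial curve \<open>c\<close>, as a polynomial in the parameter of the
  curve.\<close>

definition curve_poly :: "('v \<Rightarrow> 'a::comm_semiring_1 poly) \<Rightarrow> ('v, 'a) polys \<Rightarrow> 'a poly" where
  "curve_poly c F = (\<Sum>m \<in> Poly_Mapping.keys F. Polynomial.smult (Poly_Mapping.lookup F m) (monom_value c m))"

lemma poly_curve_poly: "poly (curve_poly c F) t = poly_value (\<lambda>v. poly (c v) t) F"
  by (simp add: curve_poly_def poly_value_def poly_sum monom_value_def poly_prod)

lemma degree_curve_poly_le: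
  fixes c :: "nat \<times> nat \<Rightarrow> 'a::idom poly"
  assumes "\<And>v. degree (c v) \<le> (if fst v = k then 1 else 0)"
    and "\<And>m. m \<in> Poly_Mapping.keys F \<Longrightarrow> block_degree k m \<le> N"
  shows "degree (curve_poly c F) \<le> N"
  unfolding curve_poly_def
proof (rule degree_sum_le)
  fix m assume m: "m \<in> Poly_Mapping.keys F"
  have "degree (monom_value c m) \<le> (\<Sum>v \<in> Poly_Mapping.keys m. degree (c v ^ Poly_Mapping.lookup m v))"
    unfolding monom_value_def using degree_prod_sum_le[OF finite_keys[of m], of "\<lambda>v. c v ^ Poly_Mapping.lookup m v"]
    by (simp add: comp_def)
  also have "\<dots> \<le> block_degree k m" unfolding block_degree_def
  proof (rule sum_mono)
    fix v
    have "degree (c v ^ Poly_Mapping.lookup m v) \<le> degree (c v) * Poly_Mapping.lookup m v"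
      by (rule degree_power_le)
    also have "\<dots> \<le> (if fst v = k then 1 else 0) * Poly_Mapping.lookup m v"
      using assms(1) by (intro mult_right_mono) auto
    finally show "degree (c v ^ Poly_Mapping.lookup m v) \<le> (if fst v = k then Poly_Mapping.lookup m v else 0)"
      by (auto split: if_splits)
  qed
  also have "\<dots> \<le> N" using assms(2)[OF m] .
  finally show "degree (Polynomial.smult (Poly_Mapping.lookup F m) (monom_value c m)) \<le> N"
    using degree_smult_le order_trans by blast
qed simp

section \<open>Index pairs and ternary monomials\<close>

lemma pair_index_less:
  assumes "i \<le> j" "j < n"
  shows "pair_index i j < (n + 1) choose 2"
proof -
  have "pair_index i j < (Suc j choose 2) + Suc j"
    using assms by (simp add: pair_index_def)
  also have "\<dots> = (Suc (Suc j) choose 2)" by (simp add: numeral_2_eq_2)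
  also have "\<dots> \<le> (n + 1) choose 2"
    using assms by (intro binomial_right_mono) simp
  finally show ?thesis .
qed

lemma pair_index_commute: "pair_index i j = pair_index j i"
  by (simp add: pair_index_def max.commute min.commute)

lemma set_upper_pairs: "set (upper_pairs n) = {(i, j). i \<le> j \<and> j < n}"
  by (auto simp: upper_pairs_def simp del: upt_Suc)

lemma distinct_upper_pairs: "distinct (upper_pairs n)"
proof (induction n)
  case (Suc n)
  have "upper_pairs (Suc n) = upper_pairs n @ map (\<lambda>i. (i, n)) [0..<Suc n]"
    by (simp add: upper_pairs_def)
  then show ?case using Suc set_upper_pairs[of n]
    by (auto simp: distinct_map inj_on_def simp del: upt_Suc)
qed (simp add: upper_pairs_def)

lemma upper_pairs_nthE:
  assumes "r < (n + 1) choose 2"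
  obtains i j where "upper_pairs n ! r = (i, j)" "i \<le> j" "j < n" "pair_index i j = r"
proof -
  obtain i j where ij: "upper_pairs n ! r = (i, j)" by (cases "upper_pairs n ! r")
  have r: "r < length (upper_pairs n)" using assms by (simp add: length_upper_pairs)
  then have "(i, j) \<in> set (upper_pairs n)" using ij nth_mem by metis
  then have le: "i \<le> j" "j < n" by (auto simp: set_upper_pairs)
  have "upper_pairs n ! pair_index i j = upper_pairs n ! r"
    using upper_pairs_nth_pair_index[OF le] ij by simp
  then have "pair_index i j = r"
    using nth_eq_iff_index_eq[OF distinct_upper_pairs[of n]] r pair_index_less[OF le] by (simp add: length_upper_pairs)
  then show ?thesis using that ij le by blast
qed

lemma sum_upper_pairs:
  fixes f :: "nat \<Rightarrow> nat \<Rightarrow> 'a::comm_monoid_add"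
  shows "(\<Sum>r < (n + 1) choose 2. case upper_pairs n ! r of (i, j) \<Rightarrow> f i j) = (\<Sum>j<n. \<Sum>i<Suc j. f i j)"
proof -
  have "(\<Sum>r < (n + 1) choose 2. case upper_pairs n ! r of (i, j) \<Rightarrow> f i j)
      = sum_list (map (\<lambda>(i, j). f i j) (upper_pairs n))"
    by (simp add: sum_list_sum_nth length_upper_pairs atLeast0LessThan)
  also have "\<dots> = (\<Sum>(i, j)\<in>set (upper_pairs n). f i j)"
    using distinct_upper_pairs by (simp add: sum.distinct_set_conv_list)
  also have "set (upper_pairs n) = prod.swap ` (SIGMA j:{..<n}. {..<Suc j})"
    by (auto simp: set_upper_pairs image_iff)
  also have "(\<Sum>(i, j)\<in>prod.swap ` (SIGMA j:{..<n}. {..<Suc j}). f i j) = (\<Sum>(j, i)\<in>(SIGMA j:{..<n}. {..<Suc j}). f i j)"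
    by (subst sum.reindex) (auto simp: inj_on_def case_prod_unfold)
  also have "\<dots> = (\<Sum>j<n. \<Sum>i<Suc j. f i j)" by (subst sum.Sigma) auto
  finally show ?thesis .
qed

definition ternary_monom :: "nat \<Rightarrow> nat \<Rightarrow> nat \<Rightarrow> (nat \<Rightarrow>\<^sub>0 nat)" where
  "ternary_monom a b c = Poly_Mapping.single 0 a + Poly_Mapping.single 1 b + Poly_Mapping.single 2 c"

lemma ternary_monoms_altdef:
  "ternary_monoms d = concat (map (\<lambda>a. map (\<lambda>b. ternary_monom a b (d - a - b)) [0..<Suc (d - a)]) [0..<Suc d])"
  by (simp add: ternary_monoms_def ternary_monom_def)

lemma lookup_ternary_monom:
  "Poly_Mapping.lookup (ternary_monom a b c) k = (if k = 0 then a else if k = 1 then b else if k = 2 then c else 0)"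
  by (simp add: ternary_monom_def lookup_add lookup_single when_def)

lemma ternary_monom_inject: "ternary_monom a b c = ternary_monom a' b' c' \<longleftrightarrow> a = a' \<and> b = b' \<and> c = c'"
proof
  assume *: "ternary_monom a b c = ternary_monom a' b' c'"
  show "a = a' \<and> b = b' \<and> c = c'"
    using arg_cong[OF *, of "\<lambda>m. Poly_Mapping.lookup m 0"] arg_cong[OF *, of "\<lambda>m. Poly_Mapping.lookup m 1"]
      arg_cong[OF *, of "\<lambda>m. Poly_Mapping.lookup m 2"] by (simp add: lookup_ternary_monom)
qed simp

lemma ternary_monom_lookup:
  assumes "Poly_Mapping.keys m \<subseteq> {0, 1, 2}"
  shows "m = ternary_monom (Poly_Mapping.lookup m 0) (Poly_Mapping.lookup m 1) (Poly_Mapping.lookup m 2)"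
proof (rule poly_mapping_eqI)
  fix k
  have "Poly_Mapping.lookup m k = 0" if "k \<notin> {0, 1, 2}"
    using assms that by (meson in_keys_iff subsetD)
  then show "Poly_Mapping.lookup m k = Poly_Mapping.lookup
      (ternary_monom (Poly_Mapping.lookup m 0) (Poly_Mapping.lookup m 1) (Poly_Mapping.lookup m 2)) k"
    by (auto simp: lookup_ternary_monom)
qed

lemma set_ternary_monoms:
  "set (ternary_monoms d) = {ternary_monom a b c | a b c. a + b + c = d}"
proof (intro equalityI subsetI)
  fix m assume "m \<in> set (ternary_monoms d)"
  then obtain a b where ab: "a < Suc d" "b < Suc (d - a)" "m = ternary_monom a b (d - a - b)"
    by (auto simp: ternary_monoms_altdef simp del: upt_Suc)
  then have "a + b + (d - a - b) = d" by simp
  then show "m \<in> {ternary_monom a b c | a b c. a + b + c = d}" using ab(3) by blast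
next
  fix m assume "m \<in> {ternary_monom a b c | a b c. a + b + c = d}"
  then obtain a b c where m: "m = ternary_monom a b c" "a + b + c = d" by blast
  have "m \<in> set (map (\<lambda>b. ternary_monom a b (d - a - b)) [0..<Suc (d - a)])"
    using m by (auto simp del: upt_Suc intro!: image_eqI[of _ _ b])
  then show "m \<in> set (ternary_monoms d)"
    using m by (auto simp: ternary_monoms_altdef simp del: upt_Suc intro!: bexI[of _ a])
qed

lemma distinct_ternary_monoms: "distinct (ternary_monoms d)"
proof -
  let ?f = "\<lambda>a. map (\<lambda>b. ternary_monom a b (d - a - b)) [0..<Suc (d - a)]"
  have ne: "ternary_monom a 0 (d - a) \<in> set (?f a)" for a by (auto simp del: upt_Suc intro!: image_eqI[of _ _ 0])
  have disj: "set (?f a) \<inter> set (?f a') = {}" if "a \<noteq> a'" for a a'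
    using that by (auto simp: ternary_monom_inject simp del: upt_Suc)
  have "inj_on ?f {0..<Suc d}"
  proof (rule inj_onI)
    fix a a' assume "?f a = ?f a'"
    then have "set (?f a) = set (?f a')" by simp
    then show "a = a'" using ne[of a] disj[of a a'] by blast
  qed
  then show ?thesis unfolding ternary_monoms_altdef
    by (intro distinct_concat) (use disj in \<open>auto simp: distinct_map inj_on_def ternary_monom_inject simp del: upt_Suc\<close>)
qed

text \<open>Sums over the columns of the Chow matrix become sums over the set of monomials.\<close>

lemma sum_ternary_monoms:
  fixes f :: "(nat \<Rightarrow>\<^sub>0 nat) \<Rightarrow> 'a::comm_monoid_add"
  shows "(\<Sum>s < (d + 2) choose 2. f (ternary_monoms d ! s)) = (\<Sum>m\<in>set (ternary_monoms d). f m)"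
proof -
  have "(\<Sum>s < (d + 2) choose 2. f (ternary_monoms d ! s)) = sum_list (map f (ternary_monoms d))"
    by (simp add: sum_list_sum_nth length_ternary_monoms atLeast0LessThan)
  then show ?thesis using distinct_ternary_monoms by (simp add: sum.distinct_set_conv_list)
qed

lemma three_binomial: "3 * ((d + 2) choose 3) = d * ((d + 2) choose 2)"
proof (induction d)
  case 0 then show ?case by (simp add: numeral_3_eq_3)
next
  case (Suc d)
  have two: "2 * ((d + 2) choose 2) = (d + 2) * (d + 1)"
  proof -
    have "even ((d + 2) * (d + 1))" by simp
    then show ?thesis by (simp add: choose_two)
  qed
  have "(Suc d + 2) choose 3 = ((d + 2) choose 2) + ((d + 2) choose 3)"
    by (simp add: numeral_3_eq_3 numeral_2_eq_2)
  moreover have "(Suc d + 2) choose 2 = (d + 2) + ((d + 2) choose 2)"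
    by (simp add: numeral_2_eq_2)
  ultimately show ?case using Suc two by (simp add: algebra_simps)
qed

text \<open>The three sums of exponents are equal by symmetry, and together they are \<open>d\<close> times the
  number of monomials. This is the degree of the Chow determinant in each of the three matrices.\<close>

lemma sum_lookup_ternary_monoms:
  assumes "k < 3"
  shows "(\<Sum>m\<in>set (ternary_monoms d). Poly_Mapping.lookup m k) = (d + 2) choose 3"
proof -
  let ?S = "set (ternary_monoms d)"
  define T where "T k = (\<Sum>m\<in>?S. Poly_Mapping.lookup m k)" for k :: nat
  have bij: "(\<Sum>m\<in>?S. f m) = (\<Sum>m\<in>?S. f (h m))"
    if "\<And>m. m \<in> ?S \<Longrightarrow> h m \<in> ?S" "\<And>m. m \<in> ?S \<Longrightarrow> h (h m) = m" for f :: "_ \<Rightarrow> nat" and h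
    by (rule sum.reindex_bij_witness[of _ h h]) (use that in auto)
  have 1: "T 0 = T 1"
  proof -
    define h where "h m = ternary_monom (Poly_Mapping.lookup m 1) (Poly_Mapping.lookup m 0) (Poly_Mapping.lookup m 2)" for m :: "nat \<Rightarrow>\<^sub>0 nat"
    have "T 0 = (\<Sum>m\<in>?S. Poly_Mapping.lookup (h m) 0)" unfolding T_def
      by (rule bij) (auto simp: h_def set_ternary_monoms lookup_ternary_monom ternary_monom_inject)
    then show ?thesis by (simp add: T_def h_def lookup_ternary_monom)
  qed
  have 2: "T 0 = T 2"
  proof -
    define h where "h m = ternary_monom (Poly_Mapping.lookup m 2) (Poly_Mapping.lookup m 1) (Poly_Mapping.lookup m 0)" for m :: "nat \<Rightarrow>\<^sub>0 nat"
    have "T 0 = (\<Sum>m\<in>?S. Poly_Mapping.lookup (h m) 0)" unfolding T_def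
      by (rule bij) (auto simp: h_def set_ternary_monoms lookup_ternary_monom ternary_monom_inject)
    then show ?thesis by (simp add: T_def h_def lookup_ternary_monom)
  qed
  have "T 0 + T 1 + T 2 = (\<Sum>m\<in>?S. d)"
    unfolding T_def sum.distrib[symmetric]
    by (intro sum.cong) (auto simp: set_ternary_monoms lookup_ternary_monom)
  also have "\<dots> = d * ((d + 2) choose 2)"
    using distinct_card[OF distinct_ternary_monoms] by (simp add: length_ternary_monoms)
  also have "\<dots> = 3 * ((d + 2) choose 3)" by (rule three_binomial[symmetric])
  finally have "T 0 = (d + 2) choose 3" using 1 2 by simp
  moreover have "k = 0 \<or> k = 1 \<or> k = 2" using assms by auto
  ultimately show ?thesis using 1 2 by (auto simp: T_def)
qed

section \<open>The Chow matrix applied to a vector of monomials\<close>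

definition point3 :: "'a \<Rightarrow> 'a \<Rightarrow> 'a \<Rightarrow> nat \<Rightarrow> 'a" where
  "point3 a b c k = (if k = 0 then a else if k = 1 then b else c)"

definition net_point :: "'a::comm_ring_1 mat \<Rightarrow> 'a mat \<Rightarrow> 'a mat \<Rightarrow> 'a \<Rightarrow> 'a \<Rightarrow> 'a \<Rightarrow> 'a mat" where
  "net_point X Y Z a b c = a \<cdot>\<^sub>m X + b \<cdot>\<^sub>m Y + c \<cdot>\<^sub>m Z"

definition monom_vec :: "nat \<Rightarrow> 'a::comm_ring_1 \<Rightarrow> 'a \<Rightarrow> 'a \<Rightarrow> 'a vec" where
  "monom_vec n a b c = vec ((n + 1) choose 2) (\<lambda>s. monom_value (point3 a b c) (ternary_monoms (n - 1) ! s))"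

lemma monom_value_ternary_monom:
  "monom_value (point3 a b c) (ternary_monom i j k) = a ^ i * b ^ j * c ^ k"
  unfolding ternary_monom_def monom_value_add monom_value_single by (simp add: point3_def)

lemma net_point_carrier:
  "X \<in> carrier_mat n n \<Longrightarrow> Y \<in> carrier_mat n n \<Longrightarrow> Z \<in> carrier_mat n n \<Longrightarrow> net_point X Y Z a b c \<in> carrier_mat n n"
  by (simp add: net_point_def)

lemma net_point_index:
  "X \<in> carrier_mat n n \<Longrightarrow> Y \<in> carrier_mat n n \<Longrightarrow> Z \<in> carrier_mat n n \<Longrightarrow> i < n \<Longrightarrow> j < n \<Longrightarrow>
    net_point X Y Z a b c $$ (i, j) = a * X $$ (i, j) + b * Y $$ (i, j) + c * Z $$ (i, j)"
  by (simp add: net_point_def)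

lemma net_mat_carrier:
  "X \<in> carrier_mat n n \<Longrightarrow> Y \<in> carrier_mat n n \<Longrightarrow> Z \<in> carrier_mat n n \<Longrightarrow> net_mat X Y Z \<in> carrier_mat n n"
  by (simp add: net_mat_def)

lemma net_mat_index:
  assumes "X \<in> carrier_mat n n" "Y \<in> carrier_mat n n" "Z \<in> carrier_mat n n" "i < n" "j < n"
  shows "net_mat X Y Z $$ (i, j) = Poly_Mapping.single (Poly_Mapping.single 0 1) (X $$ (i, j))
    + Poly_Mapping.single (Poly_Mapping.single 1 1) (Y $$ (i, j)) + Poly_Mapping.single (Poly_Mapping.single 2 1) (Z $$ (i, j))"
  using assms by (simp add: net_mat_def Var_def Const_def mult_single)

lemma map_poly_value_net_mat:
  assumes "X \<in> carrier_mat n n" "Y \<in> carrier_mat n n" "Z \<in> carrier_mat n n"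
  shows "map_mat (poly_value (point3 a b c)) (net_mat X Y Z) = net_point X Y Z a b c"
proof (rule eq_matI)
  fix i j assume "i < dim_row (net_point X Y Z a b c)" "j < dim_col (net_point X Y Z a b c)"
  then have ij: "i < n" "j < n" using net_point_carrier[OF assms, of a b c] by auto
  have "map_mat (poly_value (point3 a b c)) (net_mat X Y Z) $$ (i, j) = poly_value (point3 a b c) (net_mat X Y Z $$ (i, j))"
    using ij net_mat_carrier[OF assms] by simp
  also have "\<dots> = net_point X Y Z a b c $$ (i, j)"
    using assms ij unfolding net_mat_index[OF assms ij] poly_value_add poly_value_single monom_value_single
    by (simp add: point3_def net_point_index mult.commute)
  finally show "map_mat (poly_value (point3 a b c)) (net_mat X Y Z) $$ (i, j) = net_point X Y Z a b c $$ (i, j)" .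
qed (use net_point_carrier[OF assms, of a b c] net_mat_carrier[OF assms] in auto)

definition ternary_forms :: "nat \<Rightarrow> (nat, 'a::comm_ring_1) polys set" where
  "ternary_forms d = {P. \<forall>m\<in>Poly_Mapping.keys P. Poly_Mapping.keys m \<subseteq> {0, 1, 2} \<and>
     Poly_Mapping.lookup m 0 + Poly_Mapping.lookup m 1 + Poly_Mapping.lookup m 2 = d}"

text \<open>The entries of the adjugate are forms of degree \<open>n - 1\<close>, so the Chow matrix records all of
  their coefficients.\<close>

lemma keys_adj_net_mat:
  assumes XYZ: "X \<in> carrier_mat n n" "Y \<in> carrier_mat n n" "Z \<in> carrier_mat n n" and ij: "i < n" "j < n"
  shows "Poly_Mapping.keys (adj_mat (net_mat X Y Z) $$ (i, j)) \<subseteq> set (ternary_monoms (n - 1))"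
proof -
  have "adj_mat (net_mat X Y Z) $$ (i, j) \<in> ternary_forms (n - 1)"
  proof (rule adj_mat_mem_graded[of ternary_forms, OF _ _ _ _ _ net_mat_carrier[OF XYZ]])
    show "0 \<in> ternary_forms i" for i by (simp add: ternary_forms_def)
    show "1 \<in> ternary_forms 0" by (simp add: ternary_forms_def)
    show "x + y \<in> ternary_forms i" if "x \<in> ternary_forms i" "y \<in> ternary_forms i" for i and x y :: "(nat, 'a) polys"
      using that Poly_Mapping.keys_add[of x y] unfolding ternary_forms_def by blast
    show "- x \<in> ternary_forms i" if "x \<in> ternary_forms i" for i and x :: "(nat, 'a) polys"
      using that unfolding ternary_forms_def by simp
    show "x * y \<in> ternary_forms (i + j)" if "x \<in> ternary_forms i" "y \<in> ternary_forms j" for i j and x y :: "(nat, 'a) polys"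
      unfolding ternary_forms_def
    proof (intro CollectI ballI)
      fix m assume "m \<in> Poly_Mapping.keys (x * y)"
      then obtain a b where m: "m = a + b" "a \<in> Poly_Mapping.keys x" "b \<in> Poly_Mapping.keys y" by (rule mem_keys_multE)
      then have "Poly_Mapping.keys a \<subseteq> {0, 1, 2}" "Poly_Mapping.keys b \<subseteq> {0, 1, 2}"
        using that unfolding ternary_forms_def by blast+
      then have "Poly_Mapping.keys m \<subseteq> {0, 1, 2}" using Poly_Mapping.keys_add[of a b] m(1) by blast
      moreover have "Poly_Mapping.lookup m 0 + Poly_Mapping.lookup m 1 + Poly_Mapping.lookup m 2 = i + j"
        using that m unfolding ternary_forms_def by (force simp: lookup_add)
      ultimately show "Poly_Mapping.keys m \<subseteq> {0, 1, 2} \<and>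
        Poly_Mapping.lookup m 0 + Poly_Mapping.lookup m 1 + Poly_Mapping.lookup m 2 = i + j" by blast
    qed
    show "net_mat X Y Z $$ (r, c) \<in> ternary_forms 1" if "r < n" "c < n" for r c
    proof -
      have add: "x + y \<in> ternary_forms 1" if "x \<in> ternary_forms 1" "y \<in> ternary_forms 1" for x y :: "(nat, 'a) polys"
        using that Poly_Mapping.keys_add[of x y] unfolding ternary_forms_def by blast
      have "Poly_Mapping.single (Poly_Mapping.single k 1) x \<in> ternary_forms 1" if "k < 3" for x :: 'a and k
        using that by (cases "x = 0") (auto simp: ternary_forms_def lookup_single when_def)
      then show ?thesis unfolding net_mat_index[OF XYZ that] by (intro add) auto
    qed
  qed (use ij in auto)
  then show ?thesis
  proof (intro subsetI)
    fix m assume "m \<in> Poly_Mapping.keys (adj_mat (net_mat X Y Z) $$ (i, j))"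
    with \<open>adj_mat (net_mat X Y Z) $$ (i, j) \<in> ternary_forms (n - 1)\<close>
    have "Poly_Mapping.keys m \<subseteq> {0, 1, 2}"
      "Poly_Mapping.lookup m 0 + Poly_Mapping.lookup m 1 + Poly_Mapping.lookup m 2 = n - 1"
      unfolding ternary_forms_def by auto
    then show "m \<in> set (ternary_monoms (n - 1))"
      using ternary_monom_lookup unfolding set_ternary_monoms by fast
  qed
qed

lemma chow_mat_carrier: "chow_mat n X Y Z \<in> carrier_mat ((n + 1) choose 2) ((n + 1) choose 2)"
  by (simp add: chow_mat_def)

text \<open>Multiplying a row of coefficients by the values of the monomials evaluates the form; the
  adjugate commutes with evaluation.\<close>

lemma chow_mat_mult_monom_vec:
  assumes XYZ: "X \<in> carrier_mat n n" "Y \<in> carrier_mat n n" "Z \<in> carrier_mat n n" and n: "1 \<le> n"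
  shows "chow_mat n X Y Z *\<^sub>v monom_vec n a b c = sym_coords n (adj_mat (net_point X Y Z a b c))"
proof (rule eq_vecI)
  fix r assume "r < dim_vec (sym_coords n (adj_mat (net_point X Y Z a b c)))"
  then have r: "r < (n + 1) choose 2" by (simp add: sym_coords_def)
  then obtain i j where ij: "upper_pairs n ! r = (i, j)" "i \<le> j" "j < n" by (rule upper_pairs_nthE)
  let ?P = "adj_mat (net_mat X Y Z) $$ (i, j)" and ?\<alpha> = "point3 a b c"
  have n2: "(n + 1) choose 2 = (n - 1 + 2) choose 2" using n by simp
  have "(chow_mat n X Y Z *\<^sub>v monom_vec n a b c) $ r
      = (\<Sum>s<(n + 1) choose 2. chow_mat n X Y Z $$ (r, s) * monom_vec n a b c $ s)"
    by (rule index_mult_mat_vec_sum[OF chow_mat_carrier _ r]) (simp add: monom_vec_def)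
  also have "\<dots> = (\<Sum>s<(n - 1 + 2) choose 2. Poly_Mapping.lookup ?P (ternary_monoms (n - 1) ! s) * monom_value ?\<alpha> (ternary_monoms (n - 1) ! s))"
    unfolding n2[symmetric] using r by (intro sum.cong) (auto simp: chow_mat_def monom_vec_def ij)
  also have "\<dots> = (\<Sum>m\<in>set (ternary_monoms (n - 1)). Poly_Mapping.lookup ?P m * monom_value ?\<alpha> m)"
    by (rule sum_ternary_monoms)
  also have "\<dots> = poly_value ?\<alpha> ?P"
    using keys_adj_net_mat[OF XYZ, of i j] ij by (intro poly_value_superset[symmetric]) auto
  also have "\<dots> = adj_mat (net_point X Y Z a b c) $$ (i, j)"
    using comm_ring_hom_adj_mat[OF comm_ring_hom_poly_value net_mat_carrier[OF XYZ], of i j ?\<alpha>] ij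
    by (simp add: map_poly_value_net_mat[OF XYZ])
  finally show "(chow_mat n X Y Z *\<^sub>v monom_vec n a b c) $ r = sym_coords n (adj_mat (net_point X Y Z a b c)) $ r"
    using r ij by (simp add: sym_coords_def)
qed (simp add: sym_coords_def chow_mat_def)

text \<open>The vector of the monomials at a nonzero point contains a power of each coordinate, so it
  is nonzero, and it lies in the kernel when the adjugate vanishes at that point.\<close>

lemma det_chow_mat_eq_0_if_corank_2:
  fixes X Y Z :: "complex mat"
  assumes XYZ: "X \<in> carrier_mat n n" "Y \<in> carrier_mat n n" "Z \<in> carrier_mat n n" and n: "1 \<le> n"
    and abc: "a \<noteq> 0 \<or> b \<noteq> 0 \<or> c \<noteq> 0" and adj: "adj_mat (net_point X Y Z a b c) = 0\<^sub>m n n"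
  shows "det (chow_mat n X Y Z) = 0"
proof -
  let ?m = "(n + 1) choose 2"
  have "chow_mat n X Y Z *\<^sub>v monom_vec n a b c = 0\<^sub>v ?m"
    unfolding chow_mat_mult_monom_vec[OF XYZ n] adj
  proof (rule eq_vecI)
    fix r assume "r < dim_vec (0\<^sub>v ?m :: complex vec)"
    then have r: "r < ?m" by simp
    then obtain i j where ij: "upper_pairs n ! r = (i, j)" "i \<le> j" "j < n" by (rule upper_pairs_nthE)
    then show "sym_coords n (0\<^sub>m n n) $ r = 0\<^sub>v ?m $ r" using r by (simp add: sym_coords_def)
  qed (simp add: sym_coords_def)
  moreover have "monom_vec n a b c \<noteq> 0\<^sub>v ?m"
  proof
    assume 0: "monom_vec n a b c = 0\<^sub>v ?m"
    have z: "monom_value (point3 a b c) m = 0" if mem: "m \<in> set (ternary_monoms (n - 1))" for m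
    proof -
      obtain s where s: "s < length (ternary_monoms (n - 1))" "ternary_monoms (n - 1) ! s = m"
        by (rule exE[OF in_set_conv_nth[THEN iffD1, OF mem]]) (erule conjE, rule that)
      then have "s < ?m" using n by (simp add: length_ternary_monoms)
      then have "monom_vec n a b c $ s = monom_value (point3 a b c) m" unfolding monom_vec_def using s(2) by (simp del: One_nat_def)
      then show ?thesis using 0 \<open>s < ?m\<close> by simp
    qed
    have "ternary_monom (n - 1) 0 0 \<in> set (ternary_monoms (n - 1))" "ternary_monom 0 (n - 1) 0 \<in> set (ternary_monoms (n - 1))"
      "ternary_monom 0 0 (n - 1) \<in> set (ternary_monoms (n - 1))" by (auto simp: set_ternary_monoms ternary_monom_inject)
    from this[THEN z] show False using abc by (auto simp: monom_value_ternary_monom)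
  qed
  moreover have "monom_vec n a b c \<in> carrier_vec ?m" by (simp add: monom_vec_def)
  ultimately show ?thesis using det_0_iff_vec_prod_zero_field[OF chow_mat_carrier] by blast
qed

section \<open>Interpolation at nodes\<close>

definition node_mat :: "nat \<Rightarrow> complex mat" where
  "node_mat n = mat ((n + 1) choose 2) ((n + 1) choose 2) (\<lambda>(s, q). monom_vec n 1 (2 ^ q) (2 ^ (q * n)) $ s)"

text \<open>At the \<open>q\<close>-th node \<open>(1, 2\<^sup>q, 2\<^sup>n\<^sup>q)\<close> the monomial \<open>x\<^sup>a y\<^sup>b z\<^sup>c\<close> has the value
  \<open>(2 ^ (b + n c)) ^ q\<close>. Since \<open>b < n\<close>, the exponents \<open>b + n c\<close> are distinct, so this is a
  Vandermonde matrix.\<close>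

lemma det_node_mat:
  assumes n: "1 \<le> n"
  shows "det (node_mat n) \<noteq> 0"
proof
  let ?m = "(n + 1) choose 2"
  have E: "node_mat n \<in> carrier_mat ?m ?m" by (simp add: node_mat_def)
  assume "det (node_mat n) = 0"
  then obtain u where u: "u \<in> carrier_vec ?m" "u \<noteq> 0\<^sub>v ?m" "node_mat n *\<^sub>v u = 0\<^sub>v ?m"
    using det_0_iff_vec_prod_zero_field[OF E] by auto
  define y where "y m = (2::complex) ^ (Poly_Mapping.lookup m 1 + n * Poly_Mapping.lookup m 2)" for m :: "nat \<Rightarrow>\<^sub>0 nat"
  have inj: "inj_on y (set (ternary_monoms (n - 1)))"
  proof (rule inj_onI)
    fix m m' assume m: "m \<in> set (ternary_monoms (n - 1))" "m' \<in> set (ternary_monoms (n - 1))" "y m = y m'"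
    obtain a b c where abc: "m = ternary_monom a b c" "a + b + c = n - 1" using m(1) by (auto simp: set_ternary_monoms)
    obtain a' b' c' where abc': "m' = ternary_monom a' b' c'" "a' + b' + c' = n - 1" using m(2) by (auto simp: set_ternary_monoms)
    have "b + n * c = b' + n * c'"
    proof -
      have "(2::complex) ^ (b + n * c) = 2 ^ (b' + n * c')" using m(3) by (simp add: y_def abc abc' lookup_ternary_monom)
      then have "(2::nat) ^ (b + n * c) = 2 ^ (b' + n * c')" by (metis of_nat_eq_iff of_nat_numeral of_nat_power)
      then show ?thesis by simp
    qed
    moreover have "b < n" "b' < n" using abc abc' n by auto
    moreover have "(b + n * c) mod n = b" "(b' + n * c') mod n = b'" using \<open>b < n\<close> \<open>b' < n\<close> by simp_all
    ultimately have "b = b'" by metis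
    then have cc: "c = c'" using \<open>b + n * c = b' + n * c'\<close> n by simp
    then have "a = a'" using abc(2) abc'(2) \<open>b = b'\<close> by linarith
    then show "m = m'" unfolding abc(1) abc'(1) using \<open>b = b'\<close> cc by (simp only:)
  qed
  \<comment> \<open>a relation between the columns is a polynomial that vanishes at all \<open>y m\<close>\<close>
  define p where "p = (\<Sum>q<?m. Polynomial.monom (u $ q) q)"
  have root: "poly p (y m) = 0" if m: "m \<in> set (ternary_monoms (n - 1))" for m
  proof -
    obtain s where s: "s < length (ternary_monoms (n - 1))" "m = ternary_monoms (n - 1) ! s" using m by (metis in_set_conv_nth)
    then have sm: "s < ?m" using n by (simp add: length_ternary_monoms)
    obtain a b c where abc: "m = ternary_monom a b c" using m by (auto simp: set_ternary_monoms)
    have "poly p (y m) = (\<Sum>q<?m. node_mat n $$ (s, q) * u $ q)"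
      unfolding p_def poly_sum poly_monom using sm
      by (intro sum.cong refl) (simp add: node_mat_def monom_vec_def s(2)[symmetric] abc monom_value_ternary_monom y_def
          lookup_ternary_monom power_mult[symmetric] power_add[symmetric] algebra_simps del: One_nat_def)
    also have "\<dots> = (node_mat n *\<^sub>v u) $ s" by (rule index_mult_mat_vec_sum[OF E u(1) sm, symmetric])
    also have "\<dots> = 0" using u(3) sm by simp
    finally show ?thesis .
  qed
  have "p = 0"
  proof (rule ccontr)
    assume p: "p \<noteq> 0"
    have "?m = card (set (ternary_monoms (n - 1)))"
      using distinct_card[OF distinct_ternary_monoms] n by (simp add: length_ternary_monoms)
    also have "\<dots> = card (y ` set (ternary_monoms (n - 1)))" using card_image[OF inj] by simp
    also have "\<dots> \<le> card {x. poly p x = 0}" using root poly_roots_finite[OF p] by (intro card_mono) auto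
    also have "\<dots> \<le> degree p" by (rule card_poly_roots_bound[OF p])
    also have "degree p < ?m"
      unfolding p_def by (rule degree_sum_less) (use n in \<open>auto intro: le_less_trans[OF degree_monom_le]\<close>)
    finally show False by simp
  qed
  moreover have "Polynomial.coeff p q = u $ q" if "q < ?m" for q
    using that by (simp add: p_def coeff_sum)
  ultimately show False using u(1,2) by (auto simp: Matrix.vec_eq_iff)
qed

text \<open>The vectors of monomials at the nodes span the whole space.\<close>

lemma mat_eqI_nodes:
  fixes A B :: "complex mat"
  assumes n: "1 \<le> n" and A: "A \<in> carrier_mat ((n + 1) choose 2) ((n + 1) choose 2)" and B: "B \<in> carrier_mat ((n + 1) choose 2) ((n + 1) choose 2)"
    and eq: "\<And>q. A *\<^sub>v monom_vec n 1 (2 ^ q) (2 ^ (q * n)) = B *\<^sub>v monom_vec n 1 (2 ^ q) (2 ^ (q * n))"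
  shows "A = B"
proof -
  let ?m = "(n + 1) choose 2"
  have E: "node_mat n \<in> carrier_mat ?m ?m" by (simp add: node_mat_def)
  have "A * node_mat n = B * node_mat n"
  proof (rule eq_matI)
    fix r q assume "r < dim_row (B * node_mat n)" "q < dim_col (B * node_mat n)"
    then have rq: "r < ?m" "q < ?m" using B E by auto
    have col: "(M * node_mat n) $$ (r, q) = (M *\<^sub>v monom_vec n 1 (2 ^ q) (2 ^ (q * n))) $ r" if M: "M \<in> carrier_mat ?m ?m" for M
      using rq by (subst index_mult_mat_sum[OF M E rq], subst index_mult_mat_vec_sum[OF M _ rq(1)])
        (auto simp: node_mat_def monom_vec_def)
    show "(A * node_mat n) $$ (r, q) = (B * node_mat n) $$ (r, q)" unfolding col[OF A] col[OF B] eq ..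
  qed (use A B in auto)
  then have *: "A * node_mat n * adj_mat (node_mat n) = B * node_mat n * adj_mat (node_mat n)" by simp
  have "M * node_mat n * adj_mat (node_mat n) = det (node_mat n) \<cdot>\<^sub>m M" if M: "M \<in> carrier_mat ?m ?m" for M
  proof -
    have "M * node_mat n * adj_mat (node_mat n) = M * (det (node_mat n) \<cdot>\<^sub>m 1\<^sub>m ?m)"
      using assoc_mult_mat[OF M E adj_mat(1)[OF E]] adj_mat(2)[OF E] by simp
    also have "\<dots> = det (node_mat n) \<cdot>\<^sub>m (M * 1\<^sub>m ?m)" by (rule mult_smult_distrib[OF M one_carrier_mat])
    finally show ?thesis using right_mult_one_mat[OF M] by simp
  qed
  then have eq: "det (node_mat n) \<cdot>\<^sub>m A = det (node_mat n) \<cdot>\<^sub>m B" using * A B by simp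
  show ?thesis
  proof (rule eq_matI)
    fix i j assume ij: "i < dim_row B" "j < dim_col B"
    have "(det (node_mat n) \<cdot>\<^sub>m A) $$ (i, j) = (det (node_mat n) \<cdot>\<^sub>m B) $$ (i, j)" using eq by simp
    then show "A $$ (i, j) = B $$ (i, j)" using ij A B det_node_mat[OF n] by auto
  qed (use A B in auto)
qed

text \<open>Ring homomorphisms commute with evaluation at integral points and with the adjugate, and
  the nodes are integral.\<close>

lemma map_mat_chow_mat:
  fixes h :: "'r::comm_ring_1 \<Rightarrow> complex"
  assumes h: "comm_ring_hom h" and XYZ: "X \<in> carrier_mat n n" "Y \<in> carrier_mat n n" "Z \<in> carrier_mat n n" and n: "1 \<le> n"
  shows "map_mat h (chow_mat n X Y Z) = chow_mat n (map_mat h X) (map_mat h Y) (map_mat h Z)"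
proof (rule mat_eqI_nodes[OF n])
  interpret comm_ring_hom h by fact
  let ?m = "(n + 1) choose 2"
  fix q :: nat
  let ?a = "1 :: 'r" and ?b = "2 ^ q :: 'r" and ?c = "2 ^ (q * n) :: 'r"
  have hv: "map_vec h (monom_vec n ?a ?b ?c) = monom_vec n 1 (2 ^ q) (2 ^ (q * n))"
  proof (rule eq_vecI)
    fix s assume "s < dim_vec (monom_vec n (1::complex) (2 ^ q) (2 ^ (q * n)))"
    then have s: "s < ?m" by (simp add: monom_vec_def)
    then have "ternary_monoms (n - 1) ! s \<in> set (ternary_monoms (n - 1))" using n by (intro nth_mem) (simp add: length_ternary_monoms)
    then obtain a b c where abc: "ternary_monoms (n - 1) ! s = ternary_monom a b c" by (auto simp: set_ternary_monoms)
    show "map_vec h (monom_vec n ?a ?b ?c) $ s = monom_vec n 1 (2 ^ q) (2 ^ (q * n)) $ s"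
      using s by (simp add: monom_vec_def abc monom_value_ternary_monom hom_distribs del: One_nat_def)
  qed (simp add: monom_vec_def)
  have np: "map_mat h (net_point X Y Z ?a ?b ?c) = net_point (map_mat h X) (map_mat h Y) (map_mat h Z) 1 (2 ^ q) (2 ^ (q * n))"
    using XYZ by (intro eq_matI) (auto simp: net_point_def hom_distribs)
  have "map_mat h (chow_mat n X Y Z) *\<^sub>v monom_vec n 1 (2 ^ q) (2 ^ (q * n)) = map_vec h (chow_mat n X Y Z *\<^sub>v monom_vec n ?a ?b ?c)"
    unfolding hv[symmetric] by (rule mult_mat_vec_hom[symmetric, OF chow_mat_carrier]) (simp add: monom_vec_def)
  also have "\<dots> = map_vec h (sym_coords n (adj_mat (net_point X Y Z ?a ?b ?c)))" by (simp only: chow_mat_mult_monom_vec[OF XYZ n])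
  also have "\<dots> = sym_coords n (adj_mat (net_point (map_mat h X) (map_mat h Y) (map_mat h Z) 1 (2 ^ q) (2 ^ (q * n))))"
  proof (rule eq_vecI)
    fix r assume "r < dim_vec (sym_coords n (adj_mat (net_point (map_mat h X) (map_mat h Y) (map_mat h Z) 1 (2 ^ q) (2 ^ (q * n)))))"
    then have r: "r < ?m" by (simp add: sym_coords_def)
    then obtain i j where ij: "upper_pairs n ! r = (i, j)" "i \<le> j" "j < n" by (rule upper_pairs_nthE)
    show "map_vec h (sym_coords n (adj_mat (net_point X Y Z ?a ?b ?c))) $ r =
        sym_coords n (adj_mat (net_point (map_mat h X) (map_mat h Y) (map_mat h Z) 1 (2 ^ q) (2 ^ (q * n)))) $ r"
      using r ij comm_ring_hom_adj_mat[OF h net_point_carrier[OF XYZ], of i j ?a ?b ?c] by (simp add: sym_coords_def np)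
  qed (simp add: sym_coords_def)
  also have "\<dots> = chow_mat n (map_mat h X) (map_mat h Y) (map_mat h Z) *\<^sub>v monom_vec n 1 (2 ^ q) (2 ^ (q * n))"
    using XYZ n by (intro chow_mat_mult_monom_vec[symmetric]) auto
  finally show "map_mat h (chow_mat n X Y Z) *\<^sub>v monom_vec n 1 (2 ^ q) (2 ^ (q * n)) = \<dots>" .
qed (auto simp: chow_mat_def)

section \<open>Continuity and holomorphy of determinants\<close>

text \<open>Stated for a set of functions that is closed under the operations in the Leibniz formula,
  so that continuity and holomorphy are instances of one proof.\<close>

lemma det_mem_fun_algebra:
  fixes f :: "'x \<Rightarrow> complex mat" and K :: "('x \<Rightarrow> complex) set"
  assumes const: "\<And>c. (\<lambda>_. c) \<in> K"
    and add: "\<And>g h. g \<in> K \<Longrightarrow> h \<in> K \<Longrightarrow> (\<lambda>x. g x + h x) \<in> K"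
    and mult: "\<And>g h. g \<in> K \<Longrightarrow> h \<in> K \<Longrightarrow> (\<lambda>x. g x * h x) \<in> K"
    and f: "\<And>x. f x \<in> carrier_mat n n"
    and ent: "\<And>i j. i < n \<Longrightarrow> j < n \<Longrightarrow> (\<lambda>x. f x $$ (i, j)) \<in> K"
  shows "(\<lambda>x. det (f x)) \<in> K"
proof -
  have sum: "(\<lambda>x. \<Sum>p\<in>S. g p x) \<in> K" if "\<And>p. p \<in> S \<Longrightarrow> g p \<in> K" for S :: "(nat \<Rightarrow> nat) set" and g
    using that by (induction S rule: infinite_finite_induct) (auto intro: const add)
  have prod: "(\<lambda>x. \<Prod>p\<in>S. g p x) \<in> K" if "\<And>p. p \<in> S \<Longrightarrow> g p \<in> K" for S :: "nat set" and g
    using that by (induction S rule: infinite_finite_induct) (auto intro: const mult)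
  have eq: "(\<lambda>x. det (f x)) = (\<lambda>x. \<Sum>p\<in>{p. p permutes {0..<n}}. signof p * (\<Prod>i = 0..<n. f x $$ (i, p i)))"
    by (intro ext det_def'[OF f])
  show ?thesis unfolding eq
  proof (intro sum mult const prod)
    fix p i assume "p \<in> {p. p permutes {0..<n}}" "i \<in> {0..<n}"
    then show "(\<lambda>x. f x $$ (i, p i)) \<in> K" using permutes_in_image[of p "{0..<n}" i] by (intro ent) auto
  qed
qed

lemma adj_mat_mem_fun_algebra:
  fixes f :: "'x \<Rightarrow> complex mat" and K :: "('x \<Rightarrow> complex) set"
  assumes const: "\<And>c. (\<lambda>_. c) \<in> K"
    and add: "\<And>g h. g \<in> K \<Longrightarrow> h \<in> K \<Longrightarrow> (\<lambda>x. g x + h x) \<in> K"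
    and mult: "\<And>g h. g \<in> K \<Longrightarrow> h \<in> K \<Longrightarrow> (\<lambda>x. g x * h x) \<in> K"
    and f: "\<And>x. f x \<in> carrier_mat n n"
    and ent: "\<And>i j. i < n \<Longrightarrow> j < n \<Longrightarrow> (\<lambda>x. f x $$ (i, j)) \<in> K"
    and ij: "i < n" "j < n"
  shows "(\<lambda>x. adj_mat (f x) $$ (i, j)) \<in> K"
proof -
  have "(\<lambda>x. det (mat_delete (f x) j i)) \<in> K"
  proof (rule det_mem_fun_algebra[OF const add mult])
    show "mat_delete (f x) j i \<in> carrier_mat (n - 1) (n - 1)" for x using mat_delete_carrier[OF f] .
    fix r c assume rc: "r < n - 1" "c < n - 1"
    have "(\<lambda>x. mat_delete (f x) j i $$ (r, c)) = (\<lambda>x. f x $$ (if r < j then r else Suc r, if c < i then c else Suc c))"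
      using rc f by (auto simp: mat_delete_def fun_eq_iff carrier_matD[OF f])
    also have "\<dots> \<in> K" using rc by (intro ent) auto
    finally show "(\<lambda>x. mat_delete (f x) j i $$ (r, c)) \<in> K" .
  qed
  then have "(\<lambda>x. (-1) ^ (j + i) * det (mat_delete (f x) j i)) \<in> K" by (intro mult const)
  then show ?thesis using ij f by (simp add: adj_mat_def cofactor_def carrier_matD[OF f])
qed

lemma continuous_on_adj_mat:
  fixes f :: "'x::topological_space \<Rightarrow> complex mat"
  assumes "\<And>x. f x \<in> carrier_mat n n" "\<And>i j. i < n \<Longrightarrow> j < n \<Longrightarrow> continuous_on S (\<lambda>x. f x $$ (i, j))" "i < n" "j < n"
  shows "continuous_on S (\<lambda>x. adj_mat (f x) $$ (i, j))"
  using adj_mat_mem_fun_algebra[of "{g. continuous_on S g}" f n i j] assms by (auto intro: continuous_intros)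

lemma holomorphic_on_det:
  fixes f :: "complex \<Rightarrow> complex mat"
  assumes "\<And>x. f x \<in> carrier_mat n n" "\<And>i j. i < n \<Longrightarrow> j < n \<Longrightarrow> (\<lambda>x. f x $$ (i, j)) holomorphic_on S"
  shows "(\<lambda>x. det (f x)) holomorphic_on S"
  using det_mem_fun_algebra[of "{g. g holomorphic_on S}" f n] assms by (auto intro: holomorphic_intros)

lemma holomorphic_on_adj_mat:
  fixes f :: "complex \<Rightarrow> complex mat"
  assumes "\<And>x. f x \<in> carrier_mat n n" "\<And>i j. i < n \<Longrightarrow> j < n \<Longrightarrow> (\<lambda>x. f x $$ (i, j)) holomorphic_on S" "i < n" "j < n"
  shows "(\<lambda>x. adj_mat (f x) $$ (i, j)) holomorphic_on S"
  using adj_mat_mem_fun_algebra[of "{g. g holomorphic_on S}" f n i j] assms by (auto intro: holomorphic_intros)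

section \<open>Homogeneous solutions of negative degree\<close>

lemma mult_mat_zero_vec:
  assumes "A \<in> carrier_mat nr nc"
  shows "A *\<^sub>v 0\<^sub>v nc = 0\<^sub>v nr"
  using assms by (intro eq_vecI) (auto simp: index_mult_mat_vec_sum[OF assms zero_carrier_vec])

lemma smult_one_mult_vec:
  fixes v :: "'a::comm_ring_1 vec"
  assumes v: "v \<in> carrier_vec n"
  shows "(c \<cdot>\<^sub>m 1\<^sub>m n) *\<^sub>v v = c \<cdot>\<^sub>v v"
proof (rule eq_vecI)
  fix i assume "i < dim_vec (c \<cdot>\<^sub>v v)"
  then have i: "i < n" using v by simp
  have "((c \<cdot>\<^sub>m 1\<^sub>m n) *\<^sub>v v) $ i = (\<Sum>l<n. if i = l then c * v $ l else 0)"
    unfolding index_mult_mat_vec_sum[OF smult_carrier_mat[OF one_carrier_mat] v i] using i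
    by (intro sum.cong) auto
  then show "((c \<cdot>\<^sub>m 1\<^sub>m n) *\<^sub>v v) $ i = (c \<cdot>\<^sub>v v) $ i" using i v by simp
qed (use v in simp)

text \<open>Near a point where the determinant is nonzero, Cramer's rule expresses the solution by
  holomorphic functions.\<close>

lemma solution_differentiable:
  fixes A :: "complex \<Rightarrow> complex mat" and v :: "complex \<Rightarrow> complex vec"
  assumes A: "\<And>t. A t \<in> carrier_mat m m" and hol: "\<And>i j. i < m \<Longrightarrow> j < m \<Longrightarrow> (\<lambda>t. A t $$ (i, j)) holomorphic_on UNIV"
    and v: "\<And>t. v t \<in> carrier_vec m" and sol: "\<And>t. A t *\<^sub>v v t = w" and w: "w \<in> carrier_vec m"
    and d: "det (A t0) \<noteq> 0" and s: "s < m"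
  shows "(\<lambda>t. v t $ s) field_differentiable at t0"
proof -
  define U where "U = {t. det (A t) \<noteq> 0}"
  have hd: "(\<lambda>t. det (A t)) holomorphic_on UNIV" by (rule holomorphic_on_det[OF A hol])
  have "open U"
  proof -
    have "continuous_on UNIV (\<lambda>t. det (A t))" by (rule holomorphic_on_imp_continuous_on[OF hd])
    then have "open ((\<lambda>t. det (A t)) -` (- {0}))" by (intro open_vimage) auto
    then show ?thesis by (simp add: U_def vimage_def)
  qed
  have "(\<lambda>t. (\<Sum>r<m. adj_mat (A t) $$ (s, r) * w $ r) / det (A t)) holomorphic_on U"
    using hd holomorphic_on_adj_mat[OF A hol s]
    by (intro holomorphic_intros) (auto simp: U_def intro: holomorphic_on_subset)
  moreover have "(\<Sum>r<m. adj_mat (A t) $$ (s, r) * w $ r) / det (A t) = v t $ s" if t: "t \<in> U" for t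
  proof -
    have "adj_mat (A t) *\<^sub>v w = (adj_mat (A t) * A t) *\<^sub>v v t"
      using assoc_mult_mat_vec[OF adj_mat(1)[OF A] A v] sol by simp
    also have "\<dots> = (det (A t) \<cdot>\<^sub>m 1\<^sub>m m) *\<^sub>v v t" by (simp only: adj_mat(3)[OF A])
    also have "\<dots> = det (A t) \<cdot>\<^sub>v v t"
      by (rule smult_one_mult_vec[OF v])
    finally have "(adj_mat (A t) *\<^sub>v w) $ s = det (A t) * v t $ s" using s v[of t] by simp
    moreover have "(adj_mat (A t) *\<^sub>v w) $ s = (\<Sum>r<m. adj_mat (A t) $$ (s, r) * w $ r)"
      by (rule index_mult_mat_vec_sum[OF adj_mat(1)[OF A] w s])
    ultimately show ?thesis using t by (simp add: U_def)
  qed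
  ultimately have "(\<lambda>t. v t $ s) holomorphic_on U" by (rule holomorphic_transform)
  then show ?thesis using \<open>open U\<close> d by (intro holomorphic_on_imp_differentiable_at[of _ U]) (auto simp: U_def)
qed

text \<open>On the line of the points \<open>(1, t)\<close> the solution is an entire function by Cramer's rule. By
  homogeneity \<open>sol 1 t = sol (1/t) 1 / t\<close>, which tends to 0 as \<open>t\<close> tends to infinity, so the
  solution is 0 by Liouville's theorem and hence so is the right-hand side. The regularizing term
  \<open>R\<close> makes the square system invertible near the point \<open>(a0, b0)\<close> and may depend on that point.\<close>

lemma homogeneous_solution_trivial:
  fixes sol :: "complex \<Rightarrow> complex \<Rightarrow> complex vec"
  assumes car: "\<And>a b. sol a b \<in> carrier_vec m" and w: "w \<in> carrier_vec m"
    and hom: "\<And>t a b. t \<noteq> 0 \<Longrightarrow> a \<noteq> 0 \<or> b \<noteq> 0 \<Longrightarrow> sol (t * a) (t * b) = inverse t \<cdot>\<^sub>v sol a b"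
    and loc: "\<And>a0 b0. a0 \<noteq> 0 \<or> b0 \<noteq> 0 \<Longrightarrow> \<exists>P\<in>carrier_mat m m. \<exists>Q\<in>carrier_mat m m. \<exists>R\<in>carrier_mat m m.
        det (a0 \<cdot>\<^sub>m P + b0 \<cdot>\<^sub>m Q + R) \<noteq> 0 \<and>
        (\<forall>a b. a \<noteq> 0 \<or> b \<noteq> 0 \<longrightarrow> (a \<cdot>\<^sub>m P + b \<cdot>\<^sub>m Q + R) *\<^sub>v sol a b = w)"
  shows "w = 0\<^sub>v m"
proof -
  have zero: "sol 1 t $ s = 0" if s: "s < m" for s t
  proof (rule Liouville_weak_0[of "\<lambda>t. sol 1 t $ s"])
    show "(\<lambda>t. sol 1 t $ s) holomorphic_on UNIV"
      unfolding holomorphic_on_def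
    proof
      fix t0 :: complex
      obtain P Q R where P: "P \<in> carrier_mat m m" and Q: "Q \<in> carrier_mat m m" and R: "R \<in> carrier_mat m m"
        and d: "det (1 \<cdot>\<^sub>m P + t0 \<cdot>\<^sub>m Q + R) \<noteq> 0"
        and eq: "\<And>a b. a \<noteq> 0 \<or> b \<noteq> 0 \<Longrightarrow> (a \<cdot>\<^sub>m P + b \<cdot>\<^sub>m Q + R) *\<^sub>v sol a b = w"
        using loc[of 1 t0] by auto
      show "(\<lambda>t. sol 1 t $ s) field_differentiable at t0 within UNIV"
        by (rule solution_differentiable[where A = "\<lambda>t. 1 \<cdot>\<^sub>m P + t \<cdot>\<^sub>m Q + R" and v = "\<lambda>t. sol 1 t" and m = m and w = w])
          (use P Q R car d eq s w in \<open>auto intro!: holomorphic_intros\<close>)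
    qed
    \<comment> \<open>in the other chart, the solution is bounded near the point at infinity of the line\<close>
    have cont: "isCont (\<lambda>u. sol u 1 $ s) 0"
    proof -
      obtain P Q R where P: "P \<in> carrier_mat m m" and Q: "Q \<in> carrier_mat m m" and R: "R \<in> carrier_mat m m"
        and d: "det (0 \<cdot>\<^sub>m P + 1 \<cdot>\<^sub>m Q + R) \<noteq> 0"
        and eq: "\<And>a b. a \<noteq> 0 \<or> b \<noteq> 0 \<Longrightarrow> (a \<cdot>\<^sub>m P + b \<cdot>\<^sub>m Q + R) *\<^sub>v sol a b = w"
        using loc[of 0 1] by auto
      have "(\<lambda>u. sol u 1 $ s) field_differentiable at 0"
        by (rule solution_differentiable[where A = "\<lambda>t. t \<cdot>\<^sub>m P + 1 \<cdot>\<^sub>m Q + R" and v = "\<lambda>t. sol t 1" and m = m and w = w])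
          (use P Q R car d eq s w in \<open>auto intro!: holomorphic_intros\<close>)
      then show ?thesis by (rule field_differentiable_imp_continuous_at)
    qed
    have inv: "(inverse \<longlongrightarrow> (0::complex)) at_infinity" by (rule tendsto_inverse_0)
    have "((\<lambda>t. sol (inverse t) 1 $ s) \<longlongrightarrow> sol 0 1 $ s) at_infinity"
      by (rule isCont_tendsto_compose[OF cont inv])
    then have "((\<lambda>t. inverse t * sol (inverse t) 1 $ s) \<longlongrightarrow> 0 * sol 0 1 $ s) at_infinity"
      by (intro tendsto_mult inv)
    moreover have "\<forall>\<^sub>F t in at_infinity. inverse t * sol (inverse t) 1 $ s = sol 1 t $ s"
    proof (rule eventually_mono[OF eventually_not_equal_at_infinity[of 0]])
      fix t :: complex assume t: "t \<noteq> 0"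
      have "sol (t * inverse t) (t * 1) = inverse t \<cdot>\<^sub>v sol (inverse t) 1" using t by (intro hom) auto
      then show "inverse t * sol (inverse t) 1 $ s = sol 1 t $ s" using t s car[of "inverse t" 1] by simp
    qed
    ultimately show "((\<lambda>t. sol 1 t $ s) \<longlongrightarrow> 0) at_infinity" by (simp add: filterlim_cong[OF refl refl])
  qed
  obtain P Q R where P: "P \<in> carrier_mat m m" and Q: "Q \<in> carrier_mat m m" and R: "R \<in> carrier_mat m m"
    and eq: "\<And>a b. a \<noteq> 0 \<or> b \<noteq> 0 \<Longrightarrow> (a \<cdot>\<^sub>m P + b \<cdot>\<^sub>m Q + R) *\<^sub>v sol a b = w"
    using loc[of 1 0] by auto
  have "sol 1 0 = 0\<^sub>v m" using zero car[of 1 0] by (intro eq_vecI) auto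
  then have "(1 \<cdot>\<^sub>m P + 0 \<cdot>\<^sub>m Q + R) *\<^sub>v 0\<^sub>v m = w" using eq[of 1 0] by simp
  moreover have "(1 \<cdot>\<^sub>m P + 0 \<cdot>\<^sub>m Q + R) *\<^sub>v 0\<^sub>v m = 0\<^sub>v m"
    using P Q R by (intro mult_mat_zero_vec) auto
  ultimately show ?thesis by simp
qed

section \<open>Matrices with one-dimensional eigenspaces\<close>

definition mat_poly :: "nat \<Rightarrow> 'a::comm_ring_1 mat \<Rightarrow> 'a poly \<Rightarrow> 'a mat" where
  "mat_poly n M p = mat n n (\<lambda>(i, j). \<Sum>k\<le>degree p. Polynomial.coeff p k * (M ^\<^sub>m k) $$ (i, j))"

lemma mat_poly_carrier [simp]: "mat_poly n M p \<in> carrier_mat n n"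
  by (simp add: mat_poly_def)

lemma mat_poly_index:
  assumes "degree p \<le> N" "i < n" "j < n"
  shows "mat_poly n M p $$ (i, j) = (\<Sum>k\<le>N. Polynomial.coeff p k * (M ^\<^sub>m k) $$ (i, j))"
proof -
  have "(\<Sum>k\<le>degree p. Polynomial.coeff p k * (M ^\<^sub>m k) $$ (i, j)) = (\<Sum>k\<le>N. Polynomial.coeff p k * (M ^\<^sub>m k) $$ (i, j))"
    using assms by (intro sum.mono_neutral_left) (auto simp: coeff_eq_0)
  then show ?thesis using assms by (simp add: mat_poly_def)
qed

lemma mult_pow_mat:
  assumes M: "M \<in> carrier_mat n n"
  shows "M * M ^\<^sub>m k = M ^\<^sub>m k * M"
proof (induction k)
  case (Suc k)
  have "M * M ^\<^sub>m Suc k = M * M ^\<^sub>m k * M"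
    using assoc_mult_mat[OF M pow_carrier_mat[OF M] M] by simp
  then show ?case using Suc by simp
qed (use M in simp)

lemma index_minus_smult_one:
  assumes "M \<in> carrier_mat n n" "i < n" "j < n"
  shows "(M - l \<cdot>\<^sub>m 1\<^sub>m n) $$ (i, j) = M $$ (i, j) - (if i = j then l else (0::'a::comm_ring_1))"
  using assms by auto

lemma mat_poly_mult_linear:
  fixes M :: "'a::idom mat"
  assumes M: "M \<in> carrier_mat n n"
  shows "mat_poly n M ([:- l, 1:] * q) = mat_poly n M q * (M - l \<cdot>\<^sub>m 1\<^sub>m n)"
    and "mat_poly n M ([:- l, 1:] * q) = (M - l \<cdot>\<^sub>m 1\<^sub>m n) * mat_poly n M q"
proof -
  let ?N = "degree q"
  have Ml: "M - l \<cdot>\<^sub>m 1\<^sub>m n \<in> carrier_mat n n" using M by auto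
  have deg: "degree ([:- l, 1:] * q) \<le> Suc ?N"
    using degree_mult_le[of "[:- l, 1:]" q] by simp
  have lhs: "mat_poly n M ([:- l, 1:] * q) $$ (i, j) =
      (\<Sum>k\<le>?N. Polynomial.coeff q k * (M ^\<^sub>m Suc k) $$ (i, j)) - l * mat_poly n M q $$ (i, j)" if ij: "i < n" "j < n" for i j
  proof -
    have "mat_poly n M ([:- l, 1:] * q) $$ (i, j) = (\<Sum>k\<le>Suc ?N. Polynomial.coeff ([:- l, 1:] * q) k * (M ^\<^sub>m k) $$ (i, j))"
      by (rule mat_poly_index[OF deg ij])
    also have "\<dots> = (\<Sum>k\<le>Suc ?N. Polynomial.coeff (pCons 0 q) k * (M ^\<^sub>m k) $$ (i, j))
        - l * (\<Sum>k\<le>Suc ?N. Polynomial.coeff q k * (M ^\<^sub>m k) $$ (i, j))"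
    proof -
      have "Polynomial.coeff ([:- l, 1:] * q) k = Polynomial.coeff (pCons 0 q) k - l * Polynomial.coeff q k" for k
        by (simp add: mult_pCons_left)
      then show ?thesis by (simp only: left_diff_distrib sum_subtractf sum_distrib_left mult.assoc)
    qed
    also have "(\<Sum>k\<le>Suc ?N. Polynomial.coeff (pCons 0 q) k * (M ^\<^sub>m k) $$ (i, j)) = (\<Sum>k\<le>?N. Polynomial.coeff q k * (M ^\<^sub>m Suc k) $$ (i, j))"
      by (simp add: sum.atMost_Suc_shift del: sum.atMost_Suc)
    also have "(\<Sum>k\<le>Suc ?N. Polynomial.coeff q k * (M ^\<^sub>m k) $$ (i, j)) = mat_poly n M q $$ (i, j)"
      by (rule mat_poly_index[symmetric]) (use ij in auto)
    finally show ?thesis .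
  qed
  have q: "mat_poly n M q $$ (i, j) = (\<Sum>k\<le>?N. Polynomial.coeff q k * (M ^\<^sub>m k) $$ (i, j))" if "i < n" "j < n" for i j
    by (rule mat_poly_index[OF order_refl that])
  show "mat_poly n M ([:- l, 1:] * q) = mat_poly n M q * (M - l \<cdot>\<^sub>m 1\<^sub>m n)"
  proof (rule eq_matI)
    fix i j assume "i < dim_row (mat_poly n M q * (M - l \<cdot>\<^sub>m 1\<^sub>m n))" "j < dim_col (mat_poly n M q * (M - l \<cdot>\<^sub>m 1\<^sub>m n))"
    then have ij: "i < n" "j < n" using M by (auto simp: mat_poly_def)
    have "(mat_poly n M q * (M - l \<cdot>\<^sub>m 1\<^sub>m n)) $$ (i, j) = (\<Sum>r<n. mat_poly n M q $$ (i, r) * (M $$ (r, j) - (if r = j then l else 0)))"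
      unfolding index_mult_mat_sum[OF mat_poly_carrier Ml ij] using ij
      by (intro sum.cong refl) (simp only: lessThan_iff index_minus_smult_one[OF M])
    also have "\<dots> = (\<Sum>r<n. mat_poly n M q $$ (i, r) * M $$ (r, j)) - mat_poly n M q $$ (i, j) * l"
      using ij by (simp add: right_diff_distrib sum_subtractf if_distrib[of "\<lambda>x. _ * x"] cong: if_cong)
    also have "(\<Sum>r<n. mat_poly n M q $$ (i, r) * M $$ (r, j)) = (\<Sum>r<n. \<Sum>k\<le>?N. Polynomial.coeff q k * ((M ^\<^sub>m k) $$ (i, r) * M $$ (r, j)))"
      using ij by (intro sum.cong refl) (simp add: q sum_distrib_right mult.assoc)
    also have "\<dots> = (\<Sum>k\<le>?N. Polynomial.coeff q k * (M ^\<^sub>m Suc k) $$ (i, j))"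
      by (subst sum.swap) (simp add: index_mult_mat_sum[OF pow_carrier_mat[OF M] M ij] sum_distrib_left)
    finally show "mat_poly n M ([:- l, 1:] * q) $$ (i, j) = (mat_poly n M q * (M - l \<cdot>\<^sub>m 1\<^sub>m n)) $$ (i, j)"
      using lhs[OF ij] by (simp add: mult.commute)
  qed (use M in \<open>auto simp: mat_poly_def\<close>)
  show "mat_poly n M ([:- l, 1:] * q) = (M - l \<cdot>\<^sub>m 1\<^sub>m n) * mat_poly n M q"
  proof (rule eq_matI)
    fix i j assume "i < dim_row ((M - l \<cdot>\<^sub>m 1\<^sub>m n) * mat_poly n M q)" "j < dim_col ((M - l \<cdot>\<^sub>m 1\<^sub>m n) * mat_poly n M q)"
    then have ij: "i < n" "j < n" using M by (auto simp: mat_poly_def)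
    have "((M - l \<cdot>\<^sub>m 1\<^sub>m n) * mat_poly n M q) $$ (i, j) = (\<Sum>r<n. (M $$ (i, r) - (if i = r then l else 0)) * mat_poly n M q $$ (r, j))"
      unfolding index_mult_mat_sum[OF Ml mat_poly_carrier ij] using ij
      by (intro sum.cong refl) (simp only: lessThan_iff index_minus_smult_one[OF M])
    also have "\<dots> = (\<Sum>r<n. M $$ (i, r) * mat_poly n M q $$ (r, j)) - l * mat_poly n M q $$ (i, j)"
      using ij by (simp add: left_diff_distrib sum_subtractf if_distrib[of "\<lambda>x. x * _"] cong: if_cong)
    also have "(\<Sum>r<n. M $$ (i, r) * mat_poly n M q $$ (r, j)) = (\<Sum>r<n. \<Sum>k\<le>?N. Polynomial.coeff q k * (M $$ (i, r) * (M ^\<^sub>m k) $$ (r, j)))"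
      using ij by (intro sum.cong refl) (simp add: q sum_distrib_left mult_ac)
    also have "\<dots> = (\<Sum>k\<le>?N. Polynomial.coeff q k * (M * M ^\<^sub>m k) $$ (i, j))"
      by (subst sum.swap) (simp add: index_mult_mat_sum[OF M pow_carrier_mat[OF M] ij] sum_distrib_left)
    finally show "mat_poly n M ([:- l, 1:] * q) $$ (i, j) = ((M - l \<cdot>\<^sub>m 1\<^sub>m n) * mat_poly n M q) $$ (i, j)"
      using lhs[OF ij] mult_pow_mat[OF M] by simp
  qed (use M in \<open>auto simp: mat_poly_def\<close>)
qed

text \<open>If the kernel is spanned by \<open>u\<close> with \<open>u\<^sub>i \<noteq> 0\<close>, then \<open>g\<close> is the coordinate \<open>i\<close>.\<close>

lemma corank_le_1_kernel_form:
  fixes A :: "'a::field mat"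
  assumes A: "A \<in> carrier_mat n n" and adj: "adj_mat A \<noteq> 0\<^sub>m n n"
  shows "\<exists>g. \<forall>y\<in>carrier_vec n. A *\<^sub>v y = 0\<^sub>v n \<longrightarrow> (\<Sum>i<n. g i * y $ i) = 0 \<longrightarrow> y = 0\<^sub>v n"
proof (cases "\<exists>u\<in>carrier_vec n. u \<noteq> 0\<^sub>v n \<and> A *\<^sub>v u = 0\<^sub>v n")
  case False
  then show ?thesis by auto
next
  case True
  then obtain u where u: "u \<in> carrier_vec n" "u \<noteq> 0\<^sub>v n" "A *\<^sub>v u = 0\<^sub>v n" by blast
  obtain i where i: "i < n" "u $ i \<noteq> 0" using u(1,2) by (auto simp: Matrix.vec_eq_iff)
  show ?thesis
  proof (rule exI[of _ "\<lambda>k. if k = i then 1 else 0"], intro ballI impI)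
    fix y assume y: "y \<in> carrier_vec n" "A *\<^sub>v y = 0\<^sub>v n" "(\<Sum>k<n. (if k = i then 1 else 0) * y $ k) = 0"
    have "(\<Sum>k<n. (if k = i then 1 else 0) * y $ k) = y $ i"
      using i(1) by (simp add: if_distrib[of "\<lambda>x. x * _"] cong: if_cong)
    then have yi: "y $ i = 0" using y(3) by simp
    show "y = 0\<^sub>v n"
    proof (rule ccontr)
      assume "y \<noteq> 0\<^sub>v n"
      then obtain k where k: "k < n" "y $ k \<noteq> 0" using y(1) by (auto simp: Matrix.vec_eq_iff)
      have "adj_mat A = 0\<^sub>m n n"
      proof (rule adj_mat_eq_0_if_kernel[OF A u(1,3) y(1,2)])
        fix a b assume *: "\<forall>l<n. a * u $ l + b * y $ l = 0"
        have "a = 0" using *[rule_format, OF i(1)] yi i(2) by simp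
        then show "a = 0 \<and> b = 0" using *[rule_format, OF k(1)] k(2) by simp
      qed
      then show False using adj by simp
    qed
  qed
qed

lemma adj_mat_transpose:
  assumes A: "A \<in> carrier_mat n n"
  shows "adj_mat (transpose_mat A) = transpose_mat (adj_mat A)"
proof (rule eq_matI)
  fix i j assume "i < dim_row (transpose_mat (adj_mat A))" "j < dim_col (transpose_mat (adj_mat A))"
  then have ij: "i < n" "j < n" using A by (auto simp: adj_mat_def)
  have "mat_delete (transpose_mat A) j i = transpose_mat (mat_delete A i j)"
    using A ij by (intro eq_matI) (auto simp: mat_delete_def)
  then have "det (mat_delete (transpose_mat A) j i) = det (mat_delete A i j)"
    using det_transpose[OF mat_delete_carrier[OF A]] by simp
  then show "adj_mat (transpose_mat A) $$ (i, j) = transpose_mat (adj_mat A) $$ (i, j)"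
    using A ij by (simp add: adj_mat_def cofactor_def add.commute)
qed (use A in \<open>auto simp: adj_mat_def\<close>)

text \<open>Each linear factor \<open>M - l\<close> of \<open>p(M)\<close> enlarges the kernel by at most one dimension, so the
  kernel of \<open>p(M)\<close> has dimension at most \<open>deg p < n\<close>. The bound on the dimension is expressed by
  \<open>deg p\<close> linear forms without a common nonzero zero in the kernel.\<close>

lemma mat_poly_nonzero:
  fixes M :: "complex mat"
  assumes M: "M \<in> carrier_mat n n" and cork: "\<And>l. adj_mat (M - l \<cdot>\<^sub>m 1\<^sub>m n) \<noteq> 0\<^sub>m n n"
    and p: "p \<noteq> 0" "degree p < n"
  shows "mat_poly n M p \<noteq> 0\<^sub>m n n"
proof -
  have forms: "\<exists>f :: nat \<Rightarrow> nat \<Rightarrow> complex. \<forall>x\<in>carrier_vec n. (\<forall>i<d. (\<Sum>k<n. f i k * x $ k) = 0) \<longrightarrow>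
      mat_poly n M p *\<^sub>v x = 0\<^sub>v n \<longrightarrow> x = 0\<^sub>v n" if "p \<noteq> 0" "degree p = d" for p d
    using that
  proof (induction d arbitrary: p)
    case 0
    then obtain c where c: "p = [:c:]" "c \<noteq> 0" by (metis degree_eq_zeroE pCons_eq_0_iff)
    have "mat_poly n M p *\<^sub>v x = c \<cdot>\<^sub>v x" if "x \<in> carrier_vec n" for x
    proof -
      have "mat_poly n M p = c \<cdot>\<^sub>m 1\<^sub>m n" using M by (intro eq_matI) (auto simp: mat_poly_def c)
      then show ?thesis using smult_one_mult_vec[OF that] by simp
    qed
    moreover have "x = 0\<^sub>v n" if "x \<in> carrier_vec n" "c \<cdot>\<^sub>v x = 0\<^sub>v n" for x
    proof (rule eq_vecI)
      fix i assume "i < dim_vec (0\<^sub>v n :: complex vec)"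
      then show "x $ i = 0\<^sub>v n $ i" using arg_cong[OF that(2), of "\<lambda>v. v $ i"] that(1) c(2) by auto
    qed (use that in auto)
    ultimately show ?case by metis
  next
    case (Suc d)
    have "\<exists>l. poly p l = 0" by (rule alg_closed_imp_poly_has_root) (use Suc.prems in simp)
    then obtain l where "poly p l = 0" by (elim exE)
    then have "[:- l, 1:] dvd p" by (simp only: poly_eq_0_iff_dvd)
    then obtain q where q: "p = [:- l, 1:] * q" by (rule dvdE)
    have q0: "q \<noteq> 0" using Suc.prems q by auto
    have "degree q = d" using Suc.prems(2) q q0 degree_mult_eq[of "[:- l, 1:]" q] by simp
    from Suc.IH[OF q0 this] obtain f :: "nat \<Rightarrow> nat \<Rightarrow> complex" where
      f: "\<forall>x\<in>carrier_vec n. (\<forall>i<d. (\<Sum>k<n. f i k * x $ k) = 0) \<longrightarrow> mat_poly n M q *\<^sub>v x = 0\<^sub>v n \<longrightarrow> x = 0\<^sub>v n"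
      by (elim exE)
    let ?A = "M - l \<cdot>\<^sub>m 1\<^sub>m n"
    have A: "?A \<in> carrier_mat n n" using M by auto
    obtain g where g: "\<And>y. y \<in> carrier_vec n \<Longrightarrow> ?A *\<^sub>v y = 0\<^sub>v n \<Longrightarrow> (\<Sum>i<n. g i * y $ i) = 0 \<Longrightarrow> y = 0\<^sub>v n"
      using corank_le_1_kernel_form[OF A cork] by blast
    define f' where "f' i k = (if i < d then f i k else (\<Sum>r<n. g r * mat_poly n M q $$ (r, k)))" for i k
    show ?case
    proof (intro exI[of _ f'] ballI impI)
      fix x :: "complex vec" assume x: "x \<in> carrier_vec n" "\<forall>i<Suc d. (\<Sum>k<n. f' i k * x $ k) = 0" "mat_poly n M p *\<^sub>v x = 0\<^sub>v n"
      let ?y = "mat_poly n M q *\<^sub>v x"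
      have y: "?y \<in> carrier_vec n" using x(1) by (meson mat_poly_carrier mult_mat_vec_carrier)
      have "?A *\<^sub>v ?y = 0\<^sub>v n"
        using x(3) unfolding q mat_poly_mult_linear(2)[OF M] using assoc_mult_mat_vec[OF A mat_poly_carrier x(1)] by simp
      moreover have "(\<Sum>i<n. g i * ?y $ i) = 0"
      proof -
        have "(\<Sum>i<n. g i * ?y $ i) = (\<Sum>i<n. \<Sum>k<n. g i * (mat_poly n M q $$ (i, k) * x $ k))"
          by (simp add: index_mult_mat_vec_sum[OF mat_poly_carrier x(1)] sum_distrib_left)
        also have "\<dots> = (\<Sum>k<n. \<Sum>i<n. g i * (mat_poly n M q $$ (i, k) * x $ k))" by (rule sum.swap)
        also have "\<dots> = (\<Sum>k<n. f' d k * x $ k)"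
        proof (rule sum.cong[OF refl])
          fix k
          have "f' d k * x $ k = (\<Sum>r<n. g r * mat_poly n M q $$ (r, k) * x $ k)"
            unfolding f'_def by (simp add: sum_distrib_right)
          then show "(\<Sum>i<n. g i * (mat_poly n M q $$ (i, k) * x $ k)) = f' d k * x $ k"
            by (simp only: mult.assoc)
        qed
        finally have "(\<Sum>i<n. g i * ?y $ i) = (\<Sum>k<n. f' d k * x $ k)" .
        also have "\<dots> = 0" using x(2) by blast
        finally show ?thesis .
      qed
      ultimately have "?y = 0\<^sub>v n" by (rule g[OF y])
      moreover have "\<forall>i<d. (\<Sum>k<n. f i k * x $ k) = 0"
      proof (intro allI impI)
        fix i assume i: "i < d"
        then have "(\<Sum>k<n. f' i k * x $ k) = 0" using x(2) by simp
        then show "(\<Sum>k<n. f i k * x $ k) = 0" using i by (simp add: f'_def)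
      qed
      ultimately show "x = 0\<^sub>v n" using f[rule_format, OF x(1)] by blast
    qed
  qed
  from forms[OF p(1) refl] obtain f :: "nat \<Rightarrow> nat \<Rightarrow> complex" where
    f: "\<forall>x\<in>carrier_vec n. (\<forall>i<degree p. (\<Sum>k<n. f i k * x $ k) = 0) \<longrightarrow> mat_poly n M p *\<^sub>v x = 0\<^sub>v n \<longrightarrow> x = 0\<^sub>v n"
    by (elim exE)
  obtain c where c: "\<exists>k<n. c k \<noteq> 0" "\<forall>i<degree p. (\<Sum>k<n. f i k * c k) = 0"
    using homogeneous_system_solvable[OF p(2), of f] by blast
  define x where "x = vec n c"
  have x: "x \<in> carrier_vec n" by (simp add: x_def)
  show ?thesis
  proof
    assume z: "mat_poly n M p = 0\<^sub>m n n"
    have "mat_poly n M p *\<^sub>v x = 0\<^sub>v n"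
      unfolding z using x by (intro eq_vecI) (auto simp: index_mult_mat_vec_sum[OF zero_carrier_mat x])
    moreover have "\<forall>i<degree p. (\<Sum>k<n. f i k * x $ k) = 0" using c(2) by (simp add: x_def)
    ultimately have "x = 0\<^sub>v n" using f[rule_format, OF x] by blast
    moreover obtain k where "k < n" "c k \<noteq> 0" using c(1) by blast
    ultimately show False using index_vec[of k n c] unfolding x_def by simp
  qed
qed


lemma transpose_mat_index:
  "A \<in> carrier_mat nr nc \<Longrightarrow> i < nc \<Longrightarrow> j < nr \<Longrightarrow> transpose_mat A $$ (i, j) = A $$ (j, i)"
  by simp

text \<open>If \<open>B \<noteq> 0\<close>, let \<open>p\<close> have minimal degree such that \<open>B p(M) = 0\<close>, and write \<open>p = (x - l) q\<close>.
  Then \<open>C = B q(M)\<close> is nonzero, skew-symmetric because all \<open>B M\<^sup>k\<close> are, and \<open>C (M - l) = 0\<close>. A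
  nonzero skew-symmetric matrix has two independent rows, and these lie in the left kernel of
  \<open>M - l\<close>, against the assumption on the corank.\<close>

lemma skew_intertwiner_eq_0:
  fixes M B :: "complex mat"
  assumes M: "M \<in> carrier_mat n n" and cork: "\<And>l. adj_mat (M - l \<cdot>\<^sub>m 1\<^sub>m n) \<noteq> 0\<^sub>m n n"
    and B: "B \<in> carrier_mat n n" and skew: "transpose_mat B = - B" and comm: "B * M = transpose_mat M * B"
  shows "B = 0\<^sub>m n n"
proof (rule ccontr)
  assume B0: "B \<noteq> 0\<^sub>m n n"
  define ann where "ann p \<longleftrightarrow> p \<noteq> 0 \<and> B * mat_poly n M p = 0\<^sub>m n n" for p
  have entry: "(B * mat_poly n M p) $$ (i, j) = (\<Sum>k\<le>N. (B * M ^\<^sub>m k) $$ (i, j) * Polynomial.coeff p k)"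
    if "degree p \<le> N" and ij: "i < n" "j < n" for p N i j
  proof -
    have "(B * mat_poly n M p) $$ (i, j) = (\<Sum>l<n. \<Sum>k\<le>N. B $$ (i, l) * (Polynomial.coeff p k * (M ^\<^sub>m k) $$ (l, j)))"
      unfolding index_mult_mat_sum[OF B mat_poly_carrier ij]
      by (intro sum.cong refl) (simp add: mat_poly_index[OF that(1)] ij sum_distrib_left)
    also have "\<dots> = (\<Sum>k\<le>N. \<Sum>l<n. B $$ (i, l) * (Polynomial.coeff p k * (M ^\<^sub>m k) $$ (l, j)))"
      by (rule sum.swap)
    also have "\<dots> = (\<Sum>k\<le>N. (B * M ^\<^sub>m k) $$ (i, j) * Polynomial.coeff p k)"
      unfolding index_mult_mat_sum[OF B pow_carrier_mat[OF M] ij] sum_distrib_right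
      by (intro sum.cong refl) (simp only: mult_ac)
    finally show ?thesis .
  qed
  \<comment> \<open>\<open>n\<^sup>2 + 1\<close> matrices \<open>B M\<^sup>k\<close> with \<open>n\<^sup>2\<close> entries are linearly dependent\<close>
  have "\<exists>p. ann p"
  proof -
    obtain c where c: "\<exists>k<n * n + 1. c k \<noteq> 0"
      "\<forall>r<n * n. (\<Sum>k<n * n + 1. (B * M ^\<^sub>m k) $$ (r div n, r mod n) * c k) = 0"
      using homogeneous_system_solvable[of "n * n" "n * n + 1" "\<lambda>r k. (B * M ^\<^sub>m k) $$ (r div n, r mod n)"] by auto
    define p where "p = (\<Sum>k\<le>n * n. Polynomial.monom (c k) k)"
    have coeff: "Polynomial.coeff p k = c k" if "k \<le> n * n" for k
      using that by (simp add: p_def coeff_sum)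
    have deg: "degree p \<le> n * n"
      unfolding p_def by (rule degree_sum_le) (auto intro: order_trans[OF degree_monom_le])
    have "B * mat_poly n M p = 0\<^sub>m n n"
    proof (rule eq_matI)
      fix i j assume "i < dim_row (0\<^sub>m n n :: complex mat)" "j < dim_col (0\<^sub>m n n :: complex mat)"
      then have ij: "i < n" "j < n" by auto
      have r: "i * n + j < n * n"
      proof -
        have "i * n + j < i * n + n" using ij by simp
        also have "\<dots> = (i + 1) * n" by simp
        also have "\<dots> \<le> n * n" using ij by (intro mult_right_mono) auto
        finally show ?thesis .
      qed
      have dm: "(i * n + j) div n = i" "(i * n + j) mod n = j" using ij by auto
      have "(B * mat_poly n M p) $$ (i, j) = (\<Sum>k\<le>n * n. (B * M ^\<^sub>m k) $$ (i, j) * c k)"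
        unfolding entry[OF deg ij] by (intro sum.cong refl) (simp add: coeff)
      also have "\<dots> = 0" using c(2)[rule_format, OF r] unfolding dm by (simp add: lessThan_Suc_atMost)
      finally show "(B * mat_poly n M p) $$ (i, j) = 0\<^sub>m n n $$ (i, j)" using ij by simp
    qed (use B in \<open>auto simp: mat_poly_def\<close>)
    moreover have "p \<noteq> 0"
    proof -
      obtain k where "k < n * n + 1" "c k \<noteq> 0" using c(1) by blast
      then have "Polynomial.coeff p k \<noteq> 0" using coeff[of k] by simp
      then show ?thesis by auto
    qed
    ultimately show ?thesis by (auto simp: ann_def)
  qed
  then obtain p where p: "ann p" "\<And>q. ann q \<Longrightarrow> degree p \<le> degree q"
    using exists_least_iff[of "\<lambda>d. \<exists>p. ann p \<and> degree p = d"] by (metis linorder_not_less)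
  have p0: "p \<noteq> 0" "B * mat_poly n M p = 0\<^sub>m n n" using p(1) by (auto simp: ann_def)
  have "0 < degree p"
  proof (rule ccontr)
    assume "\<not> 0 < degree p"
    then obtain c where c: "p = [:c:]" by (metis degree_eq_zeroE gr0I)
    then have c0: "c \<noteq> 0" using p0(1) by simp
    have "B = 0\<^sub>m n n"
    proof (rule eq_matI)
      fix i j assume "i < dim_row (0\<^sub>m n n :: complex mat)" "j < dim_col (0\<^sub>m n n :: complex mat)"
      then have ij: "i < n" "j < n" by auto
      have "(B * mat_poly n M p) $$ (i, j) = (\<Sum>k\<le>0. (B * M ^\<^sub>m k) $$ (i, j) * Polynomial.coeff p k)"
        by (rule entry) (use ij c in auto)
      also have "\<dots> = B $$ (i, j) * c" using c B M by simp
      finally show "B $$ (i, j) = 0\<^sub>m n n $$ (i, j)" using p0(2) c0 ij by simp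
    qed (use B in auto)
    then show False using B0 by simp
  qed
  then have "\<exists>l. poly p l = 0" by (rule alg_closed_imp_poly_has_root)
  then obtain l where "poly p l = 0" by (elim exE)
  then have "[:- l, 1:] dvd p" by (simp only: poly_eq_0_iff_dvd)
  then obtain q where q: "p = [:- l, 1:] * q" by (rule dvdE)
  have q0: "q \<noteq> 0" using p0(1) q by auto
  have "degree q < degree p" using q q0 degree_mult_eq[of "[:- l, 1:]" q] by simp
  then have "\<not> ann q" using p(2)[of q] by linarith
  define C where "C = B * mat_poly n M q"
  have C: "C \<in> carrier_mat n n" using B unfolding C_def by (meson mat_poly_carrier mult_carrier_mat)
  have C0: "C \<noteq> 0\<^sub>m n n" using \<open>\<not> ann q\<close> q0 by (simp add: ann_def C_def)
  let ?A = "M - l \<cdot>\<^sub>m 1\<^sub>m n"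
  have A: "?A \<in> carrier_mat n n" using M by auto
  have CA: "C * ?A = 0\<^sub>m n n"
    using p0(2) unfolding q mat_poly_mult_linear(1)[OF M] C_def using assoc_mult_mat[OF B mat_poly_carrier A] by simp
  have comm_pow: "B * M ^\<^sub>m k = transpose_mat (M ^\<^sub>m k) * B" for k
  proof (induction k)
    case 0 then show ?case using B M by simp
  next
    case (Suc k)
    have Mk: "M ^\<^sub>m k \<in> carrier_mat n n" by (rule pow_carrier_mat[OF M])
    have "B * M ^\<^sub>m Suc k = (B * M ^\<^sub>m k) * M" using assoc_mult_mat[OF B Mk M] by simp
    also have "\<dots> = transpose_mat (M ^\<^sub>m k) * B * M" by (simp only: Suc)
    also have "\<dots> = transpose_mat (M ^\<^sub>m k) * (transpose_mat M * B)"
      using assoc_mult_mat[OF transpose_carrier_mat[THEN iffD2, OF Mk] B M] comm by simp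
    also have "\<dots> = transpose_mat (M ^\<^sub>m k) * transpose_mat M * B"
      by (rule assoc_mult_mat[symmetric, OF transpose_carrier_mat[THEN iffD2, OF Mk] transpose_carrier_mat[THEN iffD2, OF M] B])
    also have "transpose_mat (M ^\<^sub>m k) * transpose_mat M = transpose_mat (M ^\<^sub>m Suc k)"
      using transpose_mult[OF M Mk] mult_pow_mat[OF M] by simp
    finally show ?case .
  qed
  have skewC: "C $$ (j, i) = - C $$ (i, j)" if ij: "i < n" "j < n" for i j
  proof -
    have Bskew: "B $$ (r, s) = - B $$ (s, r)" if "r < n" "s < n" for r s
    proof -
      have "transpose_mat B $$ (s, r) = (- B) $$ (s, r)" using skew by simp
      then show ?thesis using that B by simp
    qed
    have t: "(B * M ^\<^sub>m k) $$ (j, i) = - (B * M ^\<^sub>m k) $$ (i, j)" for k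
    proof -
      have Mk: "M ^\<^sub>m k \<in> carrier_mat n n" by (rule pow_carrier_mat[OF M])
      have "(B * M ^\<^sub>m k) $$ (j, i) = (\<Sum>s<n. transpose_mat (M ^\<^sub>m k) $$ (j, s) * B $$ (s, i))"
        unfolding comm_pow using Mk B ij by (intro index_mult_mat_sum) auto
      also have "\<dots> = (\<Sum>s<n. - (B $$ (i, s) * (M ^\<^sub>m k) $$ (s, j)))"
        by (intro sum.cong refl) (simp add: transpose_mat_index[OF Mk] ij Bskew[of _ i])
      also have "\<dots> = - (B * M ^\<^sub>m k) $$ (i, j)"
        by (simp add: index_mult_mat_sum[OF B Mk ij] sum_negf)
      finally show ?thesis .
    qed
    show ?thesis unfolding C_def entry[OF order_refl ij] entry[OF order_refl ij(2,1)]
      by (simp add: t sum_negf)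
  qed
  obtain j k where jk: "j < n" "k < n" "C $$ (j, k) \<noteq> 0"
  proof (rule ccontr)
    assume "\<not> thesis"
    then have "C = 0\<^sub>m n n" using that C by (intro eq_matI) auto
    then show False using C0 by simp
  qed
  define At where "At = transpose_mat ?A"
  have At: "At \<in> carrier_mat n n" unfolding At_def using A by simp
  have row_kernel: "At *\<^sub>v vec n (\<lambda>i. C $$ (r, i)) = 0\<^sub>v n" if r: "r < n" for r
  proof (rule eq_vecI)
    fix i assume "i < dim_vec (0\<^sub>v n :: complex vec)"
    then have i: "i < n" by simp
    have "(At *\<^sub>v vec n (\<lambda>i. C $$ (r, i))) $ i = (\<Sum>s<n. At $$ (i, s) * C $$ (r, s))"
      by (subst index_mult_mat_vec_sum[OF At _ i]) auto
    also have "\<dots> = (\<Sum>s<n. C $$ (r, s) * ?A $$ (s, i))"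
      unfolding At_def using A i by (intro sum.cong refl) simp
    also have "\<dots> = (C * ?A) $$ (r, i)" by (rule index_mult_mat_sum[symmetric, OF C A r i])
    also have "\<dots> = 0" unfolding CA using r i by simp
    finally show "(At *\<^sub>v vec n (\<lambda>i. C $$ (r, i))) $ i = 0\<^sub>v n $ i" using i by simp
  qed (use At in simp)
  have "adj_mat At = 0\<^sub>m n n"
  proof (rule adj_mat_eq_0_if_kernel[OF At _ row_kernel[OF jk(1)] _ row_kernel[OF jk(2)]])
    fix a b assume *: "\<forall>i<n. a * vec n (\<lambda>i. C $$ (j, i)) $ i + b * vec n (\<lambda>i. C $$ (k, i)) $ i = 0"
    have Cjj: "C $$ (j, j) = 0" "C $$ (k, k) = 0" using skewC[of j j] skewC[of k k] jk by auto
    have "b * C $$ (k, j) = 0" using *[rule_format, OF jk(1)] jk Cjj by simp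
    moreover have "a * C $$ (j, k) = 0" using *[rule_format, OF jk(2)] jk Cjj by simp
    ultimately show "a = 0 \<and> b = 0" using jk skewC[OF jk(1,2)] by simp
  qed auto
  then have "transpose_mat (adj_mat ?A) = 0\<^sub>m n n" unfolding At_def adj_mat_transpose[OF A] .
  then have "adj_mat ?A = transpose_mat (0\<^sub>m n n)" using Matrix.transpose_transpose by metis
  also have "\<dots> = 0\<^sub>m n n" by (intro eq_matI) auto
  finally have "adj_mat ?A = 0\<^sub>m n n" .
  then show False using cork by blast
qed

section \<open>The trace pairing and the moments of an apolar matrix\<close>

text \<open>The bilinear form \<open>tr (A B\<^sup>T)\<close>, without complex conjugation.\<close>

definition mat_pairing :: "nat \<Rightarrow> complex mat \<Rightarrow> complex mat \<Rightarrow> complex" where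
  "mat_pairing n A B = (\<Sum>i<n. \<Sum>j<n. A $$ (i, j) * B $$ (i, j))"

lemma mat_pairing_mult:
  assumes A: "A \<in> carrier_mat n n" and B: "B \<in> carrier_mat n n" and C: "C \<in> carrier_mat n n"
  shows "mat_pairing n (A * B) C = mat_pairing n A (C * transpose_mat B)"
    and "mat_pairing n (A * B) C = mat_pairing n B (transpose_mat A * C)"
proof -
  have Bt: "transpose_mat B \<in> carrier_mat n n" and At: "transpose_mat A \<in> carrier_mat n n" using A B by auto
  have *: "mat_pairing n (A * B) C = (\<Sum>i<n. \<Sum>j<n. \<Sum>k<n. A $$ (i, k) * B $$ (k, j) * C $$ (i, j))"
    unfolding mat_pairing_def
    by (intro sum.cong refl) (simp add: index_mult_mat_sum[OF A B] sum_distrib_right)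
  have "mat_pairing n A (C * transpose_mat B) = (\<Sum>i<n. \<Sum>k<n. \<Sum>j<n. A $$ (i, k) * B $$ (k, j) * C $$ (i, j))"
    unfolding mat_pairing_def
  proof (intro sum.cong refl)
    fix i k assume ik: "i \<in> {..<n}" "k \<in> {..<n}"
    have "(C * transpose_mat B) $$ (i, k) = (\<Sum>j<n. C $$ (i, j) * B $$ (k, j))"
      using ik B by (subst index_mult_mat_sum[OF C Bt]) auto
    then show "A $$ (i, k) * (C * transpose_mat B) $$ (i, k) = (\<Sum>j<n. A $$ (i, k) * B $$ (k, j) * C $$ (i, j))"
      by (simp add: sum_distrib_left mult_ac)
  qed
  also have "\<dots> = mat_pairing n (A * B) C"
    unfolding * by (intro sum.cong refl sum.swap)
  finally show "mat_pairing n (A * B) C = mat_pairing n A (C * transpose_mat B)" ..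
  have "mat_pairing n B (transpose_mat A * C) = (\<Sum>k<n. \<Sum>j<n. \<Sum>i<n. A $$ (i, k) * B $$ (k, j) * C $$ (i, j))"
    unfolding mat_pairing_def
  proof (intro sum.cong refl)
    fix k j assume kj: "k \<in> {..<n}" "j \<in> {..<n}"
    have "(transpose_mat A * C) $$ (k, j) = (\<Sum>i<n. A $$ (i, k) * C $$ (i, j))"
      using kj A by (subst index_mult_mat_sum[OF At C]) auto
    then show "B $$ (k, j) * (transpose_mat A * C) $$ (k, j) = (\<Sum>i<n. A $$ (i, k) * B $$ (k, j) * C $$ (i, j))"
      by (simp add: sum_distrib_left mult_ac)
  qed
  also have "\<dots> = (\<Sum>k<n. \<Sum>i<n. \<Sum>j<n. A $$ (i, k) * B $$ (k, j) * C $$ (i, j))"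
    by (intro sum.cong refl sum.swap)
  also have "\<dots> = (\<Sum>i<n. \<Sum>k<n. \<Sum>j<n. A $$ (i, k) * B $$ (k, j) * C $$ (i, j))" by (rule sum.swap)
  also have "\<dots> = mat_pairing n (A * B) C"
    unfolding * by (intro sum.cong refl sum.swap)
  finally show "mat_pairing n (A * B) C = mat_pairing n B (transpose_mat A * C)" ..
qed

text \<open>With \<open>M = J S\<close>, where \<open>J\<close> and \<open>S\<close> are symmetric, these are the symmetric matrices \<open>M\<^sup>k J\<close>.
  They are, up to scalars, the coefficients of the expansion of \<open>(X + t S)\<^sup>-\<^sup>1\<close> in \<open>t\<close> when \<open>J\<close> is
  the inverse of \<open>X\<close>.\<close>

definition moment_mat :: "complex mat \<Rightarrow> complex mat \<Rightarrow> nat \<Rightarrow> complex mat" where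
  "moment_mat J S k = (J * S) ^\<^sub>m k * J"

lemma moment_mat:
  assumes J: "J \<in> carrier_mat n n" "transpose_mat J = J" and S: "S \<in> carrier_mat n n" "transpose_mat S = S"
  shows "moment_mat J S k \<in> carrier_mat n n"
    and "moment_mat J S k * transpose_mat (J * S) = (J * S) * moment_mat J S k"
    and "transpose_mat (moment_mat J S k) = moment_mat J S k"
proof -
  let ?M = "J * S"
  have M: "?M \<in> carrier_mat n n" using J S by auto
  have Mk: "?M ^\<^sub>m k \<in> carrier_mat n n" for k by (rule pow_carrier_mat[OF M])
  have Mt: "transpose_mat ?M = S * J" using transpose_mult[OF J(1) S(1)] J S by simp
  have Q: "moment_mat J S k \<in> carrier_mat n n" for k
    unfolding moment_mat_def using Mk J by (meson mult_carrier_mat)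
  have step: "?M * moment_mat J S k = moment_mat J S (Suc k)" for k
  proof -
    have "?M * moment_mat J S k = (?M * ?M ^\<^sub>m k) * J" unfolding moment_mat_def by (rule assoc_mult_mat[symmetric, OF M Mk J(1)])
    then show ?thesis by (simp add: moment_mat_def mult_pow_mat[OF M])
  qed
  have comm: "moment_mat J S k * transpose_mat ?M = ?M * moment_mat J S k" for k
  proof -
    have "moment_mat J S k * transpose_mat ?M = ?M ^\<^sub>m k * (J * (S * J))"
      unfolding moment_mat_def Mt using Mk J S by (intro assoc_mult_mat) auto
    also have "J * (S * J) = ?M * J" by (rule assoc_mult_mat[symmetric, OF J(1) S(1) J(1)])
    also have "?M ^\<^sub>m k * (?M * J) = ?M ^\<^sub>m k * ?M * J" by (rule assoc_mult_mat[symmetric, OF Mk M J(1)])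
    also have "\<dots> = moment_mat J S (Suc k)" by (simp add: moment_mat_def)
    finally show ?thesis by (simp only: step)
  qed
  show "moment_mat J S k \<in> carrier_mat n n" by (rule Q)
  show "moment_mat J S k * transpose_mat ?M = ?M * moment_mat J S k" by (rule comm)
  show "transpose_mat (moment_mat J S k) = moment_mat J S k"
  proof (induction k)
    case 0 then show ?case using J by (simp add: moment_mat_def)
  next
    case (Suc k)
    have "transpose_mat (moment_mat J S (Suc k)) = transpose_mat (moment_mat J S k) * transpose_mat ?M"
      unfolding step[symmetric] by (rule transpose_mult[OF M Q])
    also have "\<dots> = moment_mat J S (Suc k)" by (simp only: Suc comm step)
    finally show ?case .
  qed
qed

lemma mat_pairing_diff:
  assumes "A \<in> carrier_mat n n" "B \<in> carrier_mat n n"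
  shows "mat_pairing n (A - B) C = mat_pairing n A C - mat_pairing n B C"
  using assms by (simp add: mat_pairing_def left_diff_distrib sum_subtractf)

text \<open>By adjointness the pairing equals the pairing of \<open>B\<close> with \<open>Q M\<^sup>T - M Q\<close>, where \<open>Q = M\<^sup>k J\<close>,
  and this difference is 0.\<close>

lemma mat_pairing_skew_image:
  assumes J: "J \<in> carrier_mat n n" "transpose_mat J = J" and S: "S \<in> carrier_mat n n" "transpose_mat S = S"
    and B: "B \<in> carrier_mat n n"
  shows "mat_pairing n (B * (J * S) - transpose_mat (J * S) * B) (moment_mat J S k) = 0"
proof -
  let ?M = "J * S" and ?Q = "moment_mat J S k"
  have M: "?M \<in> carrier_mat n n" "transpose_mat ?M \<in> carrier_mat n n" using J S by auto
  note Q = moment_mat[OF J S, of k]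
  have "mat_pairing n (B * ?M - transpose_mat ?M * B) ?Q = mat_pairing n (B * ?M) ?Q - mat_pairing n (transpose_mat ?M * B) ?Q"
    by (rule mat_pairing_diff) (use B M in \<open>auto intro: mult_carrier_mat\<close>)
  also have "mat_pairing n (B * ?M) ?Q = mat_pairing n B (?Q * transpose_mat ?M)" by (rule mat_pairing_mult(1)[OF B M(1) Q(1)])
  also have "mat_pairing n (transpose_mat ?M * B) ?Q = mat_pairing n B (?M * ?Q)"
    using mat_pairing_mult(2)[OF M(2) B Q(1)] by simp
  finally show ?thesis by (simp add: Q(2))
qed

text \<open>Let \<open>N = a X + b S\<close> and \<open>M = J S\<close>. From \<open>J N = a + b M\<close> one gets
  \<open>a M\<^sup>k adj N + b M\<^sup>k\<^sup>+\<^sup>1 adj N = det N \<cdot> M\<^sup>k J\<close>. So if \<open>W\<close> is orthogonal to \<open>M\<^sup>k adj N\<close> for all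
  \<open>(a, b)\<close>, then \<open>(a, b) = (1, 0)\<close> gives the \<open>k\<close>-th moment, and then the relation gives
  orthogonality to \<open>M\<^sup>k\<^sup>+\<^sup>1 adj N\<close> when \<open>b \<noteq> 0\<close>, and by continuity also when \<open>b = 0\<close>.\<close>

lemma moments_vanish:
  assumes n: "0 < n" and X: "X \<in> carrier_mat n n" and J: "J \<in> carrier_mat n n" "J * X = 1\<^sub>m n" "X * J = 1\<^sub>m n" and S: "S \<in> carrier_mat n n"
    and W: "W \<in> carrier_mat n n" and adj: "\<And>a b. mat_pairing n W (adj_mat (a \<cdot>\<^sub>m X + b \<cdot>\<^sub>m S)) = 0"
  shows "mat_pairing n W (moment_mat J S k) = 0"
proof -
  let ?M = "J * S"
  define D where "D a b = adj_mat (a \<cdot>\<^sub>m X + b \<cdot>\<^sub>m S)" for a b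
  have N: "a \<cdot>\<^sub>m X + b \<cdot>\<^sub>m S \<in> carrier_mat n n" for a b using X S by auto
  have D: "D a b \<in> carrier_mat n n" for a b unfolding D_def by (rule adj_mat(1)[OF N])
  have M: "?M \<in> carrier_mat n n" using J S by auto
  have Mk: "?M ^\<^sub>m k \<in> carrier_mat n n" for k by (rule pow_carrier_mat[OF M])
  have detX: "det X \<noteq> 0"
  proof
    assume "det X = 0"
    then have "det (J * X) = 0" using det_mult[OF J(1) X] by simp
    then show False by (simp add: J(2))
  qed
  have lin: "a * mat_pairing n W A + b * mat_pairing n W B = c * mat_pairing n W C"
    if "A \<in> carrier_mat n n" "B \<in> carrier_mat n n" "C \<in> carrier_mat n n" "a \<cdot>\<^sub>m A + b \<cdot>\<^sub>m B = c \<cdot>\<^sub>m C" for a b c A B C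
  proof -
    have "a * A $$ (i, j) + b * B $$ (i, j) = c * C $$ (i, j)" if ij: "i < n" "j < n" for i j
    proof -
      have "(a \<cdot>\<^sub>m A + b \<cdot>\<^sub>m B) $$ (i, j) = (c \<cdot>\<^sub>m C) $$ (i, j)" using that by (simp only: \<open>a \<cdot>\<^sub>m A + b \<cdot>\<^sub>m B = c \<cdot>\<^sub>m C\<close>)
      then show ?thesis using ij \<open>A \<in> carrier_mat n n\<close> \<open>B \<in> carrier_mat n n\<close> \<open>C \<in> carrier_mat n n\<close> by simp
    qed
    then have e: "a * (W $$ (i, j) * A $$ (i, j)) + b * (W $$ (i, j) * B $$ (i, j)) = c * (W $$ (i, j) * C $$ (i, j))" if "i < n" "j < n" for i j
      using that by (metis (no_types, lifting) mult.left_commute distrib_left)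
    show ?thesis unfolding mat_pairing_def sum_distrib_left sum.distrib[symmetric]
      by (intro sum.cong refl) (use e in auto)
  qed
  have JN: "J * (a \<cdot>\<^sub>m X + b \<cdot>\<^sub>m S) = a \<cdot>\<^sub>m 1\<^sub>m n + b \<cdot>\<^sub>m ?M" for a b
    using J X S by (simp add: mult_add_distrib_mat[OF J(1) smult_carrier_mat[OF X] smult_carrier_mat[OF S]] mult_smult_distrib)
  \<comment> \<open>multiply \<open>J N = a + b M\<close> by \<open>M\<^sup>k\<close> from the left and by \<open>adj N\<close> from the right\<close>
  have rec: "a \<cdot>\<^sub>m (?M ^\<^sub>m k * D a b) + b \<cdot>\<^sub>m (?M ^\<^sub>m Suc k * D a b) = det (a \<cdot>\<^sub>m X + b \<cdot>\<^sub>m S) \<cdot>\<^sub>m moment_mat J S k" for a b k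
  proof -
    let ?N = "a \<cdot>\<^sub>m X + b \<cdot>\<^sub>m S"
    have c: "1\<^sub>m n \<in> carrier_mat n n" "a \<cdot>\<^sub>m 1\<^sub>m n \<in> carrier_mat n n" "b \<cdot>\<^sub>m ?M \<in> carrier_mat n n" using M by auto
    have "?M ^\<^sub>m k * (J * ?N) * D a b = ?M ^\<^sub>m k * (J * (?N * D a b))"
      using assoc_mult_mat[OF Mk[of k] mult_carrier_mat[OF J(1) N] D] assoc_mult_mat[OF J(1) N D] by simp
    also have "?N * D a b = det ?N \<cdot>\<^sub>m 1\<^sub>m n" unfolding D_def by (rule adj_mat(2)[OF N])
    also have "J * (det ?N \<cdot>\<^sub>m 1\<^sub>m n) = det ?N \<cdot>\<^sub>m J" using mult_smult_distrib[OF J(1) c(1)] J by simp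
    also have "?M ^\<^sub>m k * (det ?N \<cdot>\<^sub>m J) = det ?N \<cdot>\<^sub>m moment_mat J S k"
      unfolding moment_mat_def by (rule mult_smult_distrib[OF Mk J(1)])
    finally have r: "?M ^\<^sub>m k * (J * ?N) * D a b = det ?N \<cdot>\<^sub>m moment_mat J S k" .
    have "?M ^\<^sub>m k * (J * ?N) = a \<cdot>\<^sub>m ?M ^\<^sub>m k + b \<cdot>\<^sub>m ?M ^\<^sub>m Suc k"
      unfolding JN mult_add_distrib_mat[OF Mk c(2,3)] mult_smult_distrib[OF Mk c(1)] mult_smult_distrib[OF Mk M]
      using right_mult_one_mat[OF Mk] by simp
    then have "?M ^\<^sub>m k * (J * ?N) * D a b = (a \<cdot>\<^sub>m ?M ^\<^sub>m k) * D a b + (b \<cdot>\<^sub>m ?M ^\<^sub>m Suc k) * D a b"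
      by (simp only: add_mult_distrib_mat[OF smult_carrier_mat[OF Mk] smult_carrier_mat[OF Mk] D])
    then show ?thesis using r by (simp only: mult_smult_assoc_mat[OF Mk D])
  qed
  have claim: "\<forall>a b. mat_pairing n W (?M ^\<^sub>m k * D a b) = 0" for k
  proof (induction k)
    case 0
    have "?M ^\<^sub>m 0 * D a b = D a b" for a b using left_mult_one_mat[OF D[of a b]] J(1) by simp
    then show ?case using adj by (simp only: D_def) blast
  next
    case (Suc k)
    have Q: "moment_mat J S k \<in> carrier_mat n n" unfolding moment_mat_def using Mk J by (meson mult_carrier_mat)
    have MD: "?M ^\<^sub>m k * D a b \<in> carrier_mat n n" for k a b using Mk D by (meson mult_carrier_mat)
    have *: "b * mat_pairing n W (?M ^\<^sub>m Suc k * D a b) = det (a \<cdot>\<^sub>m X + b \<cdot>\<^sub>m S) * mat_pairing n W (moment_mat J S k)" for a b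
      using lin[OF MD MD Q rec] Suc by simp
    have "det (1 \<cdot>\<^sub>m X + 0 \<cdot>\<^sub>m S) = det X"
    proof -
      have "1 \<cdot>\<^sub>m X + 0 \<cdot>\<^sub>m S = X" using X S by (intro eq_matI) auto
      then show ?thesis by simp
    qed
    then have mom: "mat_pairing n W (moment_mat J S k) = 0" using *[of 0 1] detX by simp
    then have nz: "mat_pairing n W (?M ^\<^sub>m Suc k * D a b) = 0" if "b \<noteq> 0" for a b using *[of b a] that by simp
    show ?case
    proof (intro allI)
      fix a b
      show "mat_pairing n W (?M ^\<^sub>m Suc k * D a b) = 0"
      proof (cases "b = 0")
        case True
        \<comment> \<open>the value at \<open>b = 0\<close> is a limit of zeros\<close>
        define f where "f b = mat_pairing n W (?M ^\<^sub>m Suc k * D a b)" for b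
        have Dij: "continuous_on UNIV (\<lambda>b. D a b $$ (i, j))" if "i < n" "j < n" for i j
          unfolding D_def
          by (rule continuous_on_adj_mat[OF N _ that]) (use X S in \<open>auto intro!: continuous_intros\<close>)
        have f_alt: "f = (\<lambda>b. \<Sum>i<n. \<Sum>j<n. W $$ (i, j) * (\<Sum>l<n. (?M ^\<^sub>m Suc k) $$ (i, l) * D a b $$ (l, j)))"
          unfolding f_def mat_pairing_def
          by (intro ext sum.cong refl) (simp only: lessThan_iff index_mult_mat_sum[OF Mk D])
        have "continuous_on UNIV f" unfolding f_alt by (intro continuous_intros Dij) auto
        then have "isCont f 0" by (simp add: continuous_on_eq_continuous_at)
        then have "(f \<longlongrightarrow> f 0) (at 0)" by (simp add: isCont_def)
        moreover have "f b = 0" if "b \<noteq> 0" for b unfolding f_def by (rule nz[OF that])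
        then have "(f \<longlongrightarrow> 0) (at 0)"
          by (intro tendsto_eventually) (simp add: eventually_at_filter)
        ultimately have "f 0 = 0" using tendsto_unique[OF at_neq_bot] by blast
        then show ?thesis using True by (simp add: f_def)
      qed (rule nz)
    qed
  qed
  have Q: "moment_mat J S k \<in> carrier_mat n n" unfolding moment_mat_def using Mk J by (meson mult_carrier_mat)
  have MD: "?M ^\<^sub>m k * D a b \<in> carrier_mat n n" for k a b using Mk D by (meson mult_carrier_mat)
  have "1 \<cdot>\<^sub>m X + 0 \<cdot>\<^sub>m S = X" using X S by (intro eq_matI) auto
  then have "0 = det X * mat_pairing n W (moment_mat J S k)"
    using lin[OF MD MD Q rec[where a = 1 and b = 0 and k = k]] claim by simp
  then show ?thesis using detX by simp
qed

section \<open>Solving for a skew-symmetric matrix\<close>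

definition skew_coeff :: "nat \<Rightarrow> nat \<Rightarrow> nat \<Rightarrow> complex" where
  "skew_coeff s i j = (if pair_index i j = s then (if i < j then 1 else if j < i then -1 else 0) else 0)"

text \<open>A vector indexed by the pairs \<open>i \<le> j\<close> is read as a skew-symmetric matrix; its entries at
  the pairs \<open>(k, k)\<close> are the arguments of \<open>diag_op\<close> below.\<close>

definition skew_mat :: "nat \<Rightarrow> complex vec \<Rightarrow> complex mat" where
  "skew_mat n v = mat n n (\<lambda>(i, j). \<Sum>s<(n + 1) choose 2. skew_coeff s i j * v $ s)"

text \<open>The matrix of \<open>B \<mapsto> B M - M\<^sup>T B\<close> from skew-symmetric to symmetric matrices, in the
  coordinates of \<open>skew_mat\<close> and \<open>sym_coords\<close>. Its columns at the pairs \<open>(k, k)\<close> are zero.\<close>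

definition skew_op :: "nat \<Rightarrow> complex mat \<Rightarrow> complex mat" where
  "skew_op n M = mat ((n + 1) choose 2) ((n + 1) choose 2) (\<lambda>(r, s). case upper_pairs n ! r of (i, j) \<Rightarrow>
     \<Sum>l<n. skew_coeff s i l * M $$ (l, j) - M $$ (l, i) * skew_coeff s l j)"

text \<open>It fills the \<open>n\<close> columns that are zero in \<open>skew_op\<close> with given matrices \<open>C\<^sub>k\<close>.\<close>

definition diag_op :: "nat \<Rightarrow> (nat \<Rightarrow> complex mat) \<Rightarrow> complex mat" where
  "diag_op n C = mat ((n + 1) choose 2) ((n + 1) choose 2) (\<lambda>(r, s). case upper_pairs n ! r of (i, j) \<Rightarrow>
     \<Sum>k<n. if pair_index k k = s then C k $$ (i, j) else 0)"

lemma skew_op_carrier: "skew_op n M \<in> carrier_mat ((n + 1) choose 2) ((n + 1) choose 2)"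
  by (simp add: skew_op_def)

lemma diag_op_carrier: "diag_op n C \<in> carrier_mat ((n + 1) choose 2) ((n + 1) choose 2)"
  by (simp add: diag_op_def)

lemma skew_mat_carrier [simp]: "skew_mat n v \<in> carrier_mat n n"
  by (simp add: skew_mat_def)

lemma pair_index_less': "i < n \<Longrightarrow> j < n \<Longrightarrow> pair_index i j < (n + 1) choose 2"
  using pair_index_less[of i j n] pair_index_less[of j i n] pair_index_commute[of i j] by (cases "i \<le> j") auto

lemma skew_mat_index:
  assumes "i < n" "j < n"
  shows "skew_mat n v $$ (i, j) = (if i < j then v $ pair_index i j else if j < i then - v $ pair_index i j else 0)"
proof -
  have "skew_mat n v $$ (i, j) = (\<Sum>s<(n + 1) choose 2. skew_coeff s i j * v $ s)"
    using assms by (simp add: skew_mat_def)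
  also have "\<dots> = (\<Sum>s<(n + 1) choose 2. if s = pair_index i j then
      (if i < j then v $ s else if j < i then - v $ s else 0) else 0)"
    by (intro sum.cong refl) (auto simp: skew_coeff_def)
  also have "\<dots> = (if i < j then v $ pair_index i j else if j < i then - v $ pair_index i j else 0)"
    using pair_index_less'[OF assms] by simp
  finally show ?thesis .
qed

lemma transpose_skew_mat: "transpose_mat (skew_mat n v) = - skew_mat n v"
proof (rule eq_matI)
  fix i j assume "i < dim_row (- skew_mat n v)" "j < dim_col (- skew_mat n v)"
  then have ij: "i < n" "j < n" by (auto simp: skew_mat_def)
  have "transpose_mat (skew_mat n v) $$ (i, j) = skew_mat n v $$ (j, i)" by (rule transpose_mat_index) (use ij in auto)
  also have "\<dots> = - skew_mat n v $$ (i, j)"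
    using ij pair_index_commute[of i j] by (simp add: skew_mat_index)
  also have "\<dots> = (- skew_mat n v) $$ (i, j)" using ij by (simp add: skew_mat_def)
  finally show "transpose_mat (skew_mat n v) $$ (i, j) = (- skew_mat n v) $$ (i, j)" .
qed (auto simp: skew_mat_def)

lemma minus_mat_index:
  "A \<in> carrier_mat nr nc \<Longrightarrow> B \<in> carrier_mat nr nc \<Longrightarrow> i < nr \<Longrightarrow> j < nc \<Longrightarrow> (A - B) $$ (i, j) = A $$ (i, j) - B $$ (i, j)"
  by simp

lemma skew_op_mult_vec:
  assumes M: "M \<in> carrier_mat n n" and v: "v \<in> carrier_vec ((n + 1) choose 2)" and ij: "i \<le> j" "j < n"
  shows "(skew_op n M *\<^sub>v v) $ pair_index i j = (skew_mat n v * M - transpose_mat M * skew_mat n v) $$ (i, j)"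
proof -
  let ?m = "(n + 1) choose 2"
  let ?r = "pair_index i j"
  have i: "i < n" using ij by simp
  have r: "?r < ?m" using ij by (rule pair_index_less)
  have up: "upper_pairs n ! ?r = (i, j)" using ij by (rule upper_pairs_nth_pair_index)
  have Mt: "transpose_mat M \<in> carrier_mat n n" using M by simp
  have "(skew_op n M *\<^sub>v v) $ ?r = (\<Sum>s<?m. skew_op n M $$ (?r, s) * v $ s)"
    by (rule index_mult_mat_vec_sum[OF skew_op_carrier v r])
  also have "\<dots> = (\<Sum>s<?m. \<Sum>l<n. skew_coeff s i l * v $ s * M $$ (l, j) - M $$ (l, i) * (skew_coeff s l j * v $ s))"
  proof (intro sum.cong refl)
    fix s assume "s \<in> {..<?m}"
    then have "skew_op n M $$ (?r, s) * v $ s = (\<Sum>l<n. (skew_coeff s i l * M $$ (l, j) - M $$ (l, i) * skew_coeff s l j) * v $ s)"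
      using r by (simp add: skew_op_def up sum_distrib_right)
    then show "skew_op n M $$ (?r, s) * v $ s
        = (\<Sum>l<n. skew_coeff s i l * v $ s * M $$ (l, j) - M $$ (l, i) * (skew_coeff s l j * v $ s))"
      by (simp add: algebra_simps)
  qed
  also have "\<dots> = (\<Sum>l<n. \<Sum>s<?m. skew_coeff s i l * v $ s * M $$ (l, j) - M $$ (l, i) * (skew_coeff s l j * v $ s))"
    by (rule sum.swap)
  also have "\<dots> = (\<Sum>l<n. skew_mat n v $$ (i, l) * M $$ (l, j) - transpose_mat M $$ (i, l) * skew_mat n v $$ (l, j))"
    using i ij by (intro sum.cong refl) (simp add: skew_mat_def sum_subtractf sum_distrib_left sum_distrib_right transpose_mat_index[OF M])
  also have "\<dots> = (skew_mat n v * M) $$ (i, j) - (transpose_mat M * skew_mat n v) $$ (i, j)"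
    by (simp add: index_mult_mat_sum[OF skew_mat_carrier M i ij(2)] index_mult_mat_sum[OF Mt skew_mat_carrier i ij(2)] sum_subtractf)
  also have "\<dots> = (skew_mat n v * M - transpose_mat M * skew_mat n v) $$ (i, j)"
    using i ij M by (simp add: skew_mat_def)
  finally show ?thesis .
qed

lemma diag_op_mult_vec:
  assumes v: "v \<in> carrier_vec ((n + 1) choose 2)" and ij: "i \<le> j" "j < n"
  shows "(diag_op n C *\<^sub>v v) $ pair_index i j = (\<Sum>k<n. C k $$ (i, j) * v $ pair_index k k)"
proof -
  let ?m = "(n + 1) choose 2"
  let ?r = "pair_index i j"
  have r: "?r < ?m" using ij by (rule pair_index_less)
  have up: "upper_pairs n ! ?r = (i, j)" using ij by (rule upper_pairs_nth_pair_index)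
  have "(diag_op n C *\<^sub>v v) $ ?r = (\<Sum>s<?m. diag_op n C $$ (?r, s) * v $ s)"
    by (rule index_mult_mat_vec_sum[OF diag_op_carrier v r])
  also have "\<dots> = (\<Sum>s<?m. \<Sum>k<n. if s = pair_index k k then C k $$ (i, j) * v $ s else 0)"
    using r by (intro sum.cong refl) (auto simp: diag_op_def up sum_distrib_right intro!: sum.cong)
  also have "\<dots> = (\<Sum>k<n. \<Sum>s<?m. if s = pair_index k k then C k $$ (i, j) * v $ s else 0)" by (rule sum.swap)
  also have "\<dots> = (\<Sum>k<n. C k $$ (i, j) * v $ pair_index k k)"
  proof (intro sum.cong refl)
    fix k assume "k \<in> {..<n}"
    then have "pair_index k k < ?m" by (intro pair_index_less') auto
    then show "(\<Sum>s<?m. if s = pair_index k k then C k $$ (i, j) * v $ s else 0) = C k $$ (i, j) * v $ pair_index k k"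
      by simp
  qed
  finally show ?thesis .
qed

lemma symmetric_index:
  assumes "transpose_mat A = A" "A \<in> carrier_mat n n" "i < n" "j < n"
  shows "A $$ (i, j) = A $$ (j, i)"
  using transpose_mat_index[OF assms(2,3,4)] assms(1) by simp

lemma skew_image_symmetric:
  assumes M: "M \<in> carrier_mat n n" and ij: "i < n" "j < n"
  shows "(skew_mat n v * M - transpose_mat M * skew_mat n v) $$ (i, j) = (skew_mat n v * M - transpose_mat M * skew_mat n v) $$ (j, i)"
proof -
  let ?B = "skew_mat n v"
  have B: "?B $$ (r, s) = - ?B $$ (s, r)" if "r < n" "s < n" for r s
    using that pair_index_commute[of r s] by (simp add: skew_mat_index)
  have Mt: "transpose_mat M \<in> carrier_mat n n" using M by simp
  have *: "(?B * M - transpose_mat M * ?B) $$ (r, s) = (\<Sum>l<n. ?B $$ (r, l) * M $$ (l, s)) - (\<Sum>l<n. M $$ (l, r) * ?B $$ (l, s))"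
    if "r < n" "s < n" for r s
  proof -
    have "(?B * M - transpose_mat M * ?B) $$ (r, s) = (?B * M) $$ (r, s) - (transpose_mat M * ?B) $$ (r, s)"
      using that M by (simp add: skew_mat_def)
    also have "(transpose_mat M * ?B) $$ (r, s) = (\<Sum>l<n. M $$ (l, r) * ?B $$ (l, s))"
      unfolding index_mult_mat_sum[OF Mt skew_mat_carrier that]
      using that by (intro sum.cong refl) (simp add: transpose_mat_index[OF M])
    finally show ?thesis by (simp add: index_mult_mat_sum[OF skew_mat_carrier M that])
  qed
  have "(\<Sum>l<n. ?B $$ (i, l) * M $$ (l, j)) = - (\<Sum>l<n. M $$ (l, j) * ?B $$ (l, i))"
    unfolding sum_negf[symmetric] using ij B[of i] by (intro sum.cong refl) simp
  moreover have "(\<Sum>l<n. M $$ (l, i) * ?B $$ (l, j)) = - (\<Sum>l<n. ?B $$ (j, l) * M $$ (l, i))"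
    unfolding sum_negf[symmetric] using ij B[of j] by (intro sum.cong refl) simp
  ultimately show ?thesis unfolding *[OF ij] *[OF ij(2,1)] by simp
qed

text \<open>The conjugates span a complement of the annihilator of the moments, since the Hermitian
  form is definite.\<close>

definition conj_moments :: "complex mat \<Rightarrow> complex mat \<Rightarrow> nat \<Rightarrow> complex mat" where
  "conj_moments J S k = map_mat cnj (moment_mat J S k)"

text \<open>Let \<open>L\<close> be the part of \<open>W\<close> from the skew-symmetric matrix, and \<open>R\<close> the combination of the
  conjugate moments with the diagonal entries of \<open>v\<close>, so that \<open>W = L + R\<close>. Both \<open>W\<close> and \<open>L\<close> are
  orthogonal to all moments, so \<open>R\<close> is orthogonal to all moments, in particular to its conjugate;
  that is \<open>\<parallel>R\<parallel>\<^sup>2 = 0\<close>. Thus a polynomial of degree less than \<open>n\<close> in \<open>M\<close>, with the conjugated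
  diagonal entries of \<open>v\<close> as coefficients, is zero, and so are its coefficients.\<close>

lemma diag_part_vanishes:
  fixes W :: "complex mat"
  assumes J: "J \<in> carrier_mat n n" "transpose_mat J = J" and X: "X \<in> carrier_mat n n" "J * X = 1\<^sub>m n"
    and S: "S \<in> carrier_mat n n" "transpose_mat S = S"
    and cork: "\<And>l. adj_mat (J * S - l \<cdot>\<^sub>m 1\<^sub>m n) \<noteq> 0\<^sub>m n n"
    and W: "W \<in> carrier_mat n n" "transpose_mat W = W" and mom: "\<And>k. mat_pairing n W (moment_mat J S k) = 0"
    and v: "v \<in> carrier_vec ((n + 1) choose 2)"
    and eq: "(skew_op n (J * S) + diag_op n (conj_moments J S)) *\<^sub>v v = sym_coords n W"
    and k: "k < n"
  shows "v $ pair_index k k = 0"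
proof -
  let ?M = "J * S" and ?B = "skew_mat n v"
  let ?Q = "moment_mat J S"
  let ?L = "?B * ?M - transpose_mat ?M * ?B"
  have M: "?M \<in> carrier_mat n n" using J S by auto
  have Q: "?Q k \<in> carrier_mat n n" "transpose_mat (?Q k) = ?Q k" for k by (rule moment_mat[OF J S])+
  define R where "R i j = (\<Sum>k<n. v $ pair_index k k * cnj (?Q k $$ (i, j)))" for i j
  have upper: "?L $$ (i, j) + R i j = W $$ (i, j)" if ij: "i \<le> j" "j < n" for i j
  proof -
    have r: "pair_index i j < (n + 1) choose 2" using ij by (rule pair_index_less)
    have "W $$ (i, j) = sym_coords n W $ pair_index i j"
      using r upper_pairs_nth_pair_index[OF ij] by (simp add: sym_coords_def)
    also have "\<dots> = (skew_op n ?M *\<^sub>v v) $ pair_index i j + (diag_op n (conj_moments J S) *\<^sub>v v) $ pair_index i j"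
      unfolding eq[symmetric] add_mult_distrib_mat_vec[OF skew_op_carrier diag_op_carrier v]
      using r by (simp add: diag_op_def)
    also have "(diag_op n (conj_moments J S) *\<^sub>v v) $ pair_index i j = R i j"
      unfolding diag_op_mult_vec[OF v ij] R_def conj_moments_def using ij
      by (intro sum.cong refl) (simp add: carrier_matD[OF Q(1)])
    finally show ?thesis using skew_op_mult_vec[OF M v ij] by simp
  qed
  have Rsym: "R i j = R j i" if "i < n" "j < n" for i j
    unfolding R_def using symmetric_index[OF Q(2) Q(1) that] by simp
  have all: "?L $$ (i, j) + R i j = W $$ (i, j)" if ij: "i < n" "j < n" for i j
  proof (cases "i \<le> j")
    case True then show ?thesis using upper ij by simp
  next
    case False
    then have "?L $$ (j, i) + R j i = W $$ (j, i)" using upper[of j i] ij by simp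
    then show ?thesis
      using skew_image_symmetric[OF M ij, of v] Rsym[OF ij] symmetric_index[OF W(2,1) ij] by simp
  qed
  have pair0: "(\<Sum>i<n. \<Sum>j<n. R i j * ?Q k $$ (i, j)) = 0" for k
  proof -
    have "(\<Sum>i<n. \<Sum>j<n. R i j * ?Q k $$ (i, j)) = mat_pairing n W (?Q k) - mat_pairing n ?L (?Q k)"
      unfolding mat_pairing_def sum_subtractf[symmetric]
    proof (intro sum.cong refl)
      fix i j assume "i \<in> {..<n}" "j \<in> {..<n}"
      then have "R i j = W $$ (i, j) - ?L $$ (i, j)" using all[of i j] by (simp add: eq_diff_eq add.commute)
      then show "R i j * ?Q k $$ (i, j) = W $$ (i, j) * ?Q k $$ (i, j) - ?L $$ (i, j) * ?Q k $$ (i, j)"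
        by (simp only: left_diff_distrib)
    qed
    then show ?thesis using mom mat_pairing_skew_image[OF J S skew_mat_carrier] by simp
  qed
  have cR: "cnj (R i j) = (\<Sum>k<n. cnj (v $ pair_index k k) * ?Q k $$ (i, j))" for i j
    by (simp add: R_def)
  have "(\<Sum>i<n. \<Sum>j<n. R i j * cnj (R i j)) = (\<Sum>i<n. \<Sum>j<n. \<Sum>k<n. cnj (v $ pair_index k k) * (R i j * ?Q k $$ (i, j)))"
    unfolding cR sum_distrib_left by (intro sum.cong refl) (simp only: mult_ac)
  also have "\<dots> = (\<Sum>i<n. \<Sum>k<n. \<Sum>j<n. cnj (v $ pair_index k k) * (R i j * ?Q k $$ (i, j)))"
    by (intro sum.cong refl sum.swap)
  also have "\<dots> = (\<Sum>k<n. \<Sum>i<n. \<Sum>j<n. cnj (v $ pair_index k k) * (R i j * ?Q k $$ (i, j)))"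
    by (rule sum.swap)
  also have "\<dots> = 0" by (simp add: sum_distrib_left[symmetric] pair0)
  finally have "(\<Sum>i<n. \<Sum>j<n. R i j * cnj (R i j)) = 0" .
  then have "complex_of_real (\<Sum>i<n. \<Sum>j<n. (cmod (R i j))\<^sup>2) = 0"
    by (simp only: of_real_sum complex_norm_square)
  then have sq: "(\<Sum>i<n. \<Sum>j<n. (cmod (R i j))\<^sup>2) = 0" by (simp only: of_real_eq_0_iff)
  have R0: "R i j = 0" if "i < n" "j < n" for i j
  proof -
    have "\<forall>i\<in>{..<n}. (\<Sum>j<n. (cmod (R i j))\<^sup>2) = 0"
      using sq by (subst sum_nonneg_eq_0_iff[symmetric]) (auto intro: sum_nonneg)
    then have "(\<Sum>j<n. (cmod (R i j))\<^sup>2) = 0" using that by simp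
    then have "\<forall>j\<in>{..<n}. (cmod (R i j))\<^sup>2 = 0" by (subst sum_nonneg_eq_0_iff[symmetric]) auto
    then show ?thesis using that by simp
  qed
  define p where "p = (\<Sum>k<n. Polynomial.monom (cnj (v $ pair_index k k)) k)"
  have coeff: "Polynomial.coeff p k = cnj (v $ pair_index k k)" if "k < n" for k
    using that by (simp add: p_def coeff_sum)
  have n: "0 < n" using k by simp
  have deg: "degree p < n"
    unfolding p_def by (rule degree_sum_less) (use n in \<open>auto intro: le_less_trans[OF degree_monom_le]\<close>)
  have pJ: "mat_poly n ?M p * J = 0\<^sub>m n n"
  proof (rule eq_matI)
    fix i j assume "i < dim_row (0\<^sub>m n n :: complex mat)" "j < dim_col (0\<^sub>m n n :: complex mat)"
    then have ij: "i < n" "j < n" by auto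
    have "(mat_poly n ?M p * J) $$ (i, j) = (\<Sum>l<n. \<Sum>k<n. Polynomial.coeff p k * ((?M ^\<^sub>m k) $$ (i, l) * J $$ (l, j)))"
      unfolding index_mult_mat_sum[OF mat_poly_carrier J(1) ij]
    proof (intro sum.cong refl)
      fix l assume "l \<in> {..<n}"
      then have "mat_poly n ?M p $$ (i, l) = (\<Sum>k\<le>n - 1. Polynomial.coeff p k * (?M ^\<^sub>m k) $$ (i, l))"
        using ij deg by (intro mat_poly_index) auto
      also have "{..n - 1} = {..<n}" using n by auto
      finally show "mat_poly n ?M p $$ (i, l) * J $$ (l, j) = (\<Sum>k<n. Polynomial.coeff p k * ((?M ^\<^sub>m k) $$ (i, l) * J $$ (l, j)))"
        by (simp add: sum_distrib_right mult.assoc)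
    qed
    also have "\<dots> = (\<Sum>k<n. \<Sum>l<n. Polynomial.coeff p k * ((?M ^\<^sub>m k) $$ (i, l) * J $$ (l, j)))" by (rule sum.swap)
    also have "\<dots> = (\<Sum>k<n. cnj (v $ pair_index k k) * ?Q k $$ (i, j))"
      by (intro sum.cong refl) (simp add: coeff moment_mat_def index_mult_mat_sum[OF pow_carrier_mat[OF M] J(1) ij] sum_distrib_left)
    also have "\<dots> = 0" using cR[of i j] R0[OF ij] by simp
    finally show "(mat_poly n ?M p * J) $$ (i, j) = 0\<^sub>m n n $$ (i, j)" using ij by simp
  qed (use J in \<open>auto simp: mat_poly_def\<close>)
  have "mat_poly n ?M p = mat_poly n ?M p * (J * X)" unfolding X(2) by (rule right_mult_one_mat[OF mat_poly_carrier, symmetric])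
  also have "\<dots> = (mat_poly n ?M p * J) * X" by (rule assoc_mult_mat[OF mat_poly_carrier J(1) X(1), symmetric])
  also have "\<dots> = 0\<^sub>m n n" unfolding pJ by (rule left_mult_zero_mat[OF X(1)])
  finally have "p = 0" using mat_poly_nonzero[OF M cork _ deg] by blast
  then show ?thesis using coeff[OF k] by simp
qed

lemma sym_coords_eq_0_imp:
  fixes W :: "complex mat"
  assumes W: "W \<in> carrier_mat n n" "transpose_mat W = W" and 0: "sym_coords n W = 0\<^sub>v ((n + 1) choose 2)"
  shows "W = 0\<^sub>m n n"
proof (rule eq_matI)
  have up: "W $$ (i, j) = 0" if "i \<le> j" "j < n" for i j
  proof -
    have "sym_coords n W $ pair_index i j = 0" unfolding 0 using pair_index_less[OF that] by simp
    then show ?thesis using pair_index_less[OF that] upper_pairs_nth_pair_index[OF that] by (simp add: sym_coords_def)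
  qed
  fix i j assume "i < dim_row (0\<^sub>m n n :: complex mat)" "j < dim_col (0\<^sub>m n n :: complex mat)"
  then have ij: "i < n" "j < n" by auto
  show "W $$ (i, j) = 0\<^sub>m n n $$ (i, j)"
    using up[of i j] up[of j i] symmetric_index[OF W(2,1) ij] ij by (cases "i \<le> j") auto
qed (use W in auto)

text \<open>For a kernel vector the diagonal entries vanish by the preceding lemma, applied to \<open>W = 0\<close>;
  what remains is a skew-symmetric matrix \<open>B\<close> with \<open>B M = M\<^sup>T B\<close>, which is 0.\<close>

lemma det_skew_diag_op:
  assumes J: "J \<in> carrier_mat n n" "transpose_mat J = J" and X: "X \<in> carrier_mat n n" "J * X = 1\<^sub>m n"
    and S: "S \<in> carrier_mat n n" "transpose_mat S = S"
    and cork: "\<And>l. adj_mat (J * S - l \<cdot>\<^sub>m 1\<^sub>m n) \<noteq> 0\<^sub>m n n"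
  shows "det (skew_op n (J * S) + diag_op n (conj_moments J S)) \<noteq> 0"
proof
  let ?m = "(n + 1) choose 2" and ?M = "J * S"
  let ?A = "skew_op n ?M + diag_op n (conj_moments J S)"
  have A: "?A \<in> carrier_mat ?m ?m" using skew_op_carrier diag_op_carrier by auto
  have M: "?M \<in> carrier_mat n n" using J S by auto
  assume "det ?A = 0"
  then obtain v where v: "v \<in> carrier_vec ?m" "v \<noteq> 0\<^sub>v ?m" "?A *\<^sub>v v = 0\<^sub>v ?m"
    using det_0_iff_vec_prod_zero_field[OF A] by auto
  have s0: "sym_coords n (0\<^sub>m n n) = (0\<^sub>v ?m :: complex vec)"
  proof (rule eq_vecI)
    fix r assume "r < dim_vec (0\<^sub>v ?m :: complex vec)"
    then have r: "r < ?m" by simp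
    then obtain i j where ij: "upper_pairs n ! r = (i, j)" "i \<le> j" "j < n" by (rule upper_pairs_nthE)
    then show "sym_coords n (0\<^sub>m n n) $ r = (0\<^sub>v ?m :: complex vec) $ r" using r by (simp add: sym_coords_def)
  qed (simp add: sym_coords_def)
  have zt: "transpose_mat (0\<^sub>m n n) = (0\<^sub>m n n :: complex mat)" by (intro eq_matI) auto
  have diag: "v $ pair_index k k = 0" if "k < n" for k
    by (rule diag_part_vanishes[OF J X S cork zero_carrier_mat zt _ v(1) _ that])
      (use v(3) s0 in \<open>auto simp: mat_pairing_def\<close>)
  have D0: "(diag_op n (conj_moments J S) *\<^sub>v v) $ pair_index i j = 0" if "i \<le> j" "j < n" for i j
    unfolding diag_op_mult_vec[OF v(1) that] by (intro sum.neutral) (simp add: diag)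
  let ?B = "skew_mat n v"
  have L0: "(?B * ?M - transpose_mat ?M * ?B) $$ (i, j) = 0" if ij: "i \<le> j" "j < n" for i j
  proof -
    have r: "pair_index i j < ?m" by (rule pair_index_less[OF ij])
    have "(?A *\<^sub>v v) $ pair_index i j = (skew_op n ?M *\<^sub>v v) $ pair_index i j + (diag_op n (conj_moments J S) *\<^sub>v v) $ pair_index i j"
      unfolding add_mult_distrib_mat_vec[OF skew_op_carrier diag_op_carrier v(1)] using r by (simp add: diag_op_def)
    then show ?thesis unfolding v(3) D0[OF ij] skew_op_mult_vec[OF M v(1) ij] using r by simp
  qed
  have L0': "(?B * ?M - transpose_mat ?M * ?B) $$ (i, j) = 0" if ij: "i < n" "j < n" for i j
    using L0[of i j] L0[of j i] skew_image_symmetric[OF M ij, of v] ij by (cases "i \<le> j") auto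
  have "?B * ?M = transpose_mat ?M * ?B"
  proof (rule eq_matI)
    fix i j assume "i < dim_row (transpose_mat ?M * ?B)" "j < dim_col (transpose_mat ?M * ?B)"
    then have ij: "i < n" "j < n" using M by (auto simp: skew_mat_def)
    have "(?B * ?M - transpose_mat ?M * ?B) $$ (i, j) = (?B * ?M) $$ (i, j) - (transpose_mat ?M * ?B) $$ (i, j)"
      by (rule minus_mat_index[OF mult_carrier_mat[OF skew_mat_carrier M]
          mult_carrier_mat[OF transpose_carrier_mat[THEN iffD2, OF M] skew_mat_carrier] ij])
    then show "(?B * ?M) $$ (i, j) = (transpose_mat ?M * ?B) $$ (i, j)" using L0'[OF ij] by simp
  qed (use M in \<open>auto simp: skew_mat_def\<close>)
  then have B0: "?B = 0\<^sub>m n n" by (rule skew_intertwiner_eq_0[OF M cork skew_mat_carrier transpose_skew_mat])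
  have "v $ r = 0" if r: "r < ?m" for r
  proof -
    obtain i j where ij: "upper_pairs n ! r = (i, j)" "i \<le> j" "j < n" "pair_index i j = r" using r by (rule upper_pairs_nthE)
    show ?thesis
    proof (cases "i = j")
      case True then show ?thesis using diag[of i] ij by simp
    next
      case False
      then have "?B $$ (i, j) = v $ r" using ij by (simp add: skew_mat_index)
      then show ?thesis unfolding B0 using ij by simp
    qed
  qed
  then have "v = 0\<^sub>v ?m" using v(1) by (intro eq_vecI) auto
  then show False using v(2) by simp
qed

section \<open>Apolar matrices of a net with a nonsingular member\<close>

lemma inverse_symmetric:
  fixes X :: "'a::comm_ring_1 mat"
  assumes X: "X \<in> carrier_mat n n" "transpose_mat X = X" and J: "J \<in> carrier_mat n n" "J * X = 1\<^sub>m n" "X * J = 1\<^sub>m n"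
  shows "transpose_mat J = J"
proof -
  have Jt: "transpose_mat J \<in> carrier_mat n n" using J by simp
  have "transpose_mat J * X = transpose_mat (X * J)" using transpose_mult[OF X(1) J(1)] X(2) by simp
  also have "\<dots> = 1\<^sub>m n" unfolding J(3) by simp
  finally have 1: "transpose_mat J * X = 1\<^sub>m n" .
  have "transpose_mat J = transpose_mat J * (X * J)" unfolding J(3) by (rule right_mult_one_mat[OF Jt, symmetric])
  also have "\<dots> = (transpose_mat J * X) * J" by (rule assoc_mult_mat[OF Jt X(1) J(1), symmetric])
  also have "\<dots> = J" unfolding 1 by (rule left_mult_one_mat[OF J(1)])
  finally show ?thesis .
qed

lemma skew_op_add_smult:
  assumes "A \<in> carrier_mat n n" "B \<in> carrier_mat n n" "M \<in> carrier_mat n n"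
    and "\<And>i j. i < n \<Longrightarrow> j < n \<Longrightarrow> M $$ (i, j) = a * A $$ (i, j) + b * B $$ (i, j)"
  shows "a \<cdot>\<^sub>m skew_op n A + b \<cdot>\<^sub>m skew_op n B = skew_op n M"
proof (rule eq_matI)
  let ?m = "(n + 1) choose 2"
  fix r s assume "r < dim_row (skew_op n M)" "s < dim_col (skew_op n M)"
  then have rs: "r < ?m" "s < ?m" by (auto simp: skew_op_def)
  obtain i j where ij: "upper_pairs n ! r = (i, j)" "i \<le> j" "j < n" using rs(1) by (rule upper_pairs_nthE)
  have e: "skew_op n C $$ (r, s) = (\<Sum>l<n. skew_coeff s i l * C $$ (l, j) - C $$ (l, i) * skew_coeff s l j)" for C
    using rs by (simp add: skew_op_def ij)
  have "(a \<cdot>\<^sub>m skew_op n A + b \<cdot>\<^sub>m skew_op n B) $$ (r, s) = a * skew_op n A $$ (r, s) + b * skew_op n B $$ (r, s)"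
    using rs by (simp add: skew_op_def)
  also have "\<dots> = skew_op n M $$ (r, s)"
    unfolding e sum_distrib_left sum.distrib[symmetric] using ij
    by (intro sum.cong refl) (simp add: assms(4) algebra_simps)
  finally show "(a \<cdot>\<^sub>m skew_op n A + b \<cdot>\<^sub>m skew_op n B) $$ (r, s) = skew_op n M $$ (r, s)" .
qed (auto simp: skew_op_def)

text \<open>Since \<open>S - l X = X (J S - l)\<close>, kernel vectors of the second factor are kernel vectors of
  the product.\<close>

lemma corank_shift:
  fixes X :: "complex mat"
  assumes n: "0 < n" and X: "X \<in> carrier_mat n n" and J: "J \<in> carrier_mat n n" "X * J = 1\<^sub>m n"
    and S: "S \<in> carrier_mat n n" and N: "adj_mat (S - l \<cdot>\<^sub>m X) \<noteq> 0\<^sub>m n n"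
  shows "adj_mat (J * S - l \<cdot>\<^sub>m 1\<^sub>m n) \<noteq> 0\<^sub>m n n"
proof
  let ?A = "J * S - l \<cdot>\<^sub>m 1\<^sub>m n"
  have JS: "J * S \<in> carrier_mat n n" using J S by auto
  have A: "?A \<in> carrier_mat n n" using JS by auto
  assume "adj_mat ?A = 0\<^sub>m n n"
  then obtain u w where u: "u \<in> carrier_vec n" "?A *\<^sub>v u = 0\<^sub>v n" and w: "w \<in> carrier_vec n" "?A *\<^sub>v w = 0\<^sub>v n"
    and ind: "\<And>a b. (\<forall>i<n. a * u $ i + b * w $ i = 0) \<Longrightarrow> a = 0 \<and> b = 0"
    using two_kernel_vectors_if_adj_mat_eq_0[OF A n] by blast
  have XA: "X * ?A = S - l \<cdot>\<^sub>m X"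
  proof -
    have "X * ?A = X * (J * S) - X * (l \<cdot>\<^sub>m 1\<^sub>m n)" using X JS by (intro mult_minus_distrib_mat) auto
    also have "X * (J * S) = S" using assoc_mult_mat[OF X J(1) S] J(2) left_mult_one_mat[OF S] by simp
    also have "X * (l \<cdot>\<^sub>m 1\<^sub>m n) = l \<cdot>\<^sub>m X" using mult_smult_distrib[OF X one_carrier_mat] right_mult_one_mat[OF X] by simp
    finally show ?thesis .
  qed
  have K: "(S - l \<cdot>\<^sub>m X) *\<^sub>v y = 0\<^sub>v n" if "y \<in> carrier_vec n" "?A *\<^sub>v y = 0\<^sub>v n" for y
    unfolding XA[symmetric] assoc_mult_mat_vec[OF X A that(1)] that(2) by (rule mult_mat_zero_vec[OF X])
  have "adj_mat (S - l \<cdot>\<^sub>m X) = 0\<^sub>m n n"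
    by (rule adj_mat_eq_0_if_kernel[OF _ u(1) K[OF u] w(1) K[OF w] ind]) (use X S in auto)
  then show False using N by simp
qed

lemma unique_solution:
  fixes A :: "complex mat"
  assumes A: "A \<in> carrier_mat m m" "det A \<noteq> 0" and v: "v \<in> carrier_vec m" "v' \<in> carrier_vec m" and eq: "A *\<^sub>v v = A *\<^sub>v v'"
  shows "v = v'"
proof -
  have "det A \<cdot>\<^sub>v x = adj_mat A *\<^sub>v (A *\<^sub>v x)" if "x \<in> carrier_vec m" for x
    using assoc_mult_mat_vec[OF adj_mat(1)[OF A(1)] A(1) that] adj_mat(3)[OF A(1)] smult_one_mult_vec[OF that] by simp
  then have e: "det A \<cdot>\<^sub>v v = det A \<cdot>\<^sub>v v'" using v eq by simp
  show ?thesis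
  proof (rule eq_vecI)
    fix i assume "i < dim_vec v'"
    then show "v $ i = v' $ i" using arg_cong[OF e, of "\<lambda>x. x $ i"] v A(2) by auto
  qed (use v in auto)
qed

lemma solution_exists:
  fixes A :: "complex mat"
  assumes A: "A \<in> carrier_mat m m" "det A \<noteq> 0" and w: "w \<in> carrier_vec m"
  shows "\<exists>v\<in>carrier_vec m. A *\<^sub>v v = w"
proof -
  let ?v = "adj_mat A *\<^sub>v (inverse (det A) \<cdot>\<^sub>v w)"
  have iw: "inverse (det A) \<cdot>\<^sub>v w \<in> carrier_vec m" using w by simp
  have "A *\<^sub>v ?v = (A * adj_mat A) *\<^sub>v (inverse (det A) \<cdot>\<^sub>v w)"
    by (rule assoc_mult_mat_vec[OF A(1) adj_mat(1)[OF A(1)] iw, symmetric])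
  also have "\<dots> = det A \<cdot>\<^sub>v (inverse (det A) \<cdot>\<^sub>v w)" by (simp only: adj_mat(2)[OF A(1)] smult_one_mult_vec[OF iw])
  also have "\<dots> = w" using A(2) w by (intro eq_vecI) auto
  finally have "A *\<^sub>v ?v = w" .
  moreover have "?v \<in> carrier_vec m" by (rule mult_mat_vec_carrier[OF adj_mat(1)[OF A(1)] iw])
  ultimately show ?thesis by blast
qed

text \<open>For every \<open>(a, b) \<noteq> 0\<close> the apolar matrix \<open>W\<close> is \<open>B M - M\<^sup>T B\<close> for exactly one
  skew-symmetric \<open>B\<close>, where \<open>M = J (a Y + b Z)\<close>, because the moments of \<open>W\<close> vanish. As \<open>M\<close> is
  linear in \<open>(a, b)\<close>, the solution \<open>B\<close> is homogeneous of degree -1, and therefore zero.\<close>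

lemma apolar_matrix_eq_0:
  fixes X Y Z W :: "complex mat"
  assumes n: "0 < n" and X: "X \<in> carrier_mat n n" "transpose_mat X = X" and Y: "Y \<in> carrier_mat n n" "transpose_mat Y = Y"
    and Z: "Z \<in> carrier_mat n n" "transpose_mat Z = Z" and detX: "det X \<noteq> 0"
    and cork: "\<And>a b c. a \<noteq> 0 \<or> b \<noteq> 0 \<or> c \<noteq> 0 \<Longrightarrow> adj_mat (net_point X Y Z a b c) \<noteq> 0\<^sub>m n n"
    and W: "W \<in> carrier_mat n n" "transpose_mat W = W"
    and apolar: "\<And>a b c. mat_pairing n W (adj_mat (net_point X Y Z a b c)) = 0"
  shows "W = 0\<^sub>m n n"
proof -
  let ?m = "(n + 1) choose 2"
  define J where "J = inverse (det X) \<cdot>\<^sub>m adj_mat X"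
  have aX: "adj_mat X \<in> carrier_mat n n" by (rule adj_mat(1)[OF X(1)])
  have J: "J \<in> carrier_mat n n" using aX by (simp add: J_def)
  have one: "inverse (det X) \<cdot>\<^sub>m (det X \<cdot>\<^sub>m 1\<^sub>m n) = 1\<^sub>m n" using detX by (intro eq_matI) auto
  have JX: "J * X = 1\<^sub>m n" unfolding J_def mult_smult_assoc_mat[OF aX X(1)] adj_mat(3)[OF X(1)] by (rule one)
  have XJ: "X * J = 1\<^sub>m n" unfolding J_def mult_smult_distrib[OF X(1) aX] adj_mat(2)[OF X(1)] by (rule one)
  have Js: "transpose_mat J = J" by (rule inverse_symmetric[OF X J JX XJ])
  define S where "S a b = a \<cdot>\<^sub>m Y + b \<cdot>\<^sub>m Z" for a b
  have S: "S a b \<in> carrier_mat n n" "transpose_mat (S a b) = S a b" for a b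
  proof -
    show 1: "S a b \<in> carrier_mat n n" using Y Z by (simp add: S_def)
    show "transpose_mat (S a b) = S a b"
    proof (rule eq_matI)
      fix i j assume "i < dim_row (S a b)" "j < dim_col (S a b)"
      then have ij: "i < n" "j < n" using 1 by auto
      show "transpose_mat (S a b) $$ (i, j) = S a b $$ (i, j)"
        using ij Y Z symmetric_index[OF Y(2,1) ij] symmetric_index[OF Z(2,1) ij] by (simp add: S_def)
    qed (use 1 in auto)
  qed
  have JS: "J * S a b \<in> carrier_mat n n" for a b using J S(1) by (rule mult_carrier_mat)
  have JSi: "(J * S a b) $$ (i, j) = a * (J * Y) $$ (i, j) + b * (J * Z) $$ (i, j)" if ij: "i < n" "j < n" for a b i j
    unfolding index_mult_mat_sum[OF J S(1) ij] index_mult_mat_sum[OF J Y(1) ij] index_mult_mat_sum[OF J Z(1) ij]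
      sum_distrib_left sum.distrib[symmetric]
    using ij Y Z by (intro sum.cong refl) (simp add: S_def algebra_simps)
  have ck: "adj_mat (J * S a b - l \<cdot>\<^sub>m 1\<^sub>m n) \<noteq> 0\<^sub>m n n" if "a \<noteq> 0 \<or> b \<noteq> 0" for a b l
  proof (rule corank_shift[OF n X(1) J XJ S(1)])
    have "S a b - l \<cdot>\<^sub>m X = net_point X Y Z (- l) a b"
      using X Y Z by (intro eq_matI) (auto simp: S_def net_point_def)
    then show "adj_mat (S a b - l \<cdot>\<^sub>m X) \<noteq> 0\<^sub>m n n" using cork[of "- l" a b] that by auto
  qed
  have mom: "mat_pairing n W (moment_mat J (S a b) k) = 0" for a b k
  proof (rule moments_vanish[OF n X(1) J JX XJ S(1) W(1)])
    fix c d
    have "c \<cdot>\<^sub>m X + d \<cdot>\<^sub>m S a b = net_point X Y Z c (d * a) (d * b)"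
      using X Y Z by (intro eq_matI) (auto simp: S_def net_point_def algebra_simps)
    then show "mat_pairing n W (adj_mat (c \<cdot>\<^sub>m X + d \<cdot>\<^sub>m S a b)) = 0" using apolar by simp
  qed
  define w where "w = sym_coords n W"
  have w: "w \<in> carrier_vec ?m" by (simp add: w_def sym_coords_def)
  define P where "P a b = skew_op n (J * S a b)" for a b
  define C where "C a b = diag_op n (conj_moments J (S a b))" for a b
  have P: "P a b \<in> carrier_mat ?m ?m" and C: "C a b \<in> carrier_mat ?m ?m" for a b
    unfolding P_def C_def by (rule skew_op_carrier diag_op_carrier)+
  have dnz: "det (P a b + C a b) \<noteq> 0" if "a \<noteq> 0 \<or> b \<noteq> 0" for a b
    unfolding P_def C_def by (rule det_skew_diag_op[OF J Js X(1) JX S ck[OF that]])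
  have C0: "C a b *\<^sub>v v = 0\<^sub>v ?m" if v: "v \<in> carrier_vec ?m" "\<And>k. k < n \<Longrightarrow> v $ pair_index k k = 0" for a b v
  proof (rule eq_vecI)
    fix r assume "r < dim_vec (0\<^sub>v ?m :: complex vec)"
    then have r: "r < ?m" by simp
    then obtain i j where ij: "i \<le> j" "j < n" "pair_index i j = r" by (rule upper_pairs_nthE)
    have "(C a b *\<^sub>v v) $ pair_index i j = (\<Sum>k<n. conj_moments J (S a b) k $$ (i, j) * v $ pair_index k k)"
      unfolding C_def by (rule diag_op_mult_vec[OF v(1) ij(1,2)])
    also have "\<dots> = 0" by (intro sum.neutral) (simp add: v(2))
    finally show "(C a b *\<^sub>v v) $ r = 0\<^sub>v ?m $ r" using ij r by simp
  qed (use C[of a b] in simp)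
  \<comment> \<open>\<open>v\<close> encodes a skew-symmetric matrix (its entries at the pairs \<open>(k, k)\<close> are zero) that
    solves the system at \<open>(a, b)\<close>\<close>
  define good where "good a b v \<longleftrightarrow> v \<in> carrier_vec ?m \<and> (\<forall>k<n. v $ pair_index k k = 0) \<and> P a b *\<^sub>v v = w" for a b v
  have ex: "\<exists>v. good a b v" if ab: "a \<noteq> 0 \<or> b \<noteq> 0" for a b
  proof -
    have A: "P a b + C a b \<in> carrier_mat ?m ?m" using P[of a b] C[of a b] by simp
    obtain v where v: "v \<in> carrier_vec ?m" "(P a b + C a b) *\<^sub>v v = w" using solution_exists[OF A dnz[OF ab] w] by blast
    have d: "v $ pair_index k k = 0" if "k < n" for k
      by (rule diag_part_vanishes[OF J Js X(1) JX S ck[OF ab] W mom v(1) _ that]) (use v(2) in \<open>simp add: P_def C_def w_def\<close>)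
    have "P a b *\<^sub>v v + C a b *\<^sub>v v = w" using v add_mult_distrib_mat_vec[OF P C v(1)] by simp
    moreover have "P a b *\<^sub>v v \<in> carrier_vec ?m" by (rule mult_mat_vec_carrier[OF P v(1)])
    ultimately have "P a b *\<^sub>v v = w" using C0[OF v(1) d] by simp
    then show ?thesis using v d by (auto simp: good_def)
  qed
  \<comment> \<open>a solution also solves the system that is regularized at any other point\<close>
  have full: "(P a' b' + C a b) *\<^sub>v v = w" if "good a' b' v" for a b a' b' v
    using that add_mult_distrib_mat_vec[OF P C, of v a' b' a b] C0[of v a b] w by (simp add: good_def)
  have uniq: "v = v'" if "a \<noteq> 0 \<or> b \<noteq> 0" "good a b v" "good a b v'" for a b v v'
  proof (rule unique_solution[OF _ dnz[OF that(1)]])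
    show "P a b + C a b \<in> carrier_mat ?m ?m" using P[of a b] C[of a b] by simp
    show "(P a b + C a b) *\<^sub>v v = (P a b + C a b) *\<^sub>v v'" using full[OF that(2)] full[OF that(3)] by simp
  qed (use that(2,3) in \<open>auto simp: good_def\<close>)
  define sol where "sol a b = (if a \<noteq> 0 \<or> b \<noteq> 0 then SOME v. good a b v else 0\<^sub>v ?m)" for a b
  have sol: "good a b (sol a b)" if "a \<noteq> 0 \<or> b \<noteq> 0" for a b
    using that someI_ex[OF ex[OF that]] by (simp add: sol_def)
  have Plin: "a \<cdot>\<^sub>m P 1 0 + b \<cdot>\<^sub>m P 0 1 = P a b" for a b
    unfolding P_def by (rule skew_op_add_smult[OF JS JS JS]) (simp add: JSi)
  have Pscale: "t \<cdot>\<^sub>m P a b = P (t * a) (t * b)" for t a b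
  proof -
    have "t \<cdot>\<^sub>m P a b + 0 \<cdot>\<^sub>m P a b = P (t * a) (t * b)"
      unfolding P_def by (rule skew_op_add_smult[OF JS JS JS]) (simp add: JSi algebra_simps)
    moreover have "t \<cdot>\<^sub>m P a b + 0 \<cdot>\<^sub>m P a b = t \<cdot>\<^sub>m P a b" using P[of a b] by (intro eq_matI) auto
    ultimately show ?thesis by simp
  qed
  have "w = 0\<^sub>v ?m"
  proof (rule homogeneous_solution_trivial[of sol])
    show "sol a b \<in> carrier_vec ?m" for a b
      using sol[of a b] by (cases "a \<noteq> 0 \<or> b \<noteq> 0") (auto simp: good_def sol_def)
    show "w \<in> carrier_vec ?m" by (rule w)
    fix t a b :: complex assume t: "t \<noteq> 0" and ab: "a \<noteq> 0 \<or> b \<noteq> 0"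
    have g: "sol a b \<in> carrier_vec ?m" "\<And>k. k < n \<Longrightarrow> sol a b $ pair_index k k = 0" "P a b *\<^sub>v sol a b = w"
      using sol[OF ab] by (auto simp: good_def)
    have isv: "inverse t \<cdot>\<^sub>v sol a b \<in> carrier_vec ?m" using g by simp
    have "P (t * a) (t * b) *\<^sub>v (inverse t \<cdot>\<^sub>v sol a b) = w"
    proof (rule eq_vecI)
      fix r assume "r < dim_vec w"
      then have r: "r < ?m" using w by simp
      have "(P (t * a) (t * b) *\<^sub>v (inverse t \<cdot>\<^sub>v sol a b)) $ r = (\<Sum>s<?m. P (t * a) (t * b) $$ (r, s) * (inverse t \<cdot>\<^sub>v sol a b) $ s)"
        by (rule index_mult_mat_vec_sum[OF P isv r])
      also have "\<dots> = (\<Sum>s<?m. P a b $$ (r, s) * sol a b $ s)"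
        unfolding Pscale[symmetric] using P[of a b] g(1) r t by (intro sum.cong refl) simp
      also have "\<dots> = (P a b *\<^sub>v sol a b) $ r" by (rule index_mult_mat_vec_sum[OF P g(1) r, symmetric])
      finally show "(P (t * a) (t * b) *\<^sub>v (inverse t \<cdot>\<^sub>v sol a b)) $ r = w $ r" unfolding g(3) .
    qed (use P[of "t * a" "t * b"] w in auto)
    moreover have "(inverse t \<cdot>\<^sub>v sol a b) $ pair_index k k = 0" if "k < n" for k
      using g(1) g(2)[OF that] pair_index_less'[OF that that] by simp
    ultimately have "good (t * a) (t * b) (inverse t \<cdot>\<^sub>v sol a b)" using isv by (simp add: good_def)
    moreover have "t * a \<noteq> 0 \<or> t * b \<noteq> 0" using t ab by auto
    ultimately show "sol (t * a) (t * b) = inverse t \<cdot>\<^sub>v sol a b" using uniq sol by blast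
  next
    fix a0 b0 :: complex assume ab: "a0 \<noteq> 0 \<or> b0 \<noteq> 0"
    show "\<exists>P\<in>carrier_mat ?m ?m. \<exists>Q\<in>carrier_mat ?m ?m. \<exists>R\<in>carrier_mat ?m ?m. det (a0 \<cdot>\<^sub>m P + b0 \<cdot>\<^sub>m Q + R) \<noteq> 0 \<and>
        (\<forall>a b. a \<noteq> 0 \<or> b \<noteq> 0 \<longrightarrow> (a \<cdot>\<^sub>m P + b \<cdot>\<^sub>m Q + R) *\<^sub>v sol a b = w)"
      by (intro bexI[of _ "P 1 0"] bexI[of _ "P 0 1"] bexI[of _ "C a0 b0"] P C)
        (auto simp only: Plin intro!: dnz[OF ab] full sol)
  qed
  then show ?thesis using sym_coords_eq_0_imp[OF W] by (simp add: w_def)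
qed

section \<open>Deformation to nets with a nonsingular member\<close>

text \<open>Let \<open>m\<close> be the minimum of \<open>|f(s, 0)|\<close> on the circle \<open>|s| = r\<close>. For small \<open>t \<noteq> 0\<close> we have
  \<open>|f(s, t)| \<ge> m/2\<close> on that circle and \<open>f(_, t)\<close> has no zero inside, so the maximum principle for
  the inverse gives \<open>|f(0, t)| \<ge> m/2\<close>, which excludes \<open>f(0, 0) = 0\<close> by continuity.\<close>

lemma no_isolated_zero:
  fixes f :: "complex \<Rightarrow> complex \<Rightarrow> complex"
  assumes cont: "continuous_on UNIV (\<lambda>(s, t). f s t)" and hol: "\<And>t. (\<lambda>s. f s t) holomorphic_on UNIV"
    and r: "0 < r" and nz: "\<And>s t. norm s \<le> r \<Longrightarrow> norm t \<le> r \<Longrightarrow> s \<noteq> 0 \<or> t \<noteq> 0 \<Longrightarrow> f s t \<noteq> 0"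
  shows "f 0 0 \<noteq> 0"
proof
  assume f0: "f 0 0 = 0"
  let ?C = "sphere (0::complex) r"
  have ne: "?C \<noteq> {}" using r by simp
  have cont_norm: "continuous_on UNIV (\<lambda>p. norm (f (fst p) (snd p)))"
    using cont by (intro continuous_intros) (simp add: case_prod_unfold)
  have c: "continuous_on ?C (\<lambda>s. (s, 0 :: complex))" by (intro continuous_intros)
  have "continuous_on ?C (\<lambda>s. norm (f (fst (s, 0 :: complex)) (snd (s, 0 :: complex))))"
    by (rule continuous_on_compose2[OF cont_norm c]) auto
  then have "continuous_on ?C (\<lambda>s. norm (f s 0))" by simp
  then obtain s0 where s0: "s0 \<in> ?C" "\<And>s. s \<in> ?C \<Longrightarrow> norm (f s0 0) \<le> norm (f s 0)"
    using continuous_attains_inf[of ?C "\<lambda>s. norm (f s 0)"] ne compact_sphere by blast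
  define m where "m = norm (f s0 0)"
  have ns: "norm s0 = r" using s0(1) by simp
  have "f s0 0 \<noteq> 0"
  proof (rule nz)
    have "s0 \<noteq> 0"
    proof
      assume "s0 = 0"
      then have "norm s0 = 0" by simp
      with ns r show False by linarith
    qed
    then show "s0 \<noteq> 0 \<or> (0::complex) \<noteq> 0" by (rule disjI1)
    show "norm s0 \<le> r" using ns by (rule eq_refl)
    show "norm (0::complex) \<le> r" using r by simp
  qed
  then have m: "0 < m" unfolding m_def by simp
  have uc: "uniformly_continuous_on (cball 0 r \<times> cball 0 r) (\<lambda>p. norm (f (fst p) (snd p)))"
    by (rule compact_uniformly_continuous[OF continuous_on_subset[OF cont_norm]]) (auto intro: compact_Times)
  then obtain d where d: "0 < d" "\<And>p q. p \<in> cball 0 r \<times> cball 0 r \<Longrightarrow> q \<in> cball 0 r \<times> cball 0 r \<Longrightarrow> dist q p < d \<Longrightarrow>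
      dist (norm (f (fst q) (snd q))) (norm (f (fst p) (snd p))) < m / 2"
    using uc[unfolded uniformly_continuous_on_def, rule_format, OF half_gt_zero[OF m]] by blast
  define t where "t = complex_of_real (min r (d / 2))"
  have t: "t \<noteq> 0" "norm t \<le> r" "norm t < d" using r d(1) by (auto simp: t_def min_def)
  have near: "\<bar>norm (f s t) - norm (f s 0)\<bar> < m / 2" if "norm s \<le> r" for s
    using d(2)[of "(s, 0)" "(s, t)"] that t r by (simp add: dist_Pair_Pair dist_norm dist_real_def)
  have "norm (inverse (f 0 t)) \<le> 2 / m"
  proof (rule maximum_modulus_frontier[of "\<lambda>s. inverse (f s t)" "ball 0 r"])
    have nz': "f s t \<noteq> 0" if "s \<in> cball 0 r" for s using nz[of s t] that t by simp
    show "(\<lambda>s. inverse (f s t)) holomorphic_on interior (ball 0 r)"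
      using nz' by (intro holomorphic_intros holomorphic_on_subset[OF hol]) auto
    show "continuous_on (closure (ball 0 r)) (\<lambda>s. inverse (f s t))"
      using nz' r by (intro continuous_intros continuous_on_subset[OF holomorphic_on_imp_continuous_on[OF hol]]) auto
    show "norm (inverse (f z t)) \<le> 2 / m" if "z \<in> frontier (ball 0 r)" for z
    proof -
      have z: "z \<in> ?C" using that r by simp
      then have "m \<le> norm (f z 0)" using s0(2) by (simp add: m_def)
      moreover have "norm z \<le> r" using z by simp
      ultimately have "m / 2 \<le> norm (f z t)" using near[of z, unfolded abs_less_iff] by linarith
      then have "inverse (norm (f z t)) \<le> inverse (m / 2)" using m by (intro le_imp_inverse_le) auto
      then show ?thesis by (simp add: norm_inverse)
    qed
  qed (use r in auto)
  moreover have "norm (f 0 t) < m / 2" using near[of 0] r f0 by simp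
  moreover have "0 < norm (f 0 t)" using nz[of 0 t] t r by simp
  ultimately have "inverse (m / 2) < inverse (norm (f 0 t))" "inverse (norm (f 0 t)) \<le> 2 / m"
    by (auto intro: less_imp_inverse_less simp: norm_inverse simp del: inverse_divide inverse_less_iff_less)
  moreover have "inverse (m / 2) = 2 / m" by simp
  ultimately show False by linarith
qed

lemma adj_mat_smult_eq_0:
  fixes A :: "'a::field mat"
  assumes A: "A \<in> carrier_mat n n" and n: "0 < n" and adj: "adj_mat A = 0\<^sub>m n n"
  shows "adj_mat (c \<cdot>\<^sub>m A) = 0\<^sub>m n n"
proof -
  obtain u w where u: "u \<in> carrier_vec n" "A *\<^sub>v u = 0\<^sub>v n" and w: "w \<in> carrier_vec n" "A *\<^sub>v w = 0\<^sub>v n"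
    and ind: "\<And>a b. (\<forall>i<n. a * u $ i + b * w $ i = 0) \<Longrightarrow> a = 0 \<and> b = 0"
    using two_kernel_vectors_if_adj_mat_eq_0[OF A n adj] by blast
  have cA: "c \<cdot>\<^sub>m A \<in> carrier_mat n n" using A by simp
  have K: "(c \<cdot>\<^sub>m A) *\<^sub>v y = 0\<^sub>v n" if y: "y \<in> carrier_vec n" "A *\<^sub>v y = 0\<^sub>v n" for y
  proof (rule eq_vecI)
    fix r assume "r < dim_vec (0\<^sub>v n :: 'a vec)"
    then have r: "r < n" by simp
    have "((c \<cdot>\<^sub>m A) *\<^sub>v y) $ r = (\<Sum>l<n. c * (A $$ (r, l) * y $ l))"
      unfolding index_mult_mat_vec_sum[OF cA y(1) r] using A r by (intro sum.cong refl) simp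
    also have "\<dots> = c * (A *\<^sub>v y) $ r" by (simp add: index_mult_mat_vec_sum[OF A y(1) r] sum_distrib_left)
    finally show "((c \<cdot>\<^sub>m A) *\<^sub>v y) $ r = 0\<^sub>v n $ r" using y(2) r by simp
  qed (use A in simp)
  show ?thesis by (rule adj_mat_eq_0_if_kernel[OF cA u(1) K[OF u] w(1) K[OF w] ind])
qed

definition shift_mat :: "nat \<Rightarrow> complex mat \<Rightarrow> complex \<Rightarrow> complex mat" where
  "shift_mat n X s = X + s \<cdot>\<^sub>m 1\<^sub>m n"

lemma shift_mat_carrier: "X \<in> carrier_mat n n \<Longrightarrow> shift_mat n X s \<in> carrier_mat n n"
  by (simp add: shift_mat_def)

lemma shift_mat_index: "X \<in> carrier_mat n n \<Longrightarrow> i < n \<Longrightarrow> j < n \<Longrightarrow> shift_mat n X s $$ (i, j) = X $$ (i, j) + s * (if i = j then 1 else 0)"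
  by (simp add: shift_mat_def)

lemma shift_mat_symmetric:
  assumes "X \<in> carrier_mat n n" "transpose_mat X = X"
  shows "transpose_mat (shift_mat n X s) = shift_mat n X s"
proof (rule eq_matI)
  fix i j assume "i < dim_row (shift_mat n X s)" "j < dim_col (shift_mat n X s)"
  then have ij: "i < n" "j < n" using shift_mat_carrier[OF assms(1), of s] by auto
  show "transpose_mat (shift_mat n X s) $$ (i, j) = shift_mat n X s $$ (i, j)"
    using ij symmetric_index[OF assms(2,1) ij]
    by (simp add: transpose_mat_index[OF shift_mat_carrier[OF assms(1)]] shift_mat_index[OF assms(1)])
qed (use shift_mat_carrier[OF assms(1), of s] in auto)

text \<open>The exceptional \<open>s\<close> are the negatives of the eigenvalues, so there are finitely many.\<close>

lemma shift_mat_nonsingular: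
  assumes X: "X \<in> carrier_mat n n"
  shows "\<exists>r>0. \<forall>s. s \<noteq> 0 \<and> norm s \<le> r \<longrightarrow> det (shift_mat n X s) \<noteq> 0"
proof -
  define E where "E = {s. det (shift_mat n X s) = 0}"
  have "E \<subseteq> uminus ` {x. poly (char_poly X) x = 0}"
  proof
    fix s assume "s \<in> E"
    then have "det (shift_mat n X s) = 0" by (simp add: E_def)
    then obtain v where v: "v \<in> carrier_vec n" "v \<noteq> 0\<^sub>v n" "shift_mat n X s *\<^sub>v v = 0\<^sub>v n"
      using det_0_iff_vec_prod_zero_field[OF shift_mat_carrier[OF X]] by blast
    have "shift_mat n X s *\<^sub>v v = X *\<^sub>v v + s \<cdot>\<^sub>v v"
      unfolding shift_mat_def smult_one_mult_vec[OF v(1), symmetric] by (rule add_mult_distrib_mat_vec[OF X _ v(1)]) simp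
    then have z: "X *\<^sub>v v + s \<cdot>\<^sub>v v = 0\<^sub>v n" using v(3) by simp
    have "X *\<^sub>v v = (- s) \<cdot>\<^sub>v v"
    proof (rule eq_vecI)
      fix i assume "i < dim_vec ((- s) \<cdot>\<^sub>v v)"
      then have i: "i < n" using v(1) by simp
      have "(X *\<^sub>v v) $ i + s * v $ i = 0" using arg_cong[OF z, of "\<lambda>x. x $ i"] i v(1) X by simp
      then show "(X *\<^sub>v v) $ i = ((- s) \<cdot>\<^sub>v v) $ i" using i v(1) by (simp add: eq_neg_iff_add_eq_0)
    qed (use X v in simp)
    then have "eigenvalue X (- s)" unfolding eigenvalue_def eigenvector_def using X v by auto
    then have "poly (char_poly X) (- s) = 0" using eigenvalue_root_char_poly[OF X] by simp
    then show "s \<in> uminus ` {x. poly (char_poly X) x = 0}" by (intro image_eqI[of _ _ "- s"]) auto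
  qed
  moreover have "char_poly X \<noteq> 0" using degree_monic_char_poly[OF X] by auto
  ultimately have "finite E" using poly_roots_finite finite_subset by blast
  then have "open (- (E - {0}))" by (intro open_Compl finite_imp_closed) simp
  then obtain e where e: "0 < e" "cball 0 e \<subseteq> - (E - {0})" by (meson ComplI Diff_iff insertI1 open_contains_cball)
  then show ?thesis by (intro exI[of _ e]) (auto simp: E_def subset_eq)
qed

text \<open>By homogeneity a point of corank 2 can be taken on the unit sphere, which is compact; so
  the parameters of the nets that have one form a closed set.\<close>

lemma corank_2_free_open:
  fixes X Y Z :: "complex mat"
  assumes n: "0 < n" and XYZ: "X \<in> carrier_mat n n" "Y \<in> carrier_mat n n" "Z \<in> carrier_mat n n"
    and cork: "\<And>a b c. a \<noteq> 0 \<or> b \<noteq> 0 \<or> c \<noteq> 0 \<Longrightarrow> adj_mat (net_point X Y Z a b c) \<noteq> 0\<^sub>m n n"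
  shows "\<exists>r>0. \<forall>s t. norm s \<le> r \<and> norm t \<le> r \<longrightarrow> (\<forall>a b c. a \<noteq> 0 \<or> b \<noteq> 0 \<or> c \<noteq> 0 \<longrightarrow>
      adj_mat (net_point (shift_mat n X s) (shift_mat n Y t) Z a b c) \<noteq> 0\<^sub>m n n)"
proof -
  define N where "N p = (case p of ((a, b, c), (s, t)) \<Rightarrow> net_point (shift_mat n X s) (shift_mat n Y t) Z a b c)"
    for p :: "(complex \<times> complex \<times> complex) \<times> (complex \<times> complex)"
  have N: "N p \<in> carrier_mat n n" for p
    using XYZ by (auto simp: N_def net_point_def shift_mat_def split: prod.splits)
  define G where "G p = (\<Sum>i<n. \<Sum>j<n. norm (adj_mat (N p) $$ (i, j)))" for p
  have ent: "(\<lambda>p. N p $$ (i, j)) = (\<lambda>p. fst (fst p) * (X $$ (i, j) + fst (snd p) * (if i = j then 1 else 0)) +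
      fst (snd (fst p)) * (Y $$ (i, j) + snd (snd p) * (if i = j then 1 else 0)) + snd (snd (fst p)) * Z $$ (i, j))"
    if "i < n" "j < n" for i j
    using that XYZ by (auto simp: N_def fun_eq_iff net_point_index[OF shift_mat_carrier shift_mat_carrier] shift_mat_index)
  have contG: "continuous_on UNIV G"
    unfolding G_def
  proof (intro continuous_intros)
    fix i j assume "i \<in> {..<n}" "j \<in> {..<n}"
    then have ij: "i < n" "j < n" by auto
    show "continuous_on UNIV (\<lambda>p. adj_mat (N p) $$ (i, j))"
      by (rule continuous_on_adj_mat[OF N _ ij]) (simp only: ent, intro continuous_intros)
  qed
  have G0: "G p = 0 \<longleftrightarrow> adj_mat (N p) = 0\<^sub>m n n" for p
  proof
    assume "G p = 0"
    then have "\<forall>i\<in>{..<n}. (\<Sum>j<n. norm (adj_mat (N p) $$ (i, j))) = 0"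
      unfolding G_def by (subst sum_nonneg_eq_0_iff[symmetric]) (auto intro: sum_nonneg)
    then have "adj_mat (N p) $$ (i, j) = 0" if "i < n" "j < n" for i j
      using that by (subst (asm) sum_nonneg_eq_0_iff) auto
    then show "adj_mat (N p) = 0\<^sub>m n n" using adj_mat(1)[OF N[of p]] by (intro eq_matI) auto
  qed (simp add: G_def)
  \<comment> \<open>unit vectors at which a nearby net has corank 2; the parameters of such nets are its
    image under the second projection\<close>
  define K where "K = {p \<in> sphere 0 1 \<times> cball 0 1. G p = 0}"
  have "closed {p. G p = 0}"
    by (rule closed_Collect_eq[OF contG continuous_on_const])
  then have "compact ((sphere 0 1 \<times> cball 0 1) \<inter> {p. G p = 0})" by (intro compact_Int_closed compact_Times) auto
  moreover have "K = (sphere 0 1 \<times> cball 0 1) \<inter> {p. G p = 0}" by (auto simp: K_def)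
  ultimately have "compact K" by simp
  then have "compact (snd ` K)" by (intro compact_continuous_image continuous_intros)
  then have "open (- (snd ` K))" by (intro open_Compl compact_imp_closed)
  moreover have "(0, 0) \<in> - (snd ` K)"
  proof -
    have False if pK: "p \<in> K" and p0: "snd p = (0, 0)" for p
    proof -
      obtain a b c where p: "p = ((a, b, c), (0, 0))" using p0 by (cases p) auto
      have "shift_mat n X 0 = X" "shift_mat n Y 0 = Y" using XYZ by (auto simp: shift_mat_def intro!: eq_matI)
      then have "adj_mat (net_point X Y Z a b c) = 0\<^sub>m n n" using pK G0[of p] by (simp add: K_def p N_def)
      moreover have "a \<noteq> 0 \<or> b \<noteq> 0 \<or> c \<noteq> 0" using pK by (auto simp: K_def p norm_Pair)
      ultimately show False using cork by blast
    qed
    then show ?thesis by fastforce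
  qed
  ultimately obtain e where e: "0 < e" "ball (0, 0) e \<subseteq> - (snd ` K)" by (meson openE)
  define r where "r = min (1 / 2) (e / 3)"
  have r: "0 < r" using e(1) by (simp add: r_def)
  have "adj_mat (net_point (shift_mat n X s) (shift_mat n Y t) Z a b c) \<noteq> 0\<^sub>m n n"
    if st: "norm s \<le> r" "norm t \<le> r" and abc: "a \<noteq> 0 \<or> b \<noteq> 0 \<or> c \<noteq> 0" for s t a b c
  proof
    assume 0: "adj_mat (net_point (shift_mat n X s) (shift_mat n Y t) Z a b c) = 0\<^sub>m n n"
    have nst: "norm (s, t) \<le> norm s + norm t" using norm_Pair_le by blast
    have rb: "r \<le> 1 / 2" "r \<le> e / 3" by (auto simp: r_def)
    have "dist (0, 0) (s, t) = norm (s, t)" by (simp add: zero_prod_def[symmetric])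
    moreover have "norm (s, t) < e" using nst st rb e(1) by linarith
    ultimately have inball: "(s, t) \<in> ball (0, 0) e" by simp
    have "norm (s, t) \<le> 1" using nst st rb by linarith
    \<comment> \<open>the factor that scales the point to the unit sphere\<close>
    define k where "k = complex_of_real (inverse (norm (a, b, c)))"
    have nabc: "norm (a, b, c) \<noteq> 0" using abc by (auto simp: zero_prod_def)
    have unit: "norm (k * a, k * b, k * c) = 1"
    proof -
      have "(k * a, k * b, k * c) = inverse (norm (a, b, c)) *\<^sub>R (a, b, c)"
        by (simp add: k_def scaleR_prod_def scaleR_conv_of_real)
      then show ?thesis using nabc by (simp only: norm_scaleR) simp
    qed
    have "net_point (shift_mat n X s) (shift_mat n Y t) Z (k * a) (k * b) (k * c) = k \<cdot>\<^sub>m net_point (shift_mat n X s) (shift_mat n Y t) Z a b c"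
      using XYZ by (intro eq_matI) (auto simp: net_point_def shift_mat_def algebra_simps)
    moreover have "adj_mat (k \<cdot>\<^sub>m net_point (shift_mat n X s) (shift_mat n Y t) Z a b c) = 0\<^sub>m n n"
      by (rule adj_mat_smult_eq_0[OF net_point_carrier n 0]) (use XYZ in \<open>auto intro: shift_mat_carrier\<close>)
    ultimately have "G ((k * a, k * b, k * c), (s, t)) = 0" unfolding G0 by (simp add: N_def)
    then have "((k * a, k * b, k * c), (s, t)) \<in> K" using unit \<open>norm (s, t) \<le> 1\<close> by (simp add: K_def)
    then have "(s, t) \<in> snd ` K" by force
    then show False using inball e(2) by blast
  qed
  then show ?thesis using r by blast
qed

section \<open>The zeros of the Chow determinant\<close>

lemma net_point_symmetric:
  fixes X Y Z :: "complex mat"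
  assumes X: "X \<in> carrier_mat n n" "transpose_mat X = X" and Y: "Y \<in> carrier_mat n n" "transpose_mat Y = Y"
    and Z: "Z \<in> carrier_mat n n" "transpose_mat Z = Z"
  shows "transpose_mat (net_point X Y Z a b c) = net_point X Y Z a b c"
proof (rule eq_matI)
  have N: "net_point X Y Z a b c \<in> carrier_mat n n" by (rule net_point_carrier[OF X(1) Y(1) Z(1)])
  fix i j assume "i < dim_row (net_point X Y Z a b c)" "j < dim_col (net_point X Y Z a b c)"
  then have ij: "i < n" "j < n" using N by auto
  show "transpose_mat (net_point X Y Z a b c) $$ (i, j) = net_point X Y Z a b c $$ (i, j)"
    using ij symmetric_index[OF X(2,1) ij] symmetric_index[OF Y(2,1) ij] symmetric_index[OF Z(2,1) ij]
    by (simp add: transpose_mat_index[OF N] net_point_index[OF X(1) Y(1) Z(1)])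
qed (use net_point_carrier[OF X(1) Y(1) Z(1), of a b c] in auto)

lemma sum_symmetric_square:
  fixes f :: "nat \<Rightarrow> nat \<Rightarrow> complex"
  assumes "\<And>i j. f i j = f j i"
  shows "(\<Sum>i<n. \<Sum>j<n. f i j) = (\<Sum>j<n. \<Sum>i<Suc j. if i = j then f i j else 2 * f i j)"
proof (induction n)
  case (Suc n)
  have "(\<Sum>i<Suc n. \<Sum>j<Suc n. f i j) = (\<Sum>i<n. \<Sum>j<n. f i j) + (\<Sum>i<n. f i n) + (\<Sum>j<n. f n j) + f n n"
    by (simp add: sum.distrib)
  also have "(\<Sum>j<n. f n j) = (\<Sum>i<n. f i n)" using assms by (intro sum.cong refl)
  finally have "(\<Sum>i<Suc n. \<Sum>j<Suc n. f i j) = (\<Sum>i<n. \<Sum>j<n. f i j) + ((\<Sum>i<n. 2 * f i n) + f n n)"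
    by (simp add: sum_distrib_left[symmetric])
  also have "(\<Sum>i<n. 2 * f i n) + f n n = (\<Sum>i<Suc n. if i = n then f i n else 2 * f i n)" by simp
  finally show ?case using Suc by simp
qed simp

text \<open>A left kernel vector \<open>u\<close> of the Chow matrix is orthogonal to all vectors of upper
  triangular entries of \<open>adj N\<close>, for \<open>N\<close> in the net. Halving its entries off the diagonal turns
  this into orthogonality of symmetric matrices.\<close>

lemma apolar_matrix_if_det_chow_mat_eq_0:
  fixes X Y Z :: "complex mat"
  assumes n: "1 \<le> n" and X: "X \<in> carrier_mat n n" "transpose_mat X = X" and Y: "Y \<in> carrier_mat n n" "transpose_mat Y = Y"
    and Z: "Z \<in> carrier_mat n n" "transpose_mat Z = Z" and det: "det (chow_mat n X Y Z) = 0"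
  shows "\<exists>W. W \<in> carrier_mat n n \<and> transpose_mat W = W \<and> W \<noteq> 0\<^sub>m n n \<and>
    (\<forall>a b c. mat_pairing n W (adj_mat (net_point X Y Z a b c)) = 0)"
proof -
  let ?m = "(n + 1) choose 2" and ?C = "chow_mat n X Y Z"
  have C: "?C \<in> carrier_mat ?m ?m" by (rule chow_mat_carrier)
  have Ct: "transpose_mat ?C \<in> carrier_mat ?m ?m" using C by simp
  have "det (transpose_mat ?C) = 0" using det det_transpose[OF C] by simp
  then obtain u where u: "u \<in> carrier_vec ?m" "u \<noteq> 0\<^sub>v ?m" "transpose_mat ?C *\<^sub>v u = 0\<^sub>v ?m"
    using det_0_iff_vec_prod_zero_field[OF Ct] by blast
  define W where "W = mat n n (\<lambda>(i, j). if i = j then u $ pair_index i j else u $ pair_index i j / 2)"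
  have W: "W \<in> carrier_mat n n" by (simp add: W_def)
  have Wi: "W $$ (i, j) = (if i = j then u $ pair_index i j else u $ pair_index i j / 2)" if "i < n" "j < n" for i j
    using that by (simp add: W_def)
  have "transpose_mat W = W"
    by (rule eq_matI) (auto simp: W_def pair_index_commute)
  moreover have "W \<noteq> 0\<^sub>m n n"
  proof
    assume W0: "W = 0\<^sub>m n n"
    have "u $ r = 0" if r: "r < ?m" for r
    proof -
      obtain i j where ij: "i \<le> j" "j < n" "pair_index i j = r" using r by (rule upper_pairs_nthE)
      then have i: "i < n" by simp
      have "W $$ (i, j) = 0" unfolding W0 using i ij by simp
      then show ?thesis using Wi[OF i ij(2)] ij(3) by (auto split: if_splits)
    qed
    then have "u = 0\<^sub>v ?m" using u(1) by (intro eq_vecI) auto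
    then show False using u(2) by simp
  qed
  moreover have "mat_pairing n W (adj_mat (net_point X Y Z a b c)) = 0" for a b c
  proof -
    let ?N = "net_point X Y Z a b c"
    have N: "?N \<in> carrier_mat n n" by (rule net_point_carrier[OF X(1) Y(1) Z(1)])
    define A where "A = adj_mat ?N"
    have A: "A \<in> carrier_mat n n" unfolding A_def by (rule adj_mat(1)[OF N])
    have "transpose_mat ?N = ?N" by (rule net_point_symmetric[OF X Y Z])
    then have At: "transpose_mat A = A" unfolding A_def using adj_mat_transpose[OF N] by simp
    define f where "f i j = (if i < n \<and> j < n then W $$ (i, j) * A $$ (i, j) else 0)" for i j
    have fsym: "f i j = f j i" for i j
      using symmetric_index[OF At A, of i j] by (auto simp: f_def Wi pair_index_commute)
    have "mat_pairing n W A = (\<Sum>i<n. \<Sum>j<n. f i j)"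
      unfolding mat_pairing_def by (intro sum.cong refl) (simp add: f_def)
    also have "\<dots> = (\<Sum>j<n. \<Sum>i<Suc j. if i = j then f i j else 2 * f i j)" by (rule sum_symmetric_square[OF fsym])
    also have "\<dots> = (\<Sum>j<n. \<Sum>i<Suc j. u $ pair_index i j * A $$ (i, j))"
      by (intro sum.cong refl) (auto simp: f_def Wi)
    also have "\<dots> = (\<Sum>r<?m. case upper_pairs n ! r of (i, j) \<Rightarrow> u $ pair_index i j * A $$ (i, j))"
      by (rule sum_upper_pairs[symmetric])
    also have "\<dots> = (\<Sum>r<?m. u $ r * (?C *\<^sub>v monom_vec n a b c) $ r)"
    proof (intro sum.cong refl)
      fix r assume "r \<in> {..<?m}"
      then have r: "r < ?m" by simp
      obtain i j where ij: "upper_pairs n ! r = (i, j)" "i \<le> j" "j < n" "pair_index i j = r" using r by (rule upper_pairs_nthE)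
      show "(case upper_pairs n ! r of (i, j) \<Rightarrow> u $ pair_index i j * A $$ (i, j)) = u $ r * (?C *\<^sub>v monom_vec n a b c) $ r"
        unfolding chow_mat_mult_monom_vec[OF X(1) Y(1) Z(1) n] using r ij by (simp add: sym_coords_def A_def)
    qed
    also have "\<dots> = (\<Sum>r<?m. \<Sum>s<?m. u $ r * (?C $$ (r, s) * monom_vec n a b c $ s))"
    proof (intro sum.cong refl)
      fix r assume "r \<in> {..<?m}"
      then have r: "r < ?m" by simp
      have mv: "monom_vec n a b c \<in> carrier_vec ?m" by (simp add: monom_vec_def)
      show "u $ r * (?C *\<^sub>v monom_vec n a b c) $ r = (\<Sum>s<?m. u $ r * (?C $$ (r, s) * monom_vec n a b c $ s))"
        unfolding index_mult_mat_vec_sum[OF C mv r] by (rule sum_distrib_left)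
    qed
    also have "\<dots> = (\<Sum>s<?m. \<Sum>r<?m. u $ r * (?C $$ (r, s) * monom_vec n a b c $ s))" by (rule sum.swap)
    also have "\<dots> = (\<Sum>s<?m. (transpose_mat ?C *\<^sub>v u) $ s * monom_vec n a b c $ s)"
    proof (intro sum.cong refl)
      fix s assume "s \<in> {..<?m}"
      then have s: "s < ?m" by simp
      have "(transpose_mat ?C *\<^sub>v u) $ s = (\<Sum>r<?m. ?C $$ (r, s) * u $ r)"
        unfolding index_mult_mat_vec_sum[OF Ct u(1) s] using s by (intro sum.cong refl) (simp add: transpose_mat_index[OF C])
      then show "(\<Sum>r<?m. u $ r * (?C $$ (r, s) * monom_vec n a b c $ s)) = (transpose_mat ?C *\<^sub>v u) $ s * monom_vec n a b c $ s"
        by (simp add: sum_distrib_left mult_ac)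
    qed
    also have "\<dots> = 0" unfolding u(3) by (intro sum.neutral) simp
    finally show ?thesis by (simp add: A_def)
  qed
  ultimately show ?thesis using W by blast
qed

text \<open>The Chow matrix times \<open>node_mat\<close>: its entries are values instead of coefficients of the
  adjugate. This makes the dependence on the net visibly continuous and holomorphic.\<close>

definition node_values :: "nat \<Rightarrow> complex mat \<Rightarrow> complex mat \<Rightarrow> complex mat \<Rightarrow> complex mat" where
  "node_values n X Y Z = mat ((n + 1) choose 2) ((n + 1) choose 2)
     (\<lambda>(r, q). adj_mat (net_point X Y Z 1 (2 ^ q) (2 ^ (q * n))) $$ (upper_pairs n ! r))"

lemma chow_mat_mult_node_mat:
  assumes XYZ: "X \<in> carrier_mat n n" "Y \<in> carrier_mat n n" "Z \<in> carrier_mat n n" and n: "1 \<le> n"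
  shows "chow_mat n X Y Z * node_mat n = node_values n X Y Z"
proof (rule eq_matI)
  let ?m = "(n + 1) choose 2"
  have E: "node_mat n \<in> carrier_mat ?m ?m" by (simp add: node_mat_def)
  fix r q assume "r < dim_row (node_values n X Y Z)" "q < dim_col (node_values n X Y Z)"
  then have rq: "r < ?m" "q < ?m" by (auto simp: node_values_def)
  have mv: "monom_vec n 1 (2 ^ q) (2 ^ (q * n)) \<in> carrier_vec ?m" by (simp add: monom_vec_def)
  have "(chow_mat n X Y Z * node_mat n) $$ (r, q) = (chow_mat n X Y Z *\<^sub>v monom_vec n 1 (2 ^ q) (2 ^ (q * n))) $ r"
    unfolding index_mult_mat_sum[OF chow_mat_carrier E rq] index_mult_mat_vec_sum[OF chow_mat_carrier mv rq(1)]
    using rq by (intro sum.cong refl) (simp add: node_mat_def)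
  also have "\<dots> = node_values n X Y Z $$ (r, q)"
    unfolding chow_mat_mult_monom_vec[OF XYZ n] using rq by (simp add: sym_coords_def node_values_def)
  finally show "(chow_mat n X Y Z * node_mat n) $$ (r, q) = node_values n X Y Z $$ (r, q)" .
qed (auto simp: chow_mat_def node_mat_def node_values_def)

lemma det_chow_mat_eq_node_values:
  assumes XYZ: "X \<in> carrier_mat n n" "Y \<in> carrier_mat n n" "Z \<in> carrier_mat n n" and n: "1 \<le> n"
  shows "det (chow_mat n X Y Z) = det (node_values n X Y Z) / det (node_mat n)"
proof -
  have E: "node_mat n \<in> carrier_mat ((n + 1) choose 2) ((n + 1) choose 2)" by (simp add: node_mat_def)
  show ?thesis using det_mult[OF chow_mat_carrier E, of X Y Z] det_node_mat[OF n]
    by (simp add: chow_mat_mult_node_mat[OF XYZ n] field_simps)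
qed

lemma det_chow_mat_nonzero_if_det_nonzero:
  fixes X Y Z :: "complex mat"
  assumes n: "1 \<le> n" and X: "X \<in> carrier_mat n n" "transpose_mat X = X" and Y: "Y \<in> carrier_mat n n" "transpose_mat Y = Y"
    and Z: "Z \<in> carrier_mat n n" "transpose_mat Z = Z" and d: "det X \<noteq> 0 \<or> det Y \<noteq> 0"
    and cork: "\<And>a b c. a \<noteq> 0 \<or> b \<noteq> 0 \<or> c \<noteq> 0 \<Longrightarrow> adj_mat (net_point X Y Z a b c) \<noteq> 0\<^sub>m n n"
  shows "det (chow_mat n X Y Z) \<noteq> 0"
proof
  assume "det (chow_mat n X Y Z) = 0"
  then obtain W where W: "W \<in> carrier_mat n n" "transpose_mat W = W" "W \<noteq> 0\<^sub>m n n"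
    "\<And>a b c. mat_pairing n W (adj_mat (net_point X Y Z a b c)) = 0"
    using apolar_matrix_if_det_chow_mat_eq_0[OF n X Y Z] by blast
  have n0: "0 < n" using n by simp
  have swap: "net_point Y X Z a b c = net_point X Y Z b a c" for a b c
    using X Y Z by (intro eq_matI) (auto simp: net_point_def algebra_simps)
  have "W = 0\<^sub>m n n"
  proof (cases "det X = 0")
    case False
    then show ?thesis by (rule apolar_matrix_eq_0[OF n0 X Y Z _ cork W(1,2,4)])
  next
    case True
    then have dY: "det Y \<noteq> 0" using d by simp
    show ?thesis by (rule apolar_matrix_eq_0[OF n0 Y X Z dY _ W(1,2)]) (auto simp: swap W(4) cork)
  qed
  then show False using W(3) by simp
qed

text \<open>If no nonzero point of the net has corank 2, the same holds for the net of \<open>X + s\<close>, \<open>Y + t\<close>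
  and \<open>Z\<close> with \<open>s\<close>, \<open>t\<close> small. If \<open>(s, t) \<noteq> 0\<close> is small, then \<open>X + s\<close> or \<open>Y + t\<close> is nonsingular
  and the Chow determinant is nonzero. So a zero at \<open>s = t = 0\<close> would be isolated. Two parameters
  are used because a zero of a function of one variable may be isolated.\<close>

theorem det_chow_mat_eq_0_iff:
  fixes X Y Z :: "complex mat"
  assumes n: "1 \<le> n" and X: "X \<in> carrier_mat n n" "transpose_mat X = X" and Y: "Y \<in> carrier_mat n n" "transpose_mat Y = Y"
    and Z: "Z \<in> carrier_mat n n" "transpose_mat Z = Z"
  shows "det (chow_mat n X Y Z) = 0 \<longleftrightarrow> (\<exists>a b c. (a \<noteq> 0 \<or> b \<noteq> 0 \<or> c \<noteq> 0) \<and> adj_mat (net_point X Y Z a b c) = 0\<^sub>m n n)"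
proof
  assume "\<exists>a b c. (a \<noteq> 0 \<or> b \<noteq> 0 \<or> c \<noteq> 0) \<and> adj_mat (net_point X Y Z a b c) = 0\<^sub>m n n"
  then show "det (chow_mat n X Y Z) = 0" using det_chow_mat_eq_0_if_corank_2[OF X(1) Y(1) Z(1) n] by blast
next
  assume det0: "det (chow_mat n X Y Z) = 0"
  show "\<exists>a b c. (a \<noteq> 0 \<or> b \<noteq> 0 \<or> c \<noteq> 0) \<and> adj_mat (net_point X Y Z a b c) = 0\<^sub>m n n"
  proof (rule ccontr)
    assume neg: "\<not> ?thesis"
    have n0: "0 < n" using n by simp
    let ?m = "(n + 1) choose 2"
    have "\<exists>r>0. \<forall>s t. norm s \<le> r \<and> norm t \<le> r \<longrightarrow> (\<forall>a b c. a \<noteq> 0 \<or> b \<noteq> 0 \<or> c \<noteq> 0 \<longrightarrow>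
      adj_mat (net_point (shift_mat n X s) (shift_mat n Y t) Z a b c) \<noteq> 0\<^sub>m n n)"
    proof (rule corank_2_free_open[OF n0 X(1) Y(1) Z(1)])
      fix a b c :: complex assume "a \<noteq> 0 \<or> b \<noteq> 0 \<or> c \<noteq> 0"
      then show "adj_mat (net_point X Y Z a b c) \<noteq> 0\<^sub>m n n" using neg by blast
    qed
    then obtain r0 where r0: "0 < r0" "\<forall>s t. norm s \<le> r0 \<and> norm t \<le> r0 \<longrightarrow> (\<forall>a b c. a \<noteq> 0 \<or> b \<noteq> 0 \<or> c \<noteq> 0 \<longrightarrow>
      adj_mat (net_point (shift_mat n X s) (shift_mat n Y t) Z a b c) \<noteq> 0\<^sub>m n n)" by (elim exE conjE)
    obtain rX where rX: "0 < rX" "\<And>s. s \<noteq> 0 \<Longrightarrow> norm s \<le> rX \<Longrightarrow> det (shift_mat n X s) \<noteq> 0" using shift_mat_nonsingular[OF X(1)] by blast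
    obtain rY where rY: "0 < rY" "\<And>s. s \<noteq> 0 \<Longrightarrow> norm s \<le> rY \<Longrightarrow> det (shift_mat n Y s) \<noteq> 0" using shift_mat_nonsingular[OF Y(1)] by blast
    define r where "r = min r0 (min rX rY)"
    have r: "0 < r" "r \<le> r0" "r \<le> rX" "r \<le> rY" using r0(1) rX(1) rY(1) by (auto simp: r_def)
    define f where "f s t = det (chow_mat n (shift_mat n X s) (shift_mat n Y t) Z)" for s t
    have sX: "shift_mat n X s \<in> carrier_mat n n" and sY: "shift_mat n Y s \<in> carrier_mat n n" for s
      by (rule shift_mat_carrier[OF X(1)], rule shift_mat_carrier[OF Y(1)])
    define H where "H p = node_values n (shift_mat n X (fst p)) (shift_mat n Y (snd p)) Z" for p
    have H: "H p \<in> carrier_mat ?m ?m" for p by (simp add: H_def node_values_def)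
    have f_alt: "f s t = det (H (s, t)) / det (node_mat n)" for s t
      unfolding f_def H_def by (simp add: det_chow_mat_eq_node_values[OF sX sY Z(1) n])
    have ent: "(\<lambda>p. net_point (shift_mat n X (fst p)) (shift_mat n Y (snd p)) Z a b c $$ (i, j)) =
        (\<lambda>p. a * (X $$ (i, j) + fst p * (if i = j then 1 else 0)) + b * (Y $$ (i, j) + snd p * (if i = j then 1 else 0)) + c * Z $$ (i, j))"
      if "i < n" "j < n" for a b c i j
      using that by (simp add: net_point_index[OF sX sY Z(1)] shift_mat_index[OF X(1)] shift_mat_index[OF Y(1)])
    have Hent: "(\<lambda>p. H p $$ (r, q)) = (\<lambda>p. adj_mat (net_point (shift_mat n X (fst p)) (shift_mat n Y (snd p)) Z 1 (2 ^ q) (2 ^ (q * n))) $$ (upper_pairs n ! r))"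
      if "r < ?m" "q < ?m" for r q using that by (simp add: H_def node_values_def)
    have np: "net_point (shift_mat n X (fst p)) (shift_mat n Y (snd p)) Z a b c \<in> carrier_mat n n" for p a b c
      by (rule net_point_carrier[OF sX sY Z(1)])
    have "continuous_on UNIV (\<lambda>p. det (H p))"
    proof -
      have "(\<lambda>p. det (H p)) \<in> {g. continuous_on UNIV g}"
      proof (rule det_mem_fun_algebra[where n = ?m])
        fix r q assume rq: "r < ?m" "q < ?m"
        obtain i j where ij: "upper_pairs n ! r = (i, j)" "i \<le> j" "j < n" using rq(1) by (rule upper_pairs_nthE)
        have i: "i < n" using ij by simp
        have "continuous_on UNIV (\<lambda>p. adj_mat (net_point (shift_mat n X (fst p)) (shift_mat n Y (snd p)) Z 1 (2 ^ q) (2 ^ (q * n))) $$ (i, j))"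
          by (rule continuous_on_adj_mat[OF np _ i ij(3)]) (simp only: ent, intro continuous_intros)
        then show "(\<lambda>p. H p $$ (r, q)) \<in> {g. continuous_on UNIV g}" unfolding Hent[OF rq] ij(1) by simp
      next
        show "H p \<in> carrier_mat ?m ?m" for p by (rule H)
      qed (auto intro: continuous_intros)
      then show ?thesis by simp
    qed
    then have cont: "continuous_on UNIV (\<lambda>(s, t). f s t)"
      unfolding f_alt by (simp add: case_prod_unfold divide_inverse continuous_on_mult_right)
    have hol: "(\<lambda>s. f s t) holomorphic_on UNIV" for t
    proof -
      have "(\<lambda>s. det (H (s, t))) holomorphic_on UNIV"
      proof (rule holomorphic_on_det[OF H])
        fix r q assume rq: "r < ?m" "q < ?m"
        obtain i j where ij: "upper_pairs n ! r = (i, j)" "i \<le> j" "j < n" using rq(1) by (rule upper_pairs_nthE)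
        have i: "i < n" using ij by simp
        have e: "(\<lambda>s. net_point (shift_mat n X (fst (s, t))) (shift_mat n Y (snd (s, t))) Z a b c $$ (k, l)) =
          (\<lambda>s. a * (X $$ (k, l) + s * (if k = l then 1 else 0)) + b * (Y $$ (k, l) + t * (if k = l then 1 else 0)) + c * Z $$ (k, l))"
          if "k < n" "l < n" for a b c k l
          using that by (simp add: net_point_index[OF sX sY Z(1)] shift_mat_index[OF X(1)] shift_mat_index[OF Y(1)])
        have "(\<lambda>s. adj_mat (net_point (shift_mat n X (fst (s, t))) (shift_mat n Y (snd (s, t))) Z 1 (2 ^ q) (2 ^ (q * n))) $$ (i, j)) holomorphic_on UNIV"
          by (rule holomorphic_on_adj_mat[OF np _ i ij(3)]) (simp only: e, intro holomorphic_intros)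
        then show "(\<lambda>s. H (s, t) $$ (r, q)) holomorphic_on UNIV" using rq by (simp add: H_def node_values_def ij(1))
      qed
      then show ?thesis unfolding f_alt by (intro holomorphic_intros) (use det_node_mat[OF n] in auto)
    qed
    have nz: "f s t \<noteq> 0" if "norm s \<le> r" "norm t \<le> r" "s \<noteq> 0 \<or> t \<noteq> 0" for s t
      unfolding f_def
    proof (rule det_chow_mat_nonzero_if_det_nonzero[OF n sX shift_mat_symmetric[OF X] sY shift_mat_symmetric[OF Y] Z])
      show "det (shift_mat n X s) \<noteq> 0 \<or> det (shift_mat n Y t) \<noteq> 0" using rX(2)[of s] rY(2)[of t] that r by auto
      show "adj_mat (net_point (shift_mat n X s) (shift_mat n Y t) Z a b c) \<noteq> 0\<^sub>m n n" if "a \<noteq> 0 \<or> b \<noteq> 0 \<or> c \<noteq> 0" for a b c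
        by (rule r0(2)[rule_format, OF conjI that]) (use \<open>norm s \<le> r\<close> \<open>norm t \<le> r\<close> r(2) in linarith)+
    qed
    have "f 0 0 \<noteq> 0" by (rule no_isolated_zero[OF cont hol r(1) nz])
    moreover have "shift_mat n X 0 = X" "shift_mat n Y 0 = Y" using X Y by (auto simp: shift_mat_def intro!: eq_matI)
    ultimately show False using det0 by (simp add: f_def)
  qed
qed

section \<open>Change of basis of the net\<close>

text \<open>The columns are the vectors of monomials at the images of the nodes under the substitution
  by \<open>g\<close>.\<close>

definition subst_mat :: "nat \<Rightarrow> complex mat \<Rightarrow> complex mat" where
  "subst_mat n g = mat ((n + 1) choose 2) ((n + 1) choose 2) (\<lambda>(s, q). monom_vec n
     (g $$ (0, 0) + 2 ^ q * g $$ (1, 0) + 2 ^ (q * n) * g $$ (2, 0))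
     (g $$ (0, 1) + 2 ^ q * g $$ (1, 1) + 2 ^ (q * n) * g $$ (2, 1))
     (g $$ (0, 2) + 2 ^ q * g $$ (1, 2) + 2 ^ (q * n) * g $$ (2, 2)) $ s)"

definition subst_char :: "nat \<Rightarrow> complex mat \<Rightarrow> complex" where
  "subst_char n g = det (subst_mat n g) / det (node_mat n)"

definition net_row :: "complex mat \<Rightarrow> complex mat \<Rightarrow> complex mat \<Rightarrow> complex mat \<Rightarrow> nat \<Rightarrow> complex mat" where
  "net_row g X Y Z k = net_point X Y Z (g $$ (k, 0)) (g $$ (k, 1)) (g $$ (k, 2))"

text \<open>The value of the transformed net at a node is the value of the original net at the image of
  that node; so the products of the two Chow matrices with \<open>node_mat\<close> and \<open>subst_mat\<close> agree.\<close>

lemma det_chow_mat_net_row: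
  assumes XYZ: "X \<in> carrier_mat n n" "Y \<in> carrier_mat n n" "Z \<in> carrier_mat n n" and n: "1 \<le> n"
  shows "det (chow_mat n (net_row g X Y Z 0) (net_row g X Y Z 1) (net_row g X Y Z 2)) = subst_char n g * det (chow_mat n X Y Z)"
proof -
  let ?m = "(n + 1) choose 2"
  let ?X = "net_row g X Y Z 0" and ?Y = "net_row g X Y Z 1" and ?Z = "net_row g X Y Z 2"
  have G: "subst_mat n g \<in> carrier_mat ?m ?m" by (simp add: subst_mat_def)
  have R: "net_row g X Y Z k \<in> carrier_mat n n" for k unfolding net_row_def by (rule net_point_carrier[OF XYZ])
  have comp: "net_point ?X ?Y ?Z a b c = net_point X Y Z (a * g $$ (0, 0) + b * g $$ (1, 0) + c * g $$ (2, 0))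
     (a * g $$ (0, 1) + b * g $$ (1, 1) + c * g $$ (2, 1)) (a * g $$ (0, 2) + b * g $$ (1, 2) + c * g $$ (2, 2))" for a b c
    using XYZ by (intro eq_matI) (auto simp: net_point_def net_row_def algebra_simps)
  have "node_values n ?X ?Y ?Z = chow_mat n X Y Z * subst_mat n g"
  proof (rule eq_matI)
    fix r q assume "r < dim_row (chow_mat n X Y Z * subst_mat n g)" "q < dim_col (chow_mat n X Y Z * subst_mat n g)"
    then have rq: "r < ?m" "q < ?m" by (auto simp: chow_mat_def subst_mat_def)
    define a where "a = g $$ (0, 0) + 2 ^ q * g $$ (1, 0) + 2 ^ (q * n) * g $$ (2, 0)"
    define b where "b = g $$ (0, 1) + 2 ^ q * g $$ (1, 1) + 2 ^ (q * n) * g $$ (2, 1)"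
    define c where "c = g $$ (0, 2) + 2 ^ q * g $$ (1, 2) + 2 ^ (q * n) * g $$ (2, 2)"
    have mv: "monom_vec n a b c \<in> carrier_vec ?m" by (simp add: monom_vec_def)
    have "(chow_mat n X Y Z * subst_mat n g) $$ (r, q) = (chow_mat n X Y Z *\<^sub>v monom_vec n a b c) $ r"
      unfolding index_mult_mat_sum[OF chow_mat_carrier G rq] index_mult_mat_vec_sum[OF chow_mat_carrier mv rq(1)]
      using rq by (intro sum.cong refl) (simp add: subst_mat_def a_def b_def c_def)
    also have "\<dots> = adj_mat (net_point X Y Z a b c) $$ (upper_pairs n ! r)"
      unfolding chow_mat_mult_monom_vec[OF XYZ n] using rq by (simp add: sym_coords_def)
    also have "net_point X Y Z a b c = net_point ?X ?Y ?Z 1 (2 ^ q) (2 ^ (q * n))"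
      unfolding comp by (simp add: a_def b_def c_def)
    finally show "node_values n ?X ?Y ?Z $$ (r, q) = (chow_mat n X Y Z * subst_mat n g) $$ (r, q)"
      using rq by (simp add: node_values_def)
  qed (auto simp: chow_mat_def subst_mat_def node_values_def)
  then show ?thesis
    using det_mult[OF chow_mat_carrier G, of X Y Z] by (simp add: det_chow_mat_eq_node_values[OF R R R n] subst_char_def)
qed

text \<open>Row \<open>s\<close> of \<open>node_mat\<close> is scaled by the value of the monomial \<open>s\<close> at the diagonal entries,
  and each diagonal entry occurs \<open>(n + 1) choose 3\<close> times in the product of all of these values.\<close>

lemma subst_char_diag:
  assumes n: "1 \<le> n" and g: "g \<in> carrier_mat 3 3" "\<And>i j. i < 3 \<Longrightarrow> j < 3 \<Longrightarrow> i \<noteq> j \<Longrightarrow> g $$ (i, j) = 0"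
  shows "subst_char n g = (g $$ (0, 0) * g $$ (1, 1) * g $$ (2, 2)) ^ ((n + 1) choose 3)"
proof -
  let ?m = "(n + 1) choose 2" and ?E = "node_mat n"
  let ?a = "g $$ (0, 0)" and ?b = "g $$ (1, 1)" and ?c = "g $$ (2, 2)"
  let ?mon = "\<lambda>s. ternary_monoms (n - 1) ! s"
  define d where "d s = monom_value (point3 ?a ?b ?c) (?mon s)" for s
  have E: "?E \<in> carrier_mat ?m ?m" by (simp add: node_mat_def)
  have G: "subst_mat n g \<in> carrier_mat ?m ?m" by (simp add: subst_mat_def)
  have mem: "?mon s \<in> set (ternary_monoms (n - 1))" if "s < ?m" for s
    using that n by (intro nth_mem) (simp add: length_ternary_monoms)
  have ent: "subst_mat n g $$ (s, q) = d s * ?E $$ (s, q)" if sq: "s < ?m" "q < ?m" for s q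
  proof -
    obtain i j k where m: "?mon s = ternary_monom i j k" using mem[OF sq(1)] by (auto simp: set_ternary_monoms)
    show ?thesis using sq g(2)[of 0 1] g(2)[of 0 2] g(2)[of 1 0] g(2)[of 1 2] g(2)[of 2 0] g(2)[of 2 1]
      by (simp add: subst_mat_def node_mat_def monom_vec_def d_def m monom_value_ternary_monom power_mult_distrib mult_ac del: One_nat_def)
  qed
  have "det (subst_mat n g) = (\<Sum>p\<in>{p. p permutes {0..<?m}}. signof p * (\<Prod>i = 0..<?m. d i * ?E $$ (i, p i)))"
    unfolding det_def'[OF G]
  proof (intro sum.cong refl arg_cong[of _ _ "\<lambda>x. _ * x"] prod.cong)
    fix p i assume "p \<in> {p. p permutes {0..<?m}}" "i \<in> {0..<?m}"
    then show "subst_mat n g $$ (i, p i) = d i * ?E $$ (i, p i)"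
      using permutes_in_image[of p "{0..<?m}" i] by (intro ent) auto
  qed
  also have "\<dots> = (\<Prod>i = 0..<?m. d i) * det ?E"
    unfolding det_def'[OF E] sum_distrib_left by (intro sum.cong refl) (simp add: prod.distrib mult_ac)
  also have "(\<Prod>i = 0..<?m. d i) = (?a * ?b * ?c) ^ ((n + 1) choose 3)"
  proof -
    let ?l = "\<lambda>k i. Poly_Mapping.lookup (?mon i) k"
    have "(\<Prod>i = 0..<?m. d i) = (\<Prod>i<?m. ?a ^ ?l 0 i * ?b ^ ?l 1 i * ?c ^ ?l 2 i)"
    proof (intro prod.cong)
      fix i assume "i \<in> {..<?m}"
      then obtain x y z where m: "?mon i = ternary_monom x y z" using mem[of i] by (auto simp: set_ternary_monoms)
      show "d i = ?a ^ ?l 0 i * ?b ^ ?l 1 i * ?c ^ ?l 2 i"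
        unfolding d_def m by (simp add: monom_value_ternary_monom lookup_ternary_monom)
    qed auto
    also have "\<dots> = ?a ^ (\<Sum>i<?m. ?l 0 i) * ?b ^ (\<Sum>i<?m. ?l 1 i) * ?c ^ (\<Sum>i<?m. ?l 2 i)"
      by (simp add: prod.distrib power_sum)
    also have "(\<Sum>i<?m. ?l k i) = (n + 1) choose 3" if "k < 3" for k
    proof -
      have "n + 1 = n - 1 + 2" using n by simp
      then show ?thesis using sum_ternary_monoms[of "\<lambda>m. Poly_Mapping.lookup m k" "n - 1"] sum_lookup_ternary_monoms[OF that, of "n - 1"]
        by (simp only:)
    qed
    then have "?a ^ (\<Sum>i<?m. ?l 0 i) * ?b ^ (\<Sum>i<?m. ?l 1 i) * ?c ^ (\<Sum>i<?m. ?l 2 i)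
        = ?a ^ ((n + 1) choose 3) * ?b ^ ((n + 1) choose 3) * ?c ^ ((n + 1) choose 3)" by simp
    finally show ?thesis by (simp add: power_mult_distrib)
  qed
  finally show ?thesis using det_node_mat[OF n] by (simp add: subst_char_def)
qed

section \<open>The Chow determinant as a polynomial\<close>

definition sym_of :: "nat \<Rightarrow> (nat \<times> nat \<Rightarrow> complex) \<Rightarrow> nat \<Rightarrow> complex mat" where
  "sym_of n \<alpha> k = mat n n (\<lambda>(i, j). \<alpha> (k, pair_index i j))"

definition chow_poly :: "nat \<Rightarrow> (nat \<times> nat, complex) polys" where
  "chow_poly n = det (chow_mat n (generic_sym_mat n 0) (generic_sym_mat n 1) (generic_sym_mat n 2))"

lemma sym_of_carrier: "sym_of n \<alpha> k \<in> carrier_mat n n"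
  by (simp add: sym_of_def)

lemma sym_of_symmetric: "transpose_mat (sym_of n \<alpha> k) = sym_of n \<alpha> k"
  by (rule eq_matI) (auto simp: sym_of_def pair_index_commute)

lemma generic_sym_mat_carrier: "generic_sym_mat n k \<in> carrier_mat n n"
  by (simp add: generic_sym_mat_def)

lemma poly_value_chow_poly:
  assumes n: "1 \<le> n"
  shows "poly_value \<alpha> (chow_poly n) = det (chow_mat n (sym_of n \<alpha> 0) (sym_of n \<alpha> 1) (sym_of n \<alpha> 2))"
proof -
  have h: "comm_ring_hom (poly_value \<alpha> :: (nat \<times> nat, complex) polys \<Rightarrow> complex)" by (rule comm_ring_hom_poly_value)
  interpret comm_ring_hom "poly_value \<alpha> :: (nat \<times> nat, complex) polys \<Rightarrow> complex" by (rule h)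
  have g: "map_mat (poly_value \<alpha>) (generic_sym_mat n k) = sym_of n \<alpha> k" for k
    by (rule eq_matI) (auto simp: generic_sym_mat_def sym_of_def)
  show ?thesis unfolding chow_poly_def hom_det[symmetric]
    by (simp only: map_mat_chow_mat[OF h generic_sym_mat_carrier generic_sym_mat_carrier generic_sym_mat_carrier n] g)
qed

definition multihomogeneous :: "nat \<Rightarrow> (nat \<Rightarrow>\<^sub>0 nat) \<Rightarrow> (nat \<times> nat, complex) polys set" where
  "multihomogeneous n m = {p. \<forall>\<mu>\<in>Poly_Mapping.keys p.
     Poly_Mapping.keys \<mu> \<subseteq> {..<3} \<times> {..<(n + 1) choose 2} \<and> (\<forall>k. block_degree k \<mu> = Poly_Mapping.lookup m k)}"

lemma multihomogeneous_0: "0 \<in> multihomogeneous n m"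
  by (simp add: multihomogeneous_def)

lemma multihomogeneous_1: "1 \<in> multihomogeneous n 0"
  by (simp add: multihomogeneous_def block_degree_def)

lemma multihomogeneous_add: "x \<in> multihomogeneous n m \<Longrightarrow> y \<in> multihomogeneous n m \<Longrightarrow> x + y \<in> multihomogeneous n m"
  using Poly_Mapping.keys_add[of x y] unfolding multihomogeneous_def by blast

lemma multihomogeneous_neg: "x \<in> multihomogeneous n m \<Longrightarrow> - x \<in> multihomogeneous n m"
  by (simp add: multihomogeneous_def)

lemma multihomogeneous_mult:
  assumes "x \<in> multihomogeneous n m" "y \<in> multihomogeneous n m'"
  shows "x * y \<in> multihomogeneous n (m + m')"
  unfolding multihomogeneous_def
proof (intro CollectI ballI)
  fix \<mu> assume "\<mu> \<in> Poly_Mapping.keys (x * y)"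
  then obtain a b where \<mu>: "\<mu> = a + b" "a \<in> Poly_Mapping.keys x" "b \<in> Poly_Mapping.keys y" by (rule mem_keys_multE)
  have a: "Poly_Mapping.keys a \<subseteq> {..<3} \<times> {..<(n + 1) choose 2}" "\<And>k. block_degree k a = Poly_Mapping.lookup m k"
    using assms(1) \<mu>(2) unfolding multihomogeneous_def by blast+
  have b: "Poly_Mapping.keys b \<subseteq> {..<3} \<times> {..<(n + 1) choose 2}" "\<And>k. block_degree k b = Poly_Mapping.lookup m' k"
    using assms(2) \<mu>(3) unfolding multihomogeneous_def by blast+
  show "Poly_Mapping.keys \<mu> \<subseteq> {..<3} \<times> {..<(n + 1) choose 2} \<and> (\<forall>k. block_degree k \<mu> = Poly_Mapping.lookup (m + m') k)"
    using Poly_Mapping.keys_add[of a b] a b unfolding \<mu>(1) block_degree_add lookup_add by auto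
qed

lemma multihomogeneous_sum: "(\<And>x. x \<in> S \<Longrightarrow> f x \<in> multihomogeneous n m) \<Longrightarrow> sum f S \<in> multihomogeneous n m"
  by (induction S rule: infinite_finite_induct) (auto intro: multihomogeneous_0 multihomogeneous_add)

lemma Var_multihomogeneous:
  assumes "k < 3" "p < (n + 1) choose 2"
  shows "Var (k, p) \<in> multihomogeneous n (Poly_Mapping.single k 1)"
proof -
  have "block_degree k' (Poly_Mapping.single (k, p) 1) = (if k' = k then 1 else 0)" for k'
    by (subst block_degree_superset[of "{(k, p)}"]) auto
  then show ?thesis using assms by (auto simp: multihomogeneous_def Var_def lookup_single when_def)
qed

text \<open>If \<open>x\<close>, \<open>y\<close>, \<open>z\<close> get the opposite degrees of the three blocks, then the generic net
  \<open>x X + y Y + z Z\<close> has degree 0, so the coefficient of a monomial in \<open>x\<close>, \<open>y\<close>, \<open>z\<close> has the degree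
  of that monomial in the blocks.\<close>

lemma lookup_adj_generic_net_mat:
  assumes ij: "i < n" "j < n"
  shows "Poly_Mapping.lookup (adj_mat (net_mat (generic_sym_mat n 0) (generic_sym_mat n 1) (generic_sym_mat n 2)) $$ (i, j)) m
    \<in> multihomogeneous n m"
proof -
  let ?C = "\<lambda>_::nat. {P :: (nat, (nat \<times> nat, complex) polys) polys. \<forall>m. Poly_Mapping.lookup P m \<in> multihomogeneous n m}"
  let ?N = "net_mat (generic_sym_mat n 0) (generic_sym_mat n 1) (generic_sym_mat n 2) :: (nat, (nat \<times> nat, complex) polys) polys mat"
  have N: "?N \<in> carrier_mat n n" by (intro net_mat_carrier generic_sym_mat_carrier)
  have add: "x + y \<in> ?C i" if "x \<in> ?C i" "y \<in> ?C i" for i x y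
    using that by (auto simp: lookup_add intro: multihomogeneous_add)
  have "adj_mat ?N $$ (i, j) \<in> ?C (n - 1)"
  proof (rule adj_mat_mem_graded[of ?C, OF _ _ add _ _ N _ ij])
    show "0 \<in> ?C i" for i by (simp add: multihomogeneous_0)
    show "1 \<in> ?C 0" by (simp add: lookup_one when_def multihomogeneous_0 multihomogeneous_1)
    show "- x \<in> ?C i" if "x \<in> ?C i" for i x using that by (simp add: multihomogeneous_neg)
    show "x * y \<in> ?C (i + j)" if xy: "x \<in> ?C i" "y \<in> ?C j" for i j x y
    proof (intro CollectI allI)
      fix m
      show "Poly_Mapping.lookup (x * y) m \<in> multihomogeneous n m"
        unfolding lookup_mult_eq_sum
      proof (intro multihomogeneous_sum)
        fix a b
        show "(if a + b = m then Poly_Mapping.lookup x a * Poly_Mapping.lookup y b else 0) \<in> multihomogeneous n m"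
          using xy multihomogeneous_mult[of "Poly_Mapping.lookup x a" n a "Poly_Mapping.lookup y b" b]
          by (auto simp: multihomogeneous_0)
      qed
    qed
    fix r c assume rc: "r < n" "c < n"
    have s: "Poly_Mapping.single (Poly_Mapping.single k 1) (generic_sym_mat n k $$ (r, c)) \<in> ?C 1" if "k < 3" for k
      using Var_multihomogeneous[OF that pair_index_less'[OF rc]] rc
      by (auto simp: generic_sym_mat_def lookup_single when_def multihomogeneous_0)
    have "Poly_Mapping.single (Poly_Mapping.single 0 1) (generic_sym_mat n 0 $$ (r, c)) +
        Poly_Mapping.single (Poly_Mapping.single 1 1) (generic_sym_mat n 1 $$ (r, c)) +
        Poly_Mapping.single (Poly_Mapping.single 2 1) (generic_sym_mat n 2 $$ (r, c)) \<in> ?C 1"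
      by (rule add[OF add[OF s s] s]) auto
    then show "?N $$ (r, c) \<in> ?C 1"
      unfolding net_mat_index[OF generic_sym_mat_carrier generic_sym_mat_carrier generic_sym_mat_carrier rc] .
  qed
  then show ?thesis by blast
qed

lemma chow_poly_multihomogeneous:
  assumes n: "1 \<le> n"
  shows "chow_poly n \<in> multihomogeneous n (\<Sum>s<(n + 1) choose 2. ternary_monoms (n - 1) ! s)"
  unfolding chow_poly_def
proof (rule det_mem_graded[of "multihomogeneous n"])
  fix r s assume rs: "r < (n + 1) choose 2" "s < (n + 1) choose 2"
  obtain i j where ij: "upper_pairs n ! r = (i, j)" "i \<le> j" "j < n" using rs(1) by (rule upper_pairs_nthE)
  show "chow_mat n (generic_sym_mat n 0) (generic_sym_mat n 1) (generic_sym_mat n 2) $$ (r, s) \<in> multihomogeneous n (ternary_monoms (n - 1) ! s)"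
    using rs ij lookup_adj_generic_net_mat[of i n j "ternary_monoms (n - 1) ! s"] by (simp add: chow_mat_def)
next
  show "chow_mat n (generic_sym_mat n 0) (generic_sym_mat n 1) (generic_sym_mat n 2) \<in> carrier_mat ((n + 1) choose 2) ((n + 1) choose 2)"
    by (rule chow_mat_carrier)
qed (auto intro: multihomogeneous_0 multihomogeneous_1 multihomogeneous_add multihomogeneous_neg multihomogeneous_mult)

lemma keys_chow_poly:
  assumes n: "1 \<le> n" and \<mu>: "\<mu> \<in> Poly_Mapping.keys (chow_poly n)"
  shows "Poly_Mapping.keys \<mu> \<subseteq> {..<3} \<times> {..<(n + 1) choose 2}"
    and "block_degree k \<mu> = (if k < 3 then (n + 1) choose 3 else 0)"
proof -
  have m: "Poly_Mapping.keys \<mu> \<subseteq> {..<3} \<times> {..<(n + 1) choose 2}"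
    "\<And>k. block_degree k \<mu> = Poly_Mapping.lookup (\<Sum>s<(n + 1) choose 2. ternary_monoms (n - 1) ! s) k"
    using chow_poly_multihomogeneous[OF n] \<mu> unfolding multihomogeneous_def by blast+
  show "Poly_Mapping.keys \<mu> \<subseteq> {..<3} \<times> {..<(n + 1) choose 2}" by (rule m(1))
  have n1: "n - 1 + 2 = n + 1" using n by simp
  have "block_degree k \<mu> = (\<Sum>t\<in>set (ternary_monoms (n - 1)). Poly_Mapping.lookup t k)"
    unfolding m(2) lookup_sum using sum_ternary_monoms[of "\<lambda>t. Poly_Mapping.lookup t k" "n - 1"] unfolding n1 .
  also have "\<dots> = (if k < 3 then (n + 1) choose 3 else 0)"
  proof (cases "k < 3")
    case True
    then show ?thesis using sum_lookup_ternary_monoms[of k "n - 1"] unfolding n1 by simp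
  next
    case False
    then have "Poly_Mapping.lookup t k = 0" if "t \<in> set (ternary_monoms (n - 1))" for t
      using that by (auto simp: set_ternary_monoms lookup_ternary_monom)
    then show ?thesis using False by simp
  qed
  finally show "block_degree k \<mu> = (if k < 3 then (n + 1) choose 3 else 0)" .
qed

section \<open>A rational parametrization of nets with a point of corank 2\<close>

text \<open>A symmetric matrix given as a combination of \<open>n - 2\<close> squares of linear forms, so that its
  rank is at most \<open>n - 2\<close>.\<close>

definition gram_mat :: "nat \<Rightarrow> (nat \<Rightarrow> complex) \<Rightarrow> (nat \<Rightarrow> nat \<Rightarrow> complex) \<Rightarrow> complex mat" where
  "gram_mat n s y = mat n n (\<lambda>(i, j). \<Sum>q<n - 2. s q * y q i * y q j)"

text \<open>The matrix factors through a matrix \<open>C\<close> with two zero rows.\<close>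

lemma adj_gram_mat:
  assumes n: "2 \<le> n"
  shows "adj_mat (gram_mat n s y) = 0\<^sub>m n n"
proof -
  define P where "P = mat n n (\<lambda>(i, q). if q < n - 2 then s q * y q i else 0)"
  define C where "C = mat n n (\<lambda>(q, j). if q < n - 2 then y q j else 0)"
  have P: "P \<in> carrier_mat n n" and C: "C \<in> carrier_mat n n" by (auto simp: P_def C_def)
  have "gram_mat n s y = P * C"
  proof (rule eq_matI)
    fix i j assume "i < dim_row (P * C)" "j < dim_col (P * C)"
    then have ij: "i < n" "j < n" using P C by auto
    have "(P * C) $$ (i, j) = (\<Sum>q<n. if q < n - 2 then s q * y q i * y q j else 0)"
      unfolding index_mult_mat_sum[OF P C ij] using ij by (intro sum.cong refl) (auto simp: P_def C_def)
    also have "\<dots> = (\<Sum>q<n - 2. s q * y q i * y q j)"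
      by (rule sum.mono_neutral_cong_right) auto
    finally show "gram_mat n s y $$ (i, j) = (P * C) $$ (i, j)" using ij by (simp add: gram_mat_def)
  qed (auto simp: gram_mat_def P_def C_def)
  moreover have "adj_mat C = 0\<^sub>m n n"
  proof (rule eq_matI)
    fix i j assume "i < dim_row (0\<^sub>m n n :: complex mat)" "j < dim_col (0\<^sub>m n n :: complex mat)"
    then have ij: "i < n" "j < n" by auto
    have D: "mat_delete C j i \<in> carrier_mat (n - 1) (n - 1)" by (rule mat_delete_carrier[OF C])
    have r: "n - 2 < n - 1" using n by simp
    have "det (mat_delete C j i) = (\<Sum>c<n - 1. mat_delete C j i $$ (n - 2, c) * cofactor (mat_delete C j i) (n - 2) c)"
      by (rule laplace_expansion_row[OF D r])
    also have "\<dots> = 0"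
      using n ij by (intro sum.neutral) (auto simp: mat_delete_def C_def)
    finally show "adj_mat C $$ (i, j) = 0\<^sub>m n n $$ (i, j)" using ij C by (simp add: adj_mat_def cofactor_def)
  qed (use C in \<open>auto simp: adj_mat_def\<close>)
  moreover have n0: "0 < n" using n by simp
  ultimately obtain u w where u: "u \<in> carrier_vec n" "C *\<^sub>v u = 0\<^sub>v n" and w: "w \<in> carrier_vec n" "C *\<^sub>v w = 0\<^sub>v n"
    and ind: "\<And>a b. (\<forall>i<n. a * u $ i + b * w $ i = 0) \<Longrightarrow> a = 0 \<and> b = 0" and eq: "gram_mat n s y = P * C"
    using two_kernel_vectors_if_adj_mat_eq_0[OF C n0] by blast
  have K: "(P * C) *\<^sub>v x = 0\<^sub>v n" if "x \<in> carrier_vec n" "C *\<^sub>v x = 0\<^sub>v n" for x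
    unfolding assoc_mult_mat_vec[OF P C that(1)] that(2) by (rule mult_mat_zero_vec[OF P])
  show ?thesis unfolding eq
    by (rule adj_mat_eq_0_if_kernel[OF mult_carrier_mat[OF P C] u(1) K[OF u] w(1) K[OF w] ind])
qed

text \<open>The parameters \<open>(g, s, y, U, V)\<close> describe the net spanned by \<open>A\<close>, \<open>U\<close>, \<open>V\<close>, where
  \<open>A = gram_mat n s y\<close> has corank at least 2, together with the coefficients \<open>g\<close> of three spanning
  matrices in terms of \<open>A\<close>, \<open>U\<close>, \<open>V\<close>. The parameters form a vector space, so any two are joined by
  a line.\<close>

type_synonym net_param = "(nat \<Rightarrow> nat \<Rightarrow> complex) \<times> (nat \<Rightarrow> complex) \<times> (nat \<Rightarrow> nat \<Rightarrow> complex) \<times>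
  (nat \<Rightarrow> nat \<Rightarrow> complex) \<times> (nat \<Rightarrow> nat \<Rightarrow> complex)"

definition param_point :: "nat \<Rightarrow> net_param \<Rightarrow> nat \<times> nat \<Rightarrow> complex" where
  "param_point n = (\<lambda>(g, s, y, U, V) (k, p). if k < 3 \<and> p < (n + 1) choose 2 then
     (case upper_pairs n ! p of (i, j) \<Rightarrow> g k 0 * (\<Sum>q<n - 2. s q * y q i * y q j) + g k 1 * U i j + g k 2 * V i j) else 0)"

text \<open>A combination of the three matrices, with coefficients \<open>b\<close> that are not all zero,
  eliminates \<open>U\<close> and \<open>V\<close>, as this imposes two conditions on three coefficients; it is a multiple
  of \<open>A\<close>.\<close>

lemma chow_poly_param_point:
  assumes n: "2 \<le> n"
  shows "poly_value (param_point n \<pi>) (chow_poly n) = 0"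
proof -
  obtain g s y U V where \<pi>: "\<pi> = (g, s, y, U, V)" by (cases \<pi>)
  let ?X = "sym_of n (param_point n \<pi>)"
  obtain b where b: "\<exists>k<3. b k \<noteq> 0" "\<forall>i<2. (\<Sum>k<3. g k (Suc i) * b k) = 0"
    using homogeneous_system_solvable[of 2 3 "\<lambda>i k. g k (Suc i)"] by auto
  have b12: "g 0 1 * b 0 + g 1 1 * b 1 + g 2 1 * b 2 = 0" "g 0 2 * b 0 + g 1 2 * b 1 + g 2 2 * b 2 = 0"
    using b(2)[rule_format, of 0] b(2)[rule_format, of 1] by (simp_all add: numeral_3_eq_3 numeral_2_eq_2)
  define c where "c = g 0 0 * b 0 + g 1 0 * b 1 + g 2 0 * b 2"
  have ent: "?X k $$ (i, j) = g k 0 * gram_mat n s y $$ (i, j) + g k 1 * U (min i j) (max i j) + g k 2 * V (min i j) (max i j)"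
    if k: "k < 3" and ij: "i < n" "j < n" for k i j
  proof -
    have le: "min i j \<le> max i j" "max i j < n" using ij by auto
    have p: "pair_index i j = pair_index (min i j) (max i j)" by (simp add: pair_index_def)
    have "(\<Sum>q<n - 2. s q * y q (min i j) * y q (max i j)) = (\<Sum>q<n - 2. s q * y q i * y q j)"
      by (cases "i \<le> j") (auto simp: min_def max_def mult_ac)
    then show ?thesis using k ij pair_index_less[OF le] upper_pairs_nth_pair_index[OF le]
      by (simp add: sym_of_def param_point_def \<pi> p gram_mat_def)
  qed
  have G: "gram_mat n s y \<in> carrier_mat n n" by (simp add: gram_mat_def)
  have "net_point (?X 0) (?X 1) (?X 2) (b 0) (b 1) (b 2) = c \<cdot>\<^sub>m gram_mat n s y"
  proof (rule eq_matI)
    fix i j assume "i < dim_row (c \<cdot>\<^sub>m gram_mat n s y)" "j < dim_col (c \<cdot>\<^sub>m gram_mat n s y)"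
    then have ij: "i < n" "j < n" by (auto simp: gram_mat_def)
    let ?u = "U (min i j) (max i j)" and ?v = "V (min i j) (max i j)" and ?a = "gram_mat n s y $$ (i, j)"
    have "net_point (?X 0) (?X 1) (?X 2) (b 0) (b 1) (b 2) $$ (i, j) =
        c * ?a + (g 0 1 * b 0 + g 1 1 * b 1 + g 2 1 * b 2) * ?u + (g 0 2 * b 0 + g 1 2 * b 1 + g 2 2 * b 2) * ?v"
      by (simp add: net_point_index[OF sym_of_carrier sym_of_carrier sym_of_carrier ij] ent ij c_def algebra_simps)
    then show "net_point (?X 0) (?X 1) (?X 2) (b 0) (b 1) (b 2) $$ (i, j) = (c \<cdot>\<^sub>m gram_mat n s y) $$ (i, j)"
      using ij G unfolding b12 by simp
  qed (auto simp: gram_mat_def net_point_def sym_of_def)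
  then have "adj_mat (net_point (?X 0) (?X 1) (?X 2) (b 0) (b 1) (b 2)) = 0\<^sub>m n n"
    using adj_mat_smult_eq_0[OF G _ adj_gram_mat[OF n]] n by simp
  moreover have "b 0 \<noteq> 0 \<or> b 1 \<noteq> 0 \<or> b 2 \<noteq> 0"
  proof -
    obtain k where "k < 3" "b k \<noteq> 0" using b(1) by blast
    moreover from this have "k = 0 \<or> k = 1 \<or> k = 2" by auto
    ultimately show ?thesis by auto
  qed
  ultimately have "det (chow_mat n (?X 0) (?X 1) (?X 2)) = 0"
    using n by (intro det_chow_mat_eq_0_if_corank_2[OF sym_of_carrier sym_of_carrier sym_of_carrier]) auto
  then show ?thesis using n by (simp add: poly_value_chow_poly)
qed

text \<open>If neither factor vanishes on all parameters, join two witnesses by a straight line in the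
  space of parameters. The pullbacks of the factors are nonzero polynomials in one variable with
  product 0.\<close>

lemma factor_vanishes_on_params:
  assumes n: "2 \<le> n" and F: "chow_poly n = G * H"
  shows "(\<forall>\<pi>. poly_value (param_point n \<pi>) G = 0) \<or> (\<forall>\<pi>. poly_value (param_point n \<pi>) H = 0)"
proof (rule ccontr)
  assume "\<not> ?thesis"
  then obtain \<pi> \<pi>' where nz: "poly_value (param_point n \<pi>) G \<noteq> 0" "poly_value (param_point n \<pi>') H \<noteq> 0" by blast
  obtain g s y U V where \<pi>: "\<pi> = (g, s, y, U, V)" by (cases \<pi>)
  obtain g' s' y' U' V' where \<pi>': "\<pi>' = (g', s', y', U', V')" by (cases \<pi>')
  \<comment> \<open>the line from \<open>a\<close> at 0 to \<open>b\<close> at 1\<close>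
  define ln where "ln a b = [:a, b - a:]" for a b :: complex
  define cv where "cv t = (\<lambda>k l. poly (ln (g k l) (g' k l)) t, \<lambda>q. poly (ln (s q) (s' q)) t, \<lambda>q i. poly (ln (y q i) (y' q i)) t,
     \<lambda>i j. poly (ln (U i j) (U' i j)) t, \<lambda>i j. poly (ln (V i j) (V' i j)) t)" for t
  define c where "c = (\<lambda>(k, p). if k < 3 \<and> p < (n + 1) choose 2 then
     (case upper_pairs n ! p of (i, j) \<Rightarrow> ln (g k 0) (g' k 0) * (\<Sum>q<n - 2. ln (s q) (s' q) * ln (y q i) (y' q i) * ln (y q j) (y' q j))
       + ln (g k 1) (g' k 1) * ln (U i j) (U' i j) + ln (g k 2) (g' k 2) * ln (V i j) (V' i j)) else 0)"
  have c: "(\<lambda>v. poly (c v) t) = param_point n (cv t)" for t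
    by (auto simp: c_def param_point_def cv_def poly_sum fun_eq_iff split: prod.splits)
  have ends: "cv 0 = \<pi>" "cv 1 = \<pi>'" by (auto simp: cv_def \<pi> \<pi>' ln_def)
  have "poly (curve_poly c G * curve_poly c H) t = 0" for t
    unfolding poly_mult poly_curve_poly c poly_value_mult[symmetric] F[symmetric] by (rule chow_poly_param_point[OF n])
  then have "curve_poly c G * curve_poly c H = 0" by (intro poly_all_0_iff_0[THEN iffD1] allI)
  then have "curve_poly c G = 0 \<or> curve_poly c H = 0" by simp
  moreover have "poly (curve_poly c G) 0 \<noteq> 0" unfolding poly_curve_poly c ends by (rule nz)
  moreover have "poly (curve_poly c H) 1 \<noteq> 0" unfolding poly_curve_poly c ends by (rule nz)
  ultimately show False by auto
qed

section \<open>Lines of diagonalized nets\<close>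

text \<open>The matrix \<open>\<Sum>\<^sub>i l\<^sub>i v\<^sub>i v\<^sub>i\<^sup>T\<close>, where \<open>v\<^sub>0\<close> is the all-ones vector and \<open>v\<^sub>1, \<dots>, v\<^sub>n\<close> are
  the unit vectors; any \<open>n\<close> of these vectors are a basis.\<close>

definition star_mat :: "nat \<Rightarrow> (nat \<Rightarrow> complex) \<Rightarrow> complex mat" where
  "star_mat n l = mat n n (\<lambda>(r, c). l 0 + (if r = c then l (Suc r) else 0))"

definition star_vec :: "nat \<Rightarrow> nat \<Rightarrow> complex" where
  "star_vec i r = (if i = 0 \<or> i = Suc r then 1 else 0)"

lemma star_mat_carrier: "star_mat n l \<in> carrier_mat n n"
  by (simp add: star_mat_def)

lemma star_mat_eq_sum:
  assumes "r < n" "c < n"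
  shows "star_mat n l $$ (r, c) = (\<Sum>i<Suc n. l i * star_vec i r * star_vec i c)"
proof -
  have "(\<Sum>i<Suc n. l i * star_vec i r * star_vec i c) = l 0 + (\<Sum>i<n. l (Suc i) * star_vec (Suc i) r * star_vec (Suc i) c)"
    by (simp add: sum.lessThan_Suc_shift star_vec_def del: sum.lessThan_Suc)
  also have "(\<Sum>i<n. l (Suc i) * star_vec (Suc i) r * star_vec (Suc i) c) = (\<Sum>i<n. if i = r then (if r = c then l (Suc r) else 0) else 0)"
    by (intro sum.cong refl) (auto simp: star_vec_def)
  also have "\<dots> = (if r = c then l (Suc r) else 0)" using assms by simp
  finally show ?thesis using assms by (simp add: star_mat_def)
qed

text \<open>A kernel vector \<open>x\<close> satisfies \<open>l\<^sub>0 \<sigma> + l\<^sub>r\<^sub>+\<^sub>1 x\<^sub>r = 0\<close> for all \<open>r\<close>, where \<open>\<sigma>\<close> is the sum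
  of its entries. A two-dimensional kernel contains a nonzero \<open>x\<close> with \<open>\<sigma> = 0\<close>; it has two nonzero
  entries, so two of the \<open>l\<close> vanish. If \<open>l\<^sub>0 \<noteq> 0\<close>, a kernel vector that is 0 at one of these
  positions again has \<open>\<sigma> = 0\<close> and gives further indices.\<close>

lemma star_mat_corank_2:
  assumes n: "0 < n" and adj: "adj_mat (star_mat n l) = 0\<^sub>m n n"
  shows "\<exists>i j k. i \<le> n \<and> j \<le> n \<and> k \<le> n \<and> i \<noteq> j \<and> i \<noteq> k \<and> j \<noteq> k \<and> l i = 0 \<and> l j = 0 \<and> l k = 0"
proof -
  let ?N = "star_mat n l"
  have N: "?N \<in> carrier_mat n n" by (rule star_mat_carrier)
  obtain u w where u: "u \<in> carrier_vec n" "?N *\<^sub>v u = 0\<^sub>v n" and w: "w \<in> carrier_vec n" "?N *\<^sub>v w = 0\<^sub>v n"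
    and ind: "\<And>a b. (\<forall>i<n. a * u $ i + b * w $ i = 0) \<Longrightarrow> a = 0 \<and> b = 0"
    using two_kernel_vectors_if_adj_mat_eq_0[OF N n adj] by blast
  have row: "l 0 * (\<Sum>c<n. x $ c) + l (Suc r) * x $ r = 0"
    if x: "x \<in> carrier_vec n" "?N *\<^sub>v x = 0\<^sub>v n" and r: "r < n" for x r
  proof -
    have "(?N *\<^sub>v x) $ r = (\<Sum>c<n. l 0 * x $ c + (if c = r then l (Suc r) * x $ r else 0))"
      unfolding index_mult_mat_vec_sum[OF N x(1) r] using r by (intro sum.cong refl) (auto simp: star_mat_def algebra_simps)
    also have "\<dots> = l 0 * (\<Sum>c<n. x $ c) + l (Suc r) * x $ r" using r by (simp add: sum.distrib sum_distrib_left)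
    finally show ?thesis using x(2) r by simp
  qed
  have combo: "\<exists>x. (\<exists>r<n. x r \<noteq> 0) \<and> L x = 0 \<and> (\<forall>r<n. l 0 * (\<Sum>c<n. x c) + l (Suc r) * x r = 0)"
    if L: "\<And>a b. L (\<lambda>r. a * u $ r + b * w $ r) = a * L (\<lambda>r. u $ r) + b * L (\<lambda>r. w $ r)" for L :: "(nat \<Rightarrow> complex) \<Rightarrow> complex"
  proof -
    obtain a b where ab: "a \<noteq> 0 \<or> b \<noteq> 0" "a * L (\<lambda>r. u $ r) + b * L (\<lambda>r. w $ r) = 0"
      by (rule nontrivial_relationE)
    define x where "x r = a * u $ r + b * w $ r" for r
    have "\<exists>r<n. x r \<noteq> 0" using ind[of a b] ab(1) unfolding x_def by blast
    moreover have "L x = 0" using L[of a b] ab(2) unfolding x_def by simp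
    moreover have "l 0 * (\<Sum>c<n. x c) + l (Suc r) * x r = 0" if r: "r < n" for r
    proof -
      have "l 0 * (\<Sum>c<n. x c) + l (Suc r) * x r =
          a * (l 0 * (\<Sum>c<n. u $ c) + l (Suc r) * u $ r) + b * (l 0 * (\<Sum>c<n. w $ c) + l (Suc r) * w $ r)"
        by (simp add: x_def sum.distrib sum_distrib_left[symmetric] algebra_simps)
      then show ?thesis using row[OF u r] row[OF w r] by simp
    qed
    ultimately show ?thesis by blast
  qed
  have "\<exists>x. (\<exists>r<n. x r \<noteq> 0) \<and> (\<Sum>c<n. x c) = 0 \<and> (\<forall>r<n. l 0 * (\<Sum>c<n. x c) + l (Suc r) * x r = 0)"
    by (rule combo[of "\<lambda>x. \<Sum>c<n. x c"]) (simp add: sum.distrib sum_distrib_left)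
  then obtain x where x: "\<exists>r<n. x r \<noteq> 0" "(\<Sum>c<n. x c) = 0" "\<forall>r<n. l 0 * (\<Sum>c<n. x c) + l (Suc r) * x r = 0" by blast
  have second: "\<exists>r'<n. r' \<noteq> r \<and> x r' \<noteq> 0" if "r < n" "x r \<noteq> 0" "(\<Sum>c<n. x c) = 0" for r and x :: "nat \<Rightarrow> complex"
  proof (rule ccontr)
    assume no: "\<not> ?thesis"
    have "(\<Sum>c<n. x c) = (\<Sum>c<n. if c = r then x r else 0)" using no by (intro sum.cong refl) auto
    then show False using that by simp
  qed
  obtain r where r: "r < n" "x r \<noteq> 0" using x(1) by blast
  obtain r' where r': "r' < n" "r' \<noteq> r" "x r' \<noteq> 0" using second[OF r x(2)] by blast
  have lr: "l (Suc r) = 0" "l (Suc r') = 0" using x(2,3) r r' by auto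
  show ?thesis
  proof (cases "l 0 = 0")
    case True
    then show ?thesis using lr r r' by (intro exI[of _ 0] exI[of _ "Suc r"] exI[of _ "Suc r'"]) auto
  next
    case l0: False
    have "\<exists>z. (\<exists>s<n. z s \<noteq> 0) \<and> z r = 0 \<and> (\<forall>s<n. l 0 * (\<Sum>c<n. z c) + l (Suc s) * z s = 0)"
      by (rule combo[of "\<lambda>x. x r"]) simp
    then obtain z where z: "\<exists>s<n. z s \<noteq> 0" "z r = 0" "\<forall>s<n. l 0 * (\<Sum>c<n. z c) + l (Suc s) * z s = 0" by blast
    have "l 0 * (\<Sum>c<n. z c) = 0" using z(3)[rule_format, OF r(1)] z(2) by simp
    then have zs: "(\<Sum>c<n. z c) = 0" using l0 by simp
    obtain s where s: "s < n" "z s \<noteq> 0" using z(1) by blast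
    obtain s' where s': "s' < n" "s' \<noteq> s" "z s' \<noteq> 0" using second[OF s zs] by blast
    have "l (Suc s) = 0" "l (Suc s') = 0" using z(3)[rule_format, OF s(1)] z(3)[rule_format, OF s'(1)] zs s s' by auto
    moreover have "s \<noteq> r" "s' \<noteq> r" using s s' z(2) by auto
    ultimately show ?thesis using lr r s s'
      by (intro exI[of _ "Suc r"] exI[of _ "Suc s"] exI[of _ "Suc s'"]) auto
  qed
qed

text \<open>Distinct positive numbers whose subset sums are distinct.\<close>

definition node :: "nat \<Rightarrow> complex" where
  "node i = of_nat (2 ^ i)"

text \<open>The net whose linear forms are \<open>l\<^sub>i = x + y a\<^sub>i + z (a\<^sub>i\<^sup>3 + t a\<^sub>i\<^sup>2)\<close> with \<open>a\<^sub>i = node i\<close>,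
  where the matrix number \<open>k0\<close> is the coefficient of \<open>z\<close>: only this matrix moves with \<open>t\<close>. Three
  of the \<open>l\<^sub>i\<close> have a common nonzero zero iff a nonzero polynomial \<open>x + y a + z (a\<^sup>3 + t a\<^sup>2)\<close>
  vanishes at three of the \<open>a\<^sub>i\<close>, that is, iff \<open>- t\<close> is the sum of these three.\<close>

definition line_coeff :: "nat \<Rightarrow> nat \<Rightarrow> nat \<Rightarrow> complex poly" where
  "line_coeff k0 k i = (if k = k0 then [:node i ^ 3, node i ^ 2:] else if k = (if k0 = 0 then 1 else 0) then [:1:] else [:node i:])"

definition line_curve :: "nat \<Rightarrow> nat \<Rightarrow> nat \<times> nat \<Rightarrow> complex poly" where
  "line_curve n k0 = (\<lambda>(k, p). if k < 3 \<and> p < (n + 1) choose 2 then (case upper_pairs n ! p of (r, c) \<Rightarrow>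
     \<Sum>i<Suc n. line_coeff k0 k i * [:star_vec i r * star_vec i c:]) else 0)"

lemma degree_line_curve: "degree (line_curve n k0 v) \<le> (if fst v = k0 then 1 else 0)"
proof -
  obtain k p where v: "v = (k, p)" by (cases v)
  have 1: "degree (line_coeff k0 k i * [:x:]) \<le> (if k = k0 then 1 else 0)" for i x
    by (rule order_trans[OF degree_mult_le]) (auto simp: line_coeff_def)
  show ?thesis
  proof (cases "k < 3 \<and> p < (n + 1) choose 2")
    case True
    obtain r c where rc: "upper_pairs n ! p = (r, c)" by (cases "upper_pairs n ! p")
    have "line_curve n k0 v = (\<Sum>i<Suc n. line_coeff k0 k i * [:star_vec i r * star_vec i c:])"
      using True by (simp add: line_curve_def v rc del: sum.lessThan_Suc)
    then show ?thesis unfolding v fst_conv by (simp only:) (rule degree_sum_le[OF finite_lessThan 1])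
  next
    case False
    then show ?thesis by (auto simp: line_curve_def v)
  qed
qed

lemma sym_of_line_curve:
  assumes k: "k < 3"
  shows "sym_of n (\<lambda>v. poly (line_curve n k0 v) t) k = star_mat n (\<lambda>i. poly (line_coeff k0 k i) t)"
proof (rule eq_matI)
  fix r c assume "r < dim_row (star_mat n (\<lambda>i. poly (line_coeff k0 k i) t))" "c < dim_col (star_mat n (\<lambda>i. poly (line_coeff k0 k i) t))"
  then have rc: "r < n" "c < n" by (auto simp: star_mat_def)
  have le: "min r c \<le> max r c" "max r c < n" using rc by auto
  have p: "pair_index r c = pair_index (min r c) (max r c)" by (simp add: pair_index_def)
  have comm: "star_vec i (min r c) * star_vec i (max r c) = star_vec i r * star_vec i c" for i
    by (cases "r \<le> c") (auto simp: min_def max_def mult.commute)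
  have "sym_of n (\<lambda>v. poly (line_curve n k0 v) t) k $$ (r, c) = (\<Sum>i<Suc n. poly (line_coeff k0 k i) t * (star_vec i (min r c) * star_vec i (max r c)))"
    using k rc pair_index_less[OF le] upper_pairs_nth_pair_index[OF le]
    by (simp add: sym_of_def line_curve_def p poly_sum mult_ac del: sum.lessThan_Suc)
  also have "\<dots> = star_mat n (\<lambda>i. poly (line_coeff k0 k i) t) $$ (r, c)"
    unfolding star_mat_eq_sum[OF rc] comm by (simp only: mult.assoc)
  finally show "sym_of n (\<lambda>v. poly (line_curve n k0 v) t) k $$ (r, c) = star_mat n (\<lambda>i. poly (line_coeff k0 k i) t) $$ (r, c)" .
qed (auto simp: star_mat_def sym_of_def)

lemma cubic_three_roots:
  fixes p q r x y z :: "'a::field"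
  assumes "x + y * p + z * p ^ 3 = 0" "x + y * q + z * q ^ 3 = 0" "x + y * r + z * r ^ 3 = 0"
    "p \<noteq> q" "p \<noteq> r" "q \<noteq> r" "p + q + r \<noteq> 0"
  shows "x = 0 \<and> y = 0 \<and> z = 0"
proof -
  have f: "(p - q) * (y + z * (p ^ 2 + p * q + q ^ 2)) = (x + y * p + z * p ^ 3) - (x + y * q + z * q ^ 3)" for p q :: 'a
    by (simp add: algebra_simps power2_eq_square power3_eq_cube)
  have "(p - q) * (y + z * (p ^ 2 + p * q + q ^ 2)) = 0" unfolding f assms(1,2) by simp
  then have 1: "y + z * (p ^ 2 + p * q + q ^ 2) = 0" using assms(4) by simp
  have "(p - r) * (y + z * (p ^ 2 + p * r + r ^ 2)) = 0" unfolding f assms(1,3) by simp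
  then have 2: "y + z * (p ^ 2 + p * r + r ^ 2) = 0" using assms(5) by simp
  have "z * ((q - r) * (p + q + r)) = (y + z * (p ^ 2 + p * q + q ^ 2)) - (y + z * (p ^ 2 + p * r + r ^ 2))"
    by (simp add: algebra_simps power2_eq_square)
  then have "z * ((q - r) * (p + q + r)) = 0" unfolding 1 2 by simp
  then have "z = 0" using assms(6,7) by simp
  then show ?thesis using 1 assms(1) by simp
qed

lemma node_inject: "node i = node j \<longleftrightarrow> i = j"
  unfolding node_def by (simp only: of_nat_eq_iff) simp

lemma node_sum_nonzero: "node i + node j + node k \<noteq> 0"
proof -
  have "node i + node j + node k = of_nat (2 ^ i + 2 ^ j + 2 ^ k)" by (simp add: node_def)
  also have "\<dots> \<noteq> 0" by (simp only: of_nat_eq_0_iff) simp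
  finally show ?thesis .
qed

text \<open>At \<open>t = 0\<close> no three of the \<open>a\<^sub>i\<close> are the roots of a cubic polynomial of this shape, because
  their sum is positive; so no point of the net has corank 2.\<close>

lemma chow_poly_line_nonzero:
  assumes n: "1 \<le> n" and k0: "k0 < 3"
  shows "poly_value (\<lambda>v. poly (line_curve n k0 v) 0) (chow_poly n) \<noteq> 0"
proof
  let ?S = "\<lambda>k. star_mat n (\<lambda>i. poly (line_coeff k0 k i) 0)"
  assume "poly_value (\<lambda>v. poly (line_curve n k0 v) 0) (chow_poly n) = 0"
  then have "det (chow_mat n (?S 0) (?S 1) (?S 2)) = 0"
    by (simp add: poly_value_chow_poly[OF n] sym_of_line_curve)
  moreover have S: "?S k \<in> carrier_mat n n" "transpose_mat (?S k) = ?S k" for k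
    by (auto simp: star_mat_def intro!: eq_matI)
  ultimately obtain a b c where abc: "a \<noteq> 0 \<or> b \<noteq> 0 \<or> c \<noteq> 0" "adj_mat (net_point (?S 0) (?S 1) (?S 2) a b c) = 0\<^sub>m n n"
    using det_chow_mat_eq_0_iff[OF n S[of 0] S[of 1] S[of 2]] by auto
  define l where "l i = a * poly (line_coeff k0 0 i) 0 + b * poly (line_coeff k0 1 i) 0 + c * poly (line_coeff k0 2 i) 0" for i
  have "net_point (?S 0) (?S 1) (?S 2) a b c = star_mat n l"
    by (rule eq_matI) (auto simp: net_point_def star_mat_def l_def algebra_simps)
  then obtain i j k where ijk: "i \<noteq> j" "i \<noteq> k" "j \<noteq> k" "l i = 0" "l j = 0" "l k = 0"
    using star_mat_corank_2[of n l] abc(2) n by auto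
  have ne: "node i \<noteq> node j" "node i \<noteq> node k" "node j \<noteq> node k" using ijk by (auto simp: node_inject)
  consider "k0 = 0" | "k0 = 1" | "k0 = 2" using k0 by linarith
  then have "a = 0 \<and> b = 0 \<and> c = 0"
  proof cases
    case 1
    then have "l i = b + c * node i + a * node i ^ 3" for i by (simp add: l_def line_coeff_def)
    then show ?thesis using cubic_three_roots[of b c "node i" a "node j" "node k"] ijk ne node_sum_nonzero by auto
  next
    case 2
    then have "l i = a + c * node i + b * node i ^ 3" for i by (simp add: l_def line_coeff_def)
    then show ?thesis using cubic_three_roots[of a c "node i" b "node j" "node k"] ijk ne node_sum_nonzero by auto
  next
    case 3
    then have "l i = a + b * node i + c * node i ^ 3" for i by (simp add: l_def line_coeff_def)
    then show ?thesis using cubic_three_roots[of a b "node i" c "node j" "node k"] ijk ne node_sum_nonzero by auto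
  qed
  then show False using abc(1) by simp
qed

text \<open>The cubic polynomial with the roots \<open>a\<^sub>i\<close>, \<open>i \<in> T\<close>, has the form \<open>a\<^sup>3 + t a\<^sup>2 + y a + x\<close>.
  Its values are the \<open>l\<^sub>i\<close> of a point of the net, so this point is a combination of the \<open>n - 2\<close>
  squares of the \<open>v\<^sub>i\<close> with \<open>i \<notin> T\<close>. With the other two spanning matrices it is a basis of the
  net.\<close>

lemma line_meets_params:
  assumes n: "2 \<le> n" and k0: "k0 < 3" and T: "T \<subseteq> {..<Suc n}" "card T = 3"
  shows "\<exists>\<pi>. (\<lambda>v. poly (line_curve n k0 v) (- (\<Sum>i\<in>T. node i))) = param_point n \<pi>"
proof -
  obtain i1 i2 i3 where T3: "T = {i1, i2, i3}" "i1 \<noteq> i2" "i1 \<noteq> i3" "i2 \<noteq> i3" using T(2) by (auto simp: card_3_iff)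
  let ?p = "node i1" and ?q = "node i2" and ?r = "node i3"
  define t where "t = - (\<Sum>i\<in>T. node i)"
  have t: "t = - (?p + ?q + ?r)" using T3 by (simp add: t_def)
  define x where "x = - (?p * ?q * ?r)"
  define y where "y = ?p * ?q + ?p * ?r + ?q * ?r"
  \<comment> \<open>the coefficients of the point at which three of the linear forms vanish\<close>
  define l where "l i = x + y * node i + (node i ^ 3 + t * node i ^ 2)" for i
  have l_fact: "l i = (node i - ?p) * (node i - ?q) * (node i - ?r)" for i
    unfolding l_def x_def y_def t by (simp add: algebra_simps power2_eq_square power3_eq_cube)
  have finT: "finite T" using T(1) finite_subset by blast
  have "card ({..<Suc n} - T) = n - 2" using card_Diff_subset[OF finT T(1)] T(2) by simp
  then obtain e where e: "bij_betw e {..<n - 2} ({..<Suc n} - T)"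
    using ex_bij_betw_nat_finite[of "{..<Suc n} - T"] by (auto simp: atLeast0LessThan)
  \<comment> \<open>the number of the matrix that is the coefficient of \<open>x\<close>\<close>
  define k1 where "k1 = (if k0 = 0 then 1 else 0 :: nat)"
  \<comment> \<open>the point with coordinates \<open>x\<close>, \<open>y\<close>, \<open>1\<close> is the matrix of corank 2; solve for the
    matrix number \<open>k0\<close>, the other two being \<open>U\<close> and \<open>V\<close>\<close>
  define g where "g k m = (if k = k0 then (if m = 0 then 1 else if m = 1 then - x else - y) else if k = k1 then (if m = 1 then 1 else 0)
     else (if m = 2 then 1 else 0))" for k m :: nat
  define U where "U r c = (\<Sum>i<Suc n. star_vec i r * star_vec i c)" for r c
  define V where "V r c = (\<Sum>i<Suc n. node i * (star_vec i r * star_vec i c))" for r c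
  define \<pi> where "\<pi> = (g, \<lambda>q. l (e q), \<lambda>q. star_vec (e q), U, V)"
  have gram: "(\<Sum>q<n - 2. l (e q) * star_vec (e q) r * star_vec (e q) c) = (\<Sum>i<Suc n. l i * (star_vec i r * star_vec i c))" for r c
  proof -
    have "(\<Sum>q<n - 2. l (e q) * star_vec (e q) r * star_vec (e q) c) = (\<Sum>i\<in>{..<Suc n} - T. l i * (star_vec i r * star_vec i c))"
      using sum.reindex_bij_betw[OF e, of "\<lambda>i. l i * (star_vec i r * star_vec i c)"] by (simp add: mult.assoc)
    also have "\<dots> = (\<Sum>i<Suc n. l i * (star_vec i r * star_vec i c))"
      by (rule sum.mono_neutral_left) (auto simp: l_fact T3(1))
    finally show ?thesis .
  qed
  have "poly (line_curve n k0 (k, p)) t = param_point n \<pi> (k, p)" for k p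
  proof (cases "k < 3 \<and> p < (n + 1) choose 2")
    case True
    obtain r c where rc: "upper_pairs n ! p = (r, c)" by (cases "upper_pairs n ! p")
    let ?v = "\<lambda>i. star_vec i r * star_vec i c"
    have lhs: "poly (line_curve n k0 (k, p)) t = (\<Sum>i<Suc n. poly (line_coeff k0 k i) t * ?v i)"
      using True by (simp add: line_curve_def rc poly_sum mult_ac del: sum.lessThan_Suc)
    have rhs: "param_point n \<pi> (k, p) = g k 0 * (\<Sum>i<Suc n. l i * ?v i) + g k 1 * U r c + g k 2 * V r c"
      using True by (simp add: param_point_def \<pi>_def rc gram del: sum.lessThan_Suc)
    show ?thesis
    proof (cases "k = k0")
      case True
      have "(\<Sum>i<Suc n. poly (line_coeff k0 k i) t * ?v i) = (\<Sum>i<Suc n. l i * ?v i + (- x) * ?v i + (- y) * (node i * ?v i))"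
        using True by (intro sum.cong refl) (simp add: line_coeff_def l_def algebra_simps)
      also have "\<dots> = (\<Sum>i<Suc n. l i * ?v i) + (- x) * U r c + (- y) * V r c"
        unfolding U_def V_def sum_distrib_left sum.distrib ..
      finally show ?thesis using True unfolding lhs rhs by (simp add: g_def)
    next
      case False
      then show ?thesis unfolding lhs rhs by (auto simp: g_def line_coeff_def k1_def U_def V_def simp del: sum.lessThan_Suc)
    qed
  next
    case False
    then show ?thesis by (auto simp: line_curve_def param_point_def \<pi>_def)
  qed
  then show ?thesis unfolding t_def[symmetric] by (intro exI[of _ \<pi>] ext) (metis surj_pair)
qed

section \<open>Irreducibility\<close>

text \<open>On the line of nets, \<open>G\<close> has at least one root for each of the \<open>(n + 1) choose 3\<close>
  three-element sets of indices. It is not identically zero on the line, because \<open>F\<close> is nonzero at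
  \<open>t = 0\<close>.\<close>

lemma block_degree_ge_of_vanishing_factor:
  assumes n: "2 \<le> n" and k0: "k0 < 3" and F: "chow_poly n = G * H" and G: "\<And>\<pi>. poly_value (param_point n \<pi>) G = 0"
  shows "\<exists>a\<in>Poly_Mapping.keys G. (n + 1) choose 3 \<le> block_degree k0 a"
proof (rule ccontr)
  assume neg: "\<not> ?thesis"
  let ?N = "(n + 1) choose 3"
  let ?P = "curve_poly (line_curve n k0) G"
  have N: "0 < ?N" using n by simp
  have "degree ?P \<le> ?N - 1"
  proof (rule degree_curve_poly_le[OF degree_line_curve])
    fix m assume "m \<in> Poly_Mapping.keys G"
    then have "\<not> ?N \<le> block_degree k0 m" using neg by blast
    then show "block_degree k0 m \<le> ?N - 1" by simp
  qed
  have "poly ?P 0 \<noteq> 0"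
    using chow_poly_line_nonzero[of n k0] n k0 unfolding F poly_value_mult poly_curve_poly by simp
  then have P0: "?P \<noteq> 0" by auto
  define \<tau> where "\<tau> T = - (\<Sum>i\<in>T. node i)" for T
  let ?TT = "{T. T \<subseteq> {..<Suc n} \<and> card T = 3}"
  have "inj_on \<tau> ?TT"
  proof (rule inj_onI)
    fix T T' assume T: "T \<in> ?TT" "T' \<in> ?TT" "\<tau> T = \<tau> T'"
    have fin: "finite T" "finite T'" using T(1,2) finite_subset by blast+
    have e: "(\<Sum>i\<in>T. node i) = of_nat (set_encode T)" for T by (simp add: set_encode_def node_def)
    have "set_encode T = set_encode T'" using T(3) unfolding \<tau>_def e by (metis neg_equal_iff_equal of_nat_eq_iff)
    then show "T = T'" using set_encode_eq[OF fin] by simp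
  qed
  then have "card (\<tau> ` ?TT) = card ?TT" by (rule card_image)
  also have "\<dots> = ?N" using n_subsets[of "{..<Suc n}" 3] by simp
  finally have "?N = card (\<tau> ` ?TT)" ..
  also have "\<dots> \<le> card {t. poly ?P t = 0}"
  proof (rule card_mono[OF poly_roots_finite[OF P0]])
    show "\<tau> ` ?TT \<subseteq> {t. poly ?P t = 0}"
    proof (intro subsetI, elim imageE)
      fix t T assume t: "t = \<tau> T" "T \<in> ?TT"
      then obtain \<pi> where "(\<lambda>v. poly (line_curve n k0 v) t) = param_point n \<pi>"
        using line_meets_params[OF n k0, of T] by (auto simp: \<tau>_def)
      then show "t \<in> {t. poly ?P t = 0}" using G by (simp add: poly_curve_poly)
    qed
  qed
  also have "\<dots> \<le> degree ?P" by (rule card_poly_roots_bound[OF P0])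
  finally show False using \<open>degree ?P \<le> ?N - 1\<close> N by arith
qed

text \<open>\<open>G\<close> has a monomial of the full degree of \<open>F\<close> in each block, so \<open>H\<close> has degree 0 in each
  block by the additivity of leading terms.\<close>

lemma cofactor_of_vanishing_factor_is_unit:
  assumes n: "2 \<le> n" and F: "chow_poly n = G * H" and G: "\<And>\<pi>. poly_value (param_point n \<pi>) G = 0"
  shows "H dvd 1"
proof -
  let ?N = "(n + 1) choose 3"
  have n1: "1 \<le> n" using n by simp
  have bd: "block_degree k b = 0" if b: "b \<in> Poly_Mapping.keys H" for k b
  proof -
    obtain a where a: "a \<in> Poly_Mapping.keys G" "(if k < 3 then ?N else 0) \<le> block_degree k a"
    proof (cases "k < 3")
      case True
      then show ?thesis using block_degree_ge_of_vanishing_factor[OF n True F G] that by auto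
    next
      case False
      obtain a where "a \<in> Poly_Mapping.keys G" using block_degree_ge_of_vanishing_factor[OF n _ F G, of 0] by auto
      then show ?thesis using that False by simp
    qed
    obtain \<mu> where \<mu>: "\<mu> \<in> Poly_Mapping.keys (G * H)" "block_degree k a + block_degree k b \<le> block_degree k \<mu>"
      using ex_keys_mult_weight_ge[of "block_degree k", OF block_degree_add a(1) b] by blast
    have "block_degree k \<mu> = (if k < 3 then ?N else 0)" using keys_chow_poly(2)[OF n1, of \<mu> k] \<mu>(1) F by simp
    then show ?thesis using a(2) \<mu>(2) by linarith
  qed
  have b0: "b = 0" if b: "b \<in> Poly_Mapping.keys H" for b
  proof (rule poly_mapping_eqI)
    fix v
    show "Poly_Mapping.lookup b v = Poly_Mapping.lookup 0 v"
    proof (rule ccontr)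
      assume "\<not> ?thesis"
      then have v: "v \<in> Poly_Mapping.keys b" by (simp add: in_keys_iff)
      have "Poly_Mapping.lookup b v \<le> block_degree (fst v) b"
        unfolding block_degree_def using member_le_sum[OF v, of "\<lambda>u. if fst u = fst v then Poly_Mapping.lookup b u else 0"] by simp
      then show False using bd[OF b] v by (simp add: in_keys_iff)
    qed
  qed
  have "Poly_Mapping.keys H \<subseteq> {0}" using b0 by blast
  then have H: "H = Poly_Mapping.single 0 (Poly_Mapping.lookup H 0)" using sum_single_lookup[of "{0}" H] by simp
  have "H \<noteq> 0"
    using chow_poly_line_nonzero[of n 0] n F by auto
  then have c: "Poly_Mapping.lookup H 0 \<noteq> 0" using H by auto
  have "H * Poly_Mapping.single 0 (inverse (Poly_Mapping.lookup H 0)) = 1"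
    by (subst H) (use c in \<open>simp add: mult_single\<close>)
  then show ?thesis by (metis dvd_triv_left)
qed

text \<open>A unit would not vanish anywhere, whereas the Chow polynomial vanishes at all nets with a
  point of corank 2, and so does one of the factors in any factorization.\<close>

theorem irreducible_chow_poly:
  assumes n: "2 \<le> n"
  shows "Factorial_Ring.irreducible (chow_poly n)"
  unfolding Factorial_Ring.irreducible_def
proof (intro conjI allI impI)
  show "chow_poly n \<noteq> 0" using chow_poly_line_nonzero[of n 0] n by auto
  show "\<not> chow_poly n dvd 1"
  proof
    assume "chow_poly n dvd 1"
    then obtain K where K: "chow_poly n * K = 1" by (metis dvdE)
    have "poly_value (param_point n undefined) (chow_poly n * K) = 0" unfolding poly_value_mult chow_poly_param_point[OF n] by simp
    then show False unfolding K by simp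
  qed
  fix G H assume F: "chow_poly n = G * H"
  show "G dvd 1 \<or> H dvd 1"
    using factor_vanishes_on_params[OF n F]
  proof
    assume "\<forall>\<pi>. poly_value (param_point n \<pi>) G = 0"
    then have "H dvd 1" by (intro cofactor_of_vanishing_factor_is_unit[OF n F]) blast
    then show ?thesis ..
  next
    assume H: "\<forall>\<pi>. poly_value (param_point n \<pi>) H = 0"
    have "chow_poly n = H * G" using F by (simp only: mult.commute)
    then have "G dvd 1" using H by (intro cofactor_of_vanishing_factor_is_unit[OF n]) blast+
    then show ?thesis ..
  qed
qed

section \<open>Invariance in dual Stiefel coordinates\<close>

abbreviation (input) sym_row :: "nat \<Rightarrow> complex mat \<Rightarrow> nat \<Rightarrow> complex mat" where
  "sym_row n M \<equiv> sym_of n (\<lambda>v. M $$ v)"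

lemma stiefel_value_chow_poly:
  assumes "1 \<le> n"
  shows "stiefel_value (chow_poly n) M = det (chow_mat n (sym_row n M 0) (sym_row n M 1) (sym_row n M 2))"
  unfolding stiefel_value_def by (rule poly_value_chow_poly[OF assms])

lemma sum_3: "(\<Sum>k<3. f k) = f 0 + f 1 + f (2::nat)" for f :: "nat \<Rightarrow> 'a::comm_monoid_add"
  by (simp add: numeral_3_eq_3 numeral_2_eq_2)

lemma sym_row_mult:
  assumes g: "g \<in> carrier_mat 3 3" and M: "M \<in> carrier_mat 3 ((n + 1) choose 2)" and k: "k < 3"
  shows "sym_row n (g * M) k = net_row g (sym_row n M 0) (sym_row n M 1) (sym_row n M 2) k"
proof (rule eq_matI)
  let ?N = "net_row g (sym_row n M 0) (sym_row n M 1) (sym_row n M 2) k"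
  have N: "?N \<in> carrier_mat n n" unfolding net_row_def by (intro net_point_carrier sym_of_carrier)
  fix i j assume "i < dim_row ?N" "j < dim_col ?N"
  then have ij: "i < n" "j < n" using N by auto
  have "sym_row n (g * M) k $$ (i, j) = (g * M) $$ (k, pair_index i j)" using ij by (simp add: sym_of_def)
  also have "\<dots> = (\<Sum>l<3. g $$ (k, l) * M $$ (l, pair_index i j))"
    by (rule index_mult_mat_sum[OF g M k pair_index_less'[OF ij]])
  also have "\<dots> = ?N $$ (i, j)"
    unfolding net_row_def net_point_index[OF sym_of_carrier sym_of_carrier sym_of_carrier ij] sum_3
    using ij by (simp add: sym_of_def)
  finally show "sym_row n (g * M) k $$ (i, j) = ?N $$ (i, j)" .
qed (auto simp: sym_of_def net_row_def net_point_def)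

lemma stiefel_value_mult:
  assumes n: "1 \<le> n" and g: "g \<in> carrier_mat 3 3" and M: "M \<in> carrier_mat 3 ((n + 1) choose 2)"
  shows "stiefel_value (chow_poly n) (g * M) = subst_char n g * stiefel_value (chow_poly n) M"
proof -
  have k: "0 < (3::nat)" "1 < (3::nat)" "2 < (3::nat)" by simp_all
  show ?thesis
    unfolding stiefel_value_chow_poly[OF n] sym_row_mult[OF g M k(1)] sym_row_mult[OF g M k(2)] sym_row_mult[OF g M k(3)]
    by (rule det_chow_mat_net_row[OF sym_of_carrier sym_of_carrier sym_of_carrier n])
qed

lemma ex_stiefel_value_nonzero:
  assumes n: "1 \<le> n"
  shows "\<exists>M\<in>carrier_mat 3 ((n + 1) choose 2). stiefel_value (chow_poly n) M \<noteq> 0"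
proof
  define M where "M = mat 3 ((n + 1) choose 2) (\<lambda>v. poly (line_curve n 0 v) 0)"
  show "M \<in> carrier_mat 3 ((n + 1) choose 2)" by (simp add: M_def)
  have "sym_row n M k = sym_of n (\<lambda>v. poly (line_curve n 0 v) 0) k" if "k < 3" for k
    using that pair_index_less' by (intro eq_matI) (auto simp: sym_of_def M_def)
  then have "stiefel_value (chow_poly n) M = poly_value (\<lambda>v. poly (line_curve n 0 v) 0) (chow_poly n)"
    unfolding stiefel_value_chow_poly[OF n] poly_value_chow_poly[OF n] by simp
  then show "stiefel_value (chow_poly n) M \<noteq> 0" using chow_poly_line_nonzero[OF n, of 0] by simp
qed

text \<open>The factor is determined by the transformation law at one net with nonzero Chow
  determinant.\<close>

lemma subst_char_mult:
  assumes n: "1 \<le> n" and g: "g \<in> carrier_mat 3 3" and h: "h \<in> carrier_mat 3 3"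
  shows "subst_char n (g * h) = subst_char n g * subst_char n h"
proof -
  obtain M where M: "M \<in> carrier_mat 3 ((n + 1) choose 2)" "stiefel_value (chow_poly n) M \<noteq> 0"
    using ex_stiefel_value_nonzero[OF n] by blast
  have hM: "h * M \<in> carrier_mat 3 ((n + 1) choose 2)" by (rule mult_carrier_mat[OF h M(1)])
  have "subst_char n (g * h) * stiefel_value (chow_poly n) M = stiefel_value (chow_poly n) (g * (h * M))"
    using stiefel_value_mult[OF n mult_carrier_mat[OF g h] M(1)] assoc_mult_mat[OF g h M(1)] by simp
  also have "\<dots> = subst_char n g * subst_char n h * stiefel_value (chow_poly n) M"
    using stiefel_value_mult[OF n g hM] stiefel_value_mult[OF n h M(1)] by simp
  finally show ?thesis using M(2) by simp
qed

text \<open>Conjugation of \<open>U\<close> by \<open>diag (1, s, s\<^sup>2)\<close> scales the entry at \<open>(i, j)\<close> by a power of \<open>s\<close> and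
  does not change the value of the character. For \<open>s\<close> tending to 0 only the diagonal is left.\<close>

lemma subst_char_upper_triangular:
  assumes n: "1 \<le> n" and U: "U \<in> carrier_mat 3 3" and ut: "\<And>i j. i < 3 \<Longrightarrow> j < i \<Longrightarrow> U $$ (i, j) = 0"
  shows "subst_char n U = (U $$ (0, 0) * U $$ (1, 1) * U $$ (2, 2)) ^ ((n + 1) choose 3)"
proof -
  let ?N = "(n + 1) choose 3" and ?m = "(n + 1) choose 2"
  define D where "D s = mat 3 3 (\<lambda>(i, j). if i = j then s ^ i else 0)" for s :: complex
  define V where "V s = mat 3 3 (\<lambda>(i, j). if i \<le> j then s ^ (j - i) * U $$ (i, j) else 0)" for s
  have D: "D s \<in> carrier_mat 3 3" and V: "V s \<in> carrier_mat 3 3" for s by (auto simp: D_def V_def)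
  have "D s * V s = U * D s" for s
  proof (rule eq_matI)
    fix i j assume "i < dim_row (U * D s)" "j < dim_col (U * D s)"
    then have ij: "i < 3" "j < 3" using U by (auto simp: D_def)
    have "(D s * V s) $$ (i, j) = (\<Sum>l<3. if l = i then s ^ i * V s $$ (i, j) else 0)"
      unfolding index_mult_mat_sum[OF D V ij] using ij by (intro sum.cong refl) (auto simp: D_def)
    also have "\<dots> = s ^ i * V s $$ (i, j)" using ij by simp
    also have "\<dots> = U $$ (i, j) * s ^ j"
    proof (cases "i \<le> j")
      case True
      then have "s ^ i * s ^ (j - i) = s ^ j" by (simp flip: power_add)
      then have "s ^ i * (s ^ (j - i) * U $$ (i, j)) = s ^ j * U $$ (i, j)" by (simp flip: mult.assoc)
      then show ?thesis using True ij by (simp add: V_def mult.commute)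
    next
      case False
      then show ?thesis using ut[of i j] ij by (simp add: V_def)
    qed
    also have "\<dots> = (\<Sum>l<3. if l = j then U $$ (i, j) * s ^ j else 0)" using ij by simp
    also have "\<dots> = (U * D s) $$ (i, j)"
      unfolding index_mult_mat_sum[OF U D ij] using ij by (intro sum.cong refl) (auto simp: D_def)
    finally show "(D s * V s) $$ (i, j) = (U * D s) $$ (i, j)" .
  qed (use U in \<open>auto simp: D_def V_def\<close>)
  then have conj: "subst_char n (D s) * subst_char n (V s) = subst_char n U * subst_char n (D s)" for s
    by (metis subst_char_mult[OF n D V] subst_char_mult[OF n U D])
  have "subst_char n (D s) = (s ^ 3) ^ ?N" for s
  proof -
    have "subst_char n (D s) = (D s $$ (0, 0) * D s $$ (1, 1) * D s $$ (2, 2)) ^ ?N"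
      by (rule subst_char_diag[OF n D]) (auto simp: D_def)
    also have "D s $$ (0, 0) * D s $$ (1, 1) * D s $$ (2, 2) = s ^ 3"
      by (simp add: D_def power3_eq_cube power2_eq_square)
    finally show ?thesis .
  qed
  then have VU: "subst_char n (V s) = subst_char n U" if "s \<noteq> 0" for s
    using conj[of s] that by simp
  have ent: "(\<lambda>s. V s $$ (i, j)) = (\<lambda>s. if i \<le> j then s ^ (j - i) * U $$ (i, j) else 0)" if "i < 3" "j < 3" for i j
    using that by (simp add: V_def)
  have cV: "continuous_on UNIV (\<lambda>s. V s $$ (i, j))" if "i < 3" "j < 3" for i j
    unfolding ent[OF that] by (cases "i \<le> j") (auto intro!: continuous_intros)
  have "(\<lambda>s. det (subst_mat n (V s))) \<in> {f. continuous_on UNIV f}"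
  proof (rule det_mem_fun_algebra[where n = ?m])
    show "subst_mat n (V s) \<in> carrier_mat ?m ?m" for s by (simp add: subst_mat_def)
    fix r q assume rq: "r < ?m" "q < ?m"
    have "ternary_monoms (n - 1) ! r \<in> set (ternary_monoms (n - 1))"
      using rq n by (intro nth_mem) (simp add: length_ternary_monoms)
    then obtain i j k where m: "ternary_monoms (n - 1) ! r = ternary_monom i j k" by (auto simp: set_ternary_monoms)
    define L where "L s l = V s $$ (0, l) + 2 ^ q * V s $$ (1, l) + 2 ^ (q * n) * V s $$ (2, l)" for s l
    have cL: "continuous_on UNIV (\<lambda>s. L s l)" if "l < 3" for l
      unfolding L_def using that by (intro continuous_intros cV) auto
    have eq: "(\<lambda>s. subst_mat n (V s) $$ (r, q)) = (\<lambda>s. L s 0 ^ i * L s 1 ^ j * L s 2 ^ k)"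
      using rq by (simp add: subst_mat_def monom_vec_def m monom_value_ternary_monom L_def del: One_nat_def)
    have "continuous_on UNIV (\<lambda>s. L s 0 ^ i * L s 1 ^ j * L s 2 ^ k)" by (intro continuous_intros cL) auto
    then show "(\<lambda>s. subst_mat n (V s) $$ (r, q)) \<in> {f. continuous_on UNIV f}" unfolding eq by simp
  qed (auto intro: continuous_intros)
  then have "continuous_on UNIV (\<lambda>s. subst_char n (V s))"
    unfolding subst_char_def by (intro continuous_intros) (use det_node_mat[OF n] in auto)
  then have "isCont (\<lambda>s. subst_char n (V s)) 0" by (simp add: continuous_on_eq_continuous_at)
  then have "((\<lambda>s. subst_char n (V s)) \<longlongrightarrow> subst_char n (V 0)) (at 0)" by (simp add: isCont_def)
  moreover have "((\<lambda>s. subst_char n (V s)) \<longlongrightarrow> subst_char n U) (at 0)"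
    by (rule tendsto_eventually) (simp add: eventually_at_filter VU)
  ultimately have "subst_char n U = subst_char n (V 0)" using tendsto_unique[OF at_neq_bot] by blast
  also have "\<dots> = (V 0 $$ (0, 0) * V 0 $$ (1, 1) * V 0 $$ (2, 2)) ^ ?N"
    by (rule subst_char_diag[OF n V]) (auto simp: V_def)
  finally show ?thesis by (simp add: V_def)
qed

text \<open>A multiplicative function is invariant under conjugation, and every complex matrix is
  similar to an upper triangular one.\<close>

lemma subst_char_eq_det_power:
  assumes n: "1 \<le> n" and g: "g \<in> carrier_mat 3 3"
  shows "subst_char n g = det g ^ ((n + 1) choose 3)"
proof -
  obtain es where es: "char_poly g = (\<Prod>a\<leftarrow>es. [:- a, 1:])" using char_poly_factorized[OF g] by blast
  obtain B where B: "B \<in> carrier_mat 3 3" "upper_triangular B" "similar_mat g B"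
    using schur_decomposition_exists[OF g es] by blast
  obtain P Q where PQ: "similar_mat_wit g B P Q" using B(3) unfolding similar_mat_def by blast
  note w = similar_mat_witD2[OF g PQ]
  have ut: "B $$ (i, j) = 0" if "i < 3" "j < i" for i j using B(1,2) that by auto
  have "subst_char n g = subst_char n (P * B) * subst_char n Q"
    unfolding w(3) by (rule subst_char_mult[OF n mult_carrier_mat[OF w(6) w(5)] w(7)])
  also have "\<dots> = subst_char n B * (subst_char n P * subst_char n Q)" by (simp add: subst_char_mult[OF n w(6) w(5)])
  also have "subst_char n P * subst_char n Q = 1"
    unfolding subst_char_mult[OF n w(6) w(7), symmetric] w(1) by (subst subst_char_diag[OF n one_carrier_mat]) auto
  finally have "subst_char n g = (B $$ (0, 0) * B $$ (1, 1) * B $$ (2, 2)) ^ ((n + 1) choose 3)"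
    using subst_char_upper_triangular[OF n B(1) ut] by simp
  moreover have "det B = B $$ (0, 0) * B $$ (1, 1) * B $$ (2, 2)"
    unfolding det_upper_triangular[OF B(2,1)] using B(1) by (simp add: diag_mat_def numeral_3_eq_3 numeral_2_eq_2)
  ultimately show ?thesis using det_similar[OF B(3)] by simp
qed

lemma grassmannian_form_chow_poly:
  assumes n: "1 \<le> n"
  shows "grassmannian_form 3 ((n + 1) choose 2) ((n + 1) choose 3) (chow_poly n)"
  unfolding grassmannian_form_def
proof (intro conjI ballI impI)
  show "poly_vars (chow_poly n) \<subseteq> {..<3} \<times> {..<(n + 1) choose 2}"
    unfolding poly_vars_def using keys_chow_poly(1)[OF n] by blast
  show "stiefel_value (chow_poly n) (g * M) = det g ^ ((n + 1) choose 3) * stiefel_value (chow_poly n) M"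
    if "g \<in> carrier_mat 3 3" "M \<in> carrier_mat 3 ((n + 1) choose 2)" for g M
    using stiefel_value_mult[OF n that] subst_char_eq_det_power[OF n that(1)] by simp
qed

section \<open>The Chow form\<close>

text \<open>Rank \<open>k\<close> yields \<open>k\<close> independent columns of \<open>M\<close>; they form an invertible matrix whose
  transpose kills \<open>y\<close>.\<close>

lemma full_rank_transpose_injective:
  fixes M :: "complex mat"
  assumes M: "M \<in> carrier_mat k m" and rk: "vec_space.rank k M = k" and y: "y \<in> carrier_vec k" "transpose_mat M *\<^sub>v y = 0\<^sub>v m"
  shows "y = 0\<^sub>v k"
proof (rule ccontr)
  interpret vec_space "TYPE(complex)" k .
  assume y0: "y \<noteq> 0\<^sub>v k"
  obtain S where S: "maximal S (\<lambda>T. T \<subseteq> set (cols M) \<and> lin_indpt T)"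
    using maximal_exists[of "(\<lambda>T. T \<subseteq> set (cols M) \<and> lin_indpt T)" "card (set (cols M))" "{}"]
    by (meson List.finite_set card_mono empty_iff empty_subsetI finite_lin_indpt2 rev_finite_subset)
  have card: "card S = k" using rank_card_indpt[OF M S] rk by simp
  have SM: "S \<subseteq> set (cols M)" and ind: "lin_indpt S" using S by (auto simp: maximal_def)
  have "finite S" using SM finite_subset by blast
  then obtain xs where xs: "set xs = S" "distinct xs" using finite_distinct_list by blast
  have len: "length xs = k" using card xs distinct_card by fastforce
  have car: "set xs \<subseteq> carrier_vec k" using SM xs(1) cols_dim[of M] M by auto
  define B where "B = mat_of_cols k xs"
  have B: "B \<in> carrier_mat k k" using len by (simp add: B_def mat_of_cols_def)
  have cols: "cols B = xs" unfolding B_def by (rule cols_mat_of_cols[OF car])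
  have "rank B = k" using lin_indpt_full_rank[OF B] xs ind by (simp add: cols)
  then have "det B \<noteq> 0" using det_rank_iff[OF B] by simp
  moreover have Bt: "transpose_mat B \<in> carrier_mat k k" using B by simp
  moreover have "transpose_mat B *\<^sub>v y = 0\<^sub>v k"
  proof (rule eq_vecI)
    fix i assume "i < dim_vec (0\<^sub>v k :: complex vec)"
    then have i: "i < k" by simp
    have "col B i = xs ! i" using cols i len B by (metis carrier_matD(2) cols_nth)
    moreover have "xs ! i \<in> set (cols M)" using SM xs(1) i len nth_mem by blast
    ultimately obtain j where j: "j < m" "col B i = col M j" using M by (auto simp: cols_def)
    have "(transpose_mat B *\<^sub>v y) $ i = col B i \<bullet> y" using B i y by (simp add: index_mult_mat_vec)
    also have "\<dots> = (transpose_mat M *\<^sub>v y) $ j" using M j by (simp add: index_mult_mat_vec)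
    also have "\<dots> = 0" using y(2) j by simp
    finally show "(transpose_mat B *\<^sub>v y) $ i = 0\<^sub>v k $ i" using i by simp
  qed (use B in simp)
  then have "det (transpose_mat B) = 0" using det_0_iff_vec_prod_zero_field[OF Bt] y(1) y0 by blast
  ultimately show False using det_transpose[OF B] by simp
qed

lemma sym_coords_inject:
  fixes A B :: "complex mat"
  assumes "A \<in> carrier_mat n n" "transpose_mat A = A" "B \<in> carrier_mat n n" "transpose_mat B = B" and eq: "sym_coords n A = sym_coords n B"
  shows "A = B"
proof (rule eq_matI)
  have up: "A $$ (i, j) = B $$ (i, j)" if "i \<le> j" "j < n" for i j
  proof -
    have "sym_coords n C $ pair_index i j = C $$ (i, j)" for C :: "complex mat"
      using pair_index_less[OF that] upper_pairs_nth_pair_index[OF that] by (simp add: sym_coords_def)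
    then show ?thesis using eq by metis
  qed
  fix i j assume "i < dim_row B" "j < dim_col B"
  then have ij: "i < n" "j < n" using assms by auto
  show "A $$ (i, j) = B $$ (i, j)"
    using up[of i j] up[of j i] symmetric_index[OF assms(2,1) ij] symmetric_index[OF assms(4,3) ij] ij by (cases "i \<le> j") auto
qed (use assms in auto)

lemma sym_coords_mem_corank2_variety_iff:
  assumes n: "0 < n" and B: "B \<in> carrier_mat n n" "transpose_mat B = B"
  shows "sym_coords n B \<in> corank2_variety n \<longleftrightarrow> adj_mat B = 0\<^sub>m n n"
proof -
  have "corank2_variety n = sym_coords n ` {C \<in> sym_mats n. adj_mat C = 0\<^sub>m n n}"
    unfolding corank2_variety_def
    by (intro arg_cong[where f = "image (sym_coords n)"] Collect_cong conj_cong refl minors_eq_0_iff_adj_mat_eq_0[OF _ n])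
      (auto simp: sym_mats_def)
  then have "sym_coords n B \<in> corank2_variety n \<longleftrightarrow> (\<exists>C\<in>{C \<in> sym_mats n. adj_mat C = 0\<^sub>m n n}. sym_coords n B = sym_coords n C)"
    by (simp only: image_iff)
  also have "\<dots> \<longleftrightarrow> adj_mat B = 0\<^sub>m n n"
  proof
    assume "\<exists>C\<in>{C \<in> sym_mats n. adj_mat C = 0\<^sub>m n n}. sym_coords n B = sym_coords n C"
    then obtain C where C: "C \<in> sym_mats n" "adj_mat C = 0\<^sub>m n n" "sym_coords n B = sym_coords n C" by blast
    have "B = C" by (rule sym_coords_inject[OF B _ _ C(3)]) (use C(1) in \<open>simp_all add: sym_mats_def\<close>)
    then show "adj_mat B = 0\<^sub>m n n" using C(2) by (simp only:)
  next
    assume "adj_mat B = 0\<^sub>m n n"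
    then have "B \<in> {C \<in> sym_mats n. adj_mat C = 0\<^sub>m n n}" using B by (simp add: sym_mats_def)
    then show "\<exists>C\<in>{C \<in> sym_mats n. adj_mat C = 0\<^sub>m n n}. sym_coords n B = sym_coords n C" by blast
  qed
  finally show ?thesis .
qed

lemma vec_3_ne_zero_iff:
  assumes "y \<in> carrier_vec 3"
  shows "y \<noteq> 0\<^sub>v 3 \<longleftrightarrow> y $ 0 \<noteq> 0 \<or> y $ 1 \<noteq> 0 \<or> y $ 2 \<noteq> 0"
proof -
  have "y = 0\<^sub>v 3 \<longleftrightarrow> (\<forall>k<3. y $ k = 0)" using assms by (auto simp: Matrix.vec_eq_iff)
  also have "\<dots> \<longleftrightarrow> y $ 0 = 0 \<and> y $ 1 = 0 \<and> y $ 2 = 0"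
    by (simp add: numeral_3_eq_3 numeral_2_eq_2 less_Suc_eq all_conj_distrib)
  finally show ?thesis by blast
qed

text \<open>For \<open>M\<close> of rank 3, the vectors in the row space are the points of the net spanned by the
  rows of \<open>M\<close>, and a nonzero vector of the row space comes from a nonzero point.\<close>

lemma chow_form_chow_poly:
  assumes n: "2 \<le> n"
  shows "chow_form 3 ((n + 1) choose 2) (corank2_variety n) (chow_poly n)"
  unfolding chow_form_def
proof (intro conjI ballI impI)
  let ?m = "(n + 1) choose 2"
  have n1: "1 \<le> n" and n0: "0 < n" using n by auto
  show "\<exists>d. grassmannian_form 3 ?m d (chow_poly n)" using grassmannian_form_chow_poly[OF n1] by blast
  show "Factorial_Ring.irreducible (chow_poly n)" by (rule irreducible_chow_poly[OF n])
  fix M :: "complex mat" assume M: "M \<in> carrier_mat 3 ?m" and rk: "vec_space.rank 3 M = 3"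
  define A where "A y = net_point (sym_row n M 0) (sym_row n M 1) (sym_row n M 2) (y $ 0) (y $ 1) (y $ 2)" for y :: "complex vec"
  have A: "A y \<in> carrier_mat n n" "transpose_mat (A y) = A y" for y
    unfolding A_def
    by (rule net_point_carrier[OF sym_of_carrier sym_of_carrier sym_of_carrier],
      rule net_point_symmetric[OF sym_of_carrier sym_of_symmetric sym_of_carrier sym_of_symmetric sym_of_carrier sym_of_symmetric])
  have Mt: "transpose_mat M \<in> carrier_mat ?m 3" using M by simp
  have coords: "sym_coords n (A y) = transpose_mat M *\<^sub>v y" if y: "y \<in> carrier_vec 3" for y
  proof (rule eq_vecI)
    fix r assume "r < dim_vec (transpose_mat M *\<^sub>v y)"
    then have r: "r < ?m" using M by simp
    obtain i j where ij: "upper_pairs n ! r = (i, j)" "i \<le> j" "j < n" "pair_index i j = r" using r by (rule upper_pairs_nthE)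
    have i: "i < n" using ij by simp
    have "sym_coords n (A y) $ r = A y $$ (i, j)" using r ij by (simp add: sym_coords_def)
    also have "\<dots> = y $ 0 * M $$ (0, r) + y $ 1 * M $$ (1, r) + y $ 2 * M $$ (2, r)"
      unfolding A_def net_point_index[OF sym_of_carrier sym_of_carrier sym_of_carrier i ij(3)] using i ij by (simp add: sym_of_def)
    also have "\<dots> = (transpose_mat M *\<^sub>v y) $ r"
      unfolding index_mult_mat_vec_sum[OF Mt y r] sum_3 using M r by (simp add: mult.commute)
    finally show "sym_coords n (A y) $ r = (transpose_mat M *\<^sub>v y) $ r" .
  qed (use M in \<open>simp add: sym_coords_def\<close>)
  have rs: "vec_space.row_space ?m M = {w \<in> carrier_vec ?m. \<exists>y\<in>carrier_vec 3. transpose_mat M *\<^sub>v y = w}"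
    using vec_space.row_space_eq[OF M] M by simp
  have zero_iff: "stiefel_value (chow_poly n) M = 0 \<longleftrightarrow> (\<exists>y\<in>carrier_vec 3. y \<noteq> 0\<^sub>v 3 \<and> adj_mat (A y) = 0\<^sub>m n n)"
  proof -
    have "stiefel_value (chow_poly n) M = 0 \<longleftrightarrow> (\<exists>a b c. (a \<noteq> 0 \<or> b \<noteq> 0 \<or> c \<noteq> 0) \<and>
        adj_mat (net_point (sym_row n M 0) (sym_row n M 1) (sym_row n M 2) a b c) = 0\<^sub>m n n)"
      unfolding stiefel_value_chow_poly[OF n1]
      by (rule det_chow_mat_eq_0_iff[OF n1 sym_of_carrier sym_of_symmetric sym_of_carrier sym_of_symmetric sym_of_carrier sym_of_symmetric])
    also have "\<dots> \<longleftrightarrow> (\<exists>y\<in>carrier_vec 3. y \<noteq> 0\<^sub>v 3 \<and> adj_mat (A y) = 0\<^sub>m n n)"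
    proof (intro iffI; elim exE bexE conjE)
      fix a b c
      assume abc: "a \<noteq> 0 \<or> b \<noteq> 0 \<or> c \<noteq> 0"
        "adj_mat (net_point (sym_row n M 0) (sym_row n M 1) (sym_row n M 2) a b c) = 0\<^sub>m n n"
      define y where "y = vec 3 (point3 a b c)"
      have y: "y \<in> carrier_vec 3" unfolding y_def by (rule vec_carrier)
      have yk: "y $ 0 = a" "y $ 1 = b" "y $ 2 = c" by (simp_all add: y_def point3_def)
      have "y \<noteq> 0\<^sub>v 3" unfolding vec_3_ne_zero_iff[OF y] yk by (rule abc(1))
      moreover have "adj_mat (A y) = 0\<^sub>m n n" unfolding A_def yk by (rule abc(2))
      ultimately show "\<exists>y\<in>carrier_vec 3. y \<noteq> 0\<^sub>v 3 \<and> adj_mat (A y) = 0\<^sub>m n n" using y by blast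
    next
      fix y :: "complex vec"
      assume y: "y \<in> carrier_vec 3" "y \<noteq> 0\<^sub>v 3" "adj_mat (A y) = 0\<^sub>m n n"
      show "\<exists>a b c. (a \<noteq> 0 \<or> b \<noteq> 0 \<or> c \<noteq> 0) \<and> adj_mat (net_point (sym_row n M 0) (sym_row n M 1) (sym_row n M 2) a b c) = 0\<^sub>m n n"
        by (intro exI conjI, rule y(2)[unfolded vec_3_ne_zero_iff[OF y(1)]], rule y(3)[unfolded A_def])
    qed
    finally show ?thesis .
  qed
  have mem: "transpose_mat M *\<^sub>v y \<in> corank2_variety n \<longleftrightarrow> adj_mat (A y) = 0\<^sub>m n n" if "y \<in> carrier_vec 3" for y
    using sym_coords_mem_corank2_variety_iff[OF n0 A[of y]] coords[OF that] by simp
  have nz: "transpose_mat M *\<^sub>v y \<noteq> 0\<^sub>v ?m \<longleftrightarrow> y \<noteq> 0\<^sub>v 3" if "y \<in> carrier_vec 3" for y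
    using full_rank_transpose_injective[OF M rk that] mult_mat_zero_vec[OF Mt] by blast
  show "stiefel_value (chow_poly n) M = 0 \<longleftrightarrow> (\<exists>v\<in>vec_space.row_space ?m M. v \<noteq> 0\<^sub>v ?m \<and> v \<in> corank2_variety n)"
    unfolding zero_iff rs using mem nz mult_mat_vec_carrier[OF Mt] by blast
qed

lemma invertible_mat_iff_det_nonzero:
  fixes A :: "'a::field mat"
  assumes A: "A \<in> carrier_mat m m"
  shows "invertible_mat A \<longleftrightarrow> det A \<noteq> 0"
proof
  assume "invertible_mat A"
  then obtain B where B: "A * B = 1\<^sub>m m" "B * A = 1\<^sub>m (dim_row B)"
    using A unfolding invertible_mat_def inverts_mat_def by auto
  have "B \<in> carrier_mat m m"
  proof -
    have "dim_col (A * B) = m" unfolding B(1) by simp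
    moreover have "dim_col (B * A) = dim_row B" unfolding B(2) by simp
    ultimately show ?thesis using A by auto
  qed
  then show "det A \<noteq> 0" using det_mult[OF A, of B] B(1) by auto
next
  assume d: "det A \<noteq> 0"
  have aA: "adj_mat A \<in> carrier_mat m m" by (rule adj_mat(1)[OF A])
  define B where "B = inverse (det A) \<cdot>\<^sub>m adj_mat A"
  have B: "B \<in> carrier_mat m m" using aA by (simp add: B_def)
  have one: "inverse (det A) \<cdot>\<^sub>m (det A \<cdot>\<^sub>m 1\<^sub>m m) = 1\<^sub>m m" using d by (intro eq_matI) auto
  have "A * B = 1\<^sub>m m" unfolding B_def mult_smult_distrib[OF A aA] adj_mat(2)[OF A] by (rule one)
  moreover have "B * A = 1\<^sub>m m" unfolding B_def mult_smult_assoc_mat[OF aA A] adj_mat(3)[OF A] by (rule one)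
  ultimately show "invertible_mat A" using A B unfolding invertible_mat_def inverts_mat_def by auto
qed

lemma chow_mat_singular_iff:
  fixes X Y Z :: "complex mat"
  assumes n: "2 \<le> n" and X: "X \<in> sym_mats n" and Y: "Y \<in> sym_mats n" and Z: "Z \<in> sym_mats n"
    and indep: "\<And>a b c. a \<cdot>\<^sub>m X + b \<cdot>\<^sub>m Y + c \<cdot>\<^sub>m Z = 0\<^sub>m n n \<Longrightarrow> a = 0 \<and> b = 0 \<and> c = 0"
  shows "\<not> invertible_mat (chow_mat n X Y Z) \<longleftrightarrow>
    (\<exists>M \<in> {a \<cdot>\<^sub>m X + b \<cdot>\<^sub>m Y + c \<cdot>\<^sub>m Z | a b c. True} - {0\<^sub>m n n}. vec_space.rank n M \<le> n - 2)"
proof -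
  have n1: "1 \<le> n" using n by simp
  have X': "X \<in> carrier_mat n n" "transpose_mat X = X" and Y': "Y \<in> carrier_mat n n" "transpose_mat Y = Y"
    and Z': "Z \<in> carrier_mat n n" "transpose_mat Z = Z" using X Y Z by (auto simp: sym_mats_def)
  have N: "a \<cdot>\<^sub>m X + b \<cdot>\<^sub>m Y + c \<cdot>\<^sub>m Z \<in> carrier_mat n n" for a b c using X' Y' Z' by simp
  have z: "a \<cdot>\<^sub>m X + b \<cdot>\<^sub>m Y + c \<cdot>\<^sub>m Z = 0\<^sub>m n n \<longleftrightarrow> a = 0 \<and> b = 0 \<and> c = 0" for a b c
  proof
    assume "a = 0 \<and> b = 0 \<and> c = 0"
    then show "a \<cdot>\<^sub>m X + b \<cdot>\<^sub>m Y + c \<cdot>\<^sub>m Z = 0\<^sub>m n n" using X' Y' Z' by (intro eq_matI) auto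
  qed (rule indep)
  have "\<not> invertible_mat (chow_mat n X Y Z) \<longleftrightarrow>
      (\<exists>a b c. (a \<noteq> 0 \<or> b \<noteq> 0 \<or> c \<noteq> 0) \<and> adj_mat (net_point X Y Z a b c) = 0\<^sub>m n n)"
    unfolding invertible_mat_iff_det_nonzero[OF chow_mat_carrier] not_not by (rule det_chow_mat_eq_0_iff[OF n1 X' Y' Z'])
  also have "\<dots> \<longleftrightarrow> (\<exists>a b c. a \<cdot>\<^sub>m X + b \<cdot>\<^sub>m Y + c \<cdot>\<^sub>m Z \<noteq> 0\<^sub>m n n \<and> vec_space.rank n (a \<cdot>\<^sub>m X + b \<cdot>\<^sub>m Y + c \<cdot>\<^sub>m Z) \<le> n - 2)"
    unfolding net_point_def rank_le_iff_adj_mat_eq_0[OF N n, symmetric] z de_Morgan_conj by (rule refl)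
  also have "\<dots> \<longleftrightarrow> (\<exists>M \<in> {a \<cdot>\<^sub>m X + b \<cdot>\<^sub>m Y + c \<cdot>\<^sub>m Z | a b c. True} - {0\<^sub>m n n}. vec_space.rank n M \<le> n - 2)"
    by blast
  finally show ?thesis .
qed

theorem lemma6p4:
  fixes n :: nat
  assumes "n \<ge> 3"
  shows "(\<forall>X \<in> sym_mats n. \<forall>Y \<in> sym_mats n. \<forall>Z \<in> sym_mats n.
            (\<forall>a b c :: complex.
               a \<cdot>\<^sub>m X + b \<cdot>\<^sub>m Y + c \<cdot>\<^sub>m Z = 0\<^sub>m n n \<longrightarrow> a = 0 \<and> b = 0 \<and> c = 0) \<longrightarrow>
            (\<not> invertible_mat (chow_mat n X Y Z) \<longleftrightarrow>
             (\<exists>M \<in> {a \<cdot>\<^sub>m X + b \<cdot>\<^sub>m Y + c \<cdot>\<^sub>m Z | a b c. True} - {0\<^sub>m n n}.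
                vec_space.rank n M \<le> n - 2)))
       \<and> (\<exists>F k. chow_form 3 ((n + 1) choose 2) (corank2_variety n) F \<and> k \<noteq> 0 \<and>
            det (chow_mat n (generic_sym_mat n 0) (generic_sym_mat n 1) (generic_sym_mat n 2))
              = Const k * F)"
proof (intro conjI ballI impI)
  have n: "2 \<le> n" using assms by simp
  fix X Y Z :: "complex mat"
  assume XYZ: "X \<in> sym_mats n" "Y \<in> sym_mats n" "Z \<in> sym_mats n"
    and indep: "\<forall>a b c. a \<cdot>\<^sub>m X + b \<cdot>\<^sub>m Y + c \<cdot>\<^sub>m Z = 0\<^sub>m n n \<longrightarrow> a = 0 \<and> b = 0 \<and> c = 0"
  show "\<not> invertible_mat (chow_mat n X Y Z) \<longleftrightarrow>
    (\<exists>M \<in> {a \<cdot>\<^sub>m X + b \<cdot>\<^sub>m Y + c \<cdot>\<^sub>m Z | a b c. True} - {0\<^sub>m n n}. vec_space.rank n M \<le> n - 2)"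
    by (rule chow_mat_singular_iff[OF n XYZ]) (use indep in blast)
next
  have n: "2 \<le> n" using assms by simp
  have "det (chow_mat n (generic_sym_mat n 0) (generic_sym_mat n 1) (generic_sym_mat n 2)) = Const 1 * chow_poly n"
    by (simp add: chow_poly_def Const_def)
  then show "\<exists>F k. chow_form 3 ((n + 1) choose 2) (corank2_variety n) F \<and> k \<noteq> 0 \<and>
      det (chow_mat n (generic_sym_mat n 0) (generic_sym_mat n 1) (generic_sym_mat n 2)) = Const k * F"
    using chow_form_chow_poly[OF n] zero_neq_one[symmetric] by blast
qed

end
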